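(* Let $G$ be a simple plane graph, let $J$ be its line graph, and let $k:=\max\{15,\Delta(G)\}$. If $L$ is a $k$-assignment for $J$, then $J$ is $L$-swappable.
   Context: A list assignment $L$ for a graph assigns to each vertex $v$ a set $L(v)$ of colors; it is a $k$-assignment if $|L(v)|=k$ for all $v$. An $L$-coloring is a proper coloring $\varphi$ with $\varphi(v)\in L(v)$ for all $v$. An $\alpha,\beta$-Kempe swap interchanges colors $\alpha,\beta$ on one connected component of the subgraph induced by vertices colored $\alpha$ or $\beta$; it is $L$-valid for $\varphi$ if the result is again an $L$-coloring. A graph is $L$-swappable if every two of its $L$-colorings can be transformed into each other by a sequence of $L$-valid Kempe swaps. A plane graph is a planar graph with a fixed planar embedding. The line graph has vertex set $E(G)$, two edges adjacent iff they share an endpoint. *)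

theory Defs
  imports "HOL-Analysis.Analysis" "HOL-Combinatorics.Transposition"
begin

type_synonym 'v graph = "'v set \<times> 'v set set"

abbreviation verts :: "'v graph \<Rightarrow> 'v set" where
  "verts G \<equiv> fst G"

abbreviation edges :: "'v graph \<Rightarrow> 'v set set" where
  "edges G \<equiv> snd G"

definition simple_graph :: "'v graph \<Rightarrow> bool" where
  "simple_graph G \<longleftrightarrow>
     finite (verts G) \<and> (\<forall>e\<in>edges G. e \<subseteq> verts G \<and> card e = 2)"

definition vdegree :: "'v graph \<Rightarrow> 'v \<Rightarrow> nat" where
  "vdegree G v = card {e \<in> edges G. v \<in> e}"

text \<open>Inserting 0 only matters for the graph without vertices.\<close>

definition max_degree :: "'v graph \<Rightarrow> nat" where
  "max_degree G = Max (insert 0 (vdegree G ` verts G))"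

text \<open>The plane is \<^typ>\<open>complex\<close>. Vertices are drawn as distinct points and every edge as a
  simple arc joining the points of its two ends; the interior of such an arc contains neither
  a vertex nor a point of another edge.\<close>

definition planar_embedding ::
    "'v graph \<Rightarrow> ('v \<Rightarrow> complex) \<Rightarrow> ('v set \<Rightarrow> real \<Rightarrow> complex) \<Rightarrow> bool" where
  "planar_embedding G pos \<gamma> \<longleftrightarrow>
     inj_on pos (verts G) \<and>
     (\<forall>e\<in>edges G.
        arc (\<gamma> e) \<and>
        {pathstart (\<gamma> e), pathfinish (\<gamma> e)} = pos ` e \<and>
        (path_image (\<gamma> e) - pos ` e) \<inter> pos ` verts G = {} \<and>
        (\<forall>f\<in>edges G. f \<noteq> e \<longrightarrow> (path_image (\<gamma> e) - pos ` e) \<inter> path_image (\<gamma> f) = {}))"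

definition simple_plane_graph ::
    "'v graph \<Rightarrow> ('v \<Rightarrow> complex) \<Rightarrow> ('v set \<Rightarrow> real \<Rightarrow> complex) \<Rightarrow> bool" where
  "simple_plane_graph G pos \<gamma> \<longleftrightarrow> simple_graph G \<and> planar_embedding G pos \<gamma>"

definition line_graph :: "'v graph \<Rightarrow> 'v set graph" where
  "line_graph G =
     (edges G, {{e, f} | e f. e \<in> edges G \<and> f \<in> edges G \<and> e \<noteq> f \<and> e \<inter> f \<noteq> {}})"

definition adj :: "'v graph \<Rightarrow> 'v rel" where
  "adj G = {(u, v). {u, v} \<in> edges G}"

definition induced_subgraph :: "'v graph \<Rightarrow> 'v set \<Rightarrow> 'v graph" where
  "induced_subgraph G S = (verts G \<inter> S, {e \<in> edges G. e \<subseteq> S})"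

text \<open>Vertex sets of the connected components.\<close>

definition conn_components :: "'v graph \<Rightarrow> 'v set set" where
  "conn_components G = verts G // (adj G)\<^sup>*"

definition k_assignment :: "nat \<Rightarrow> 'v graph \<Rightarrow> ('v \<Rightarrow> 'c set) \<Rightarrow> bool" where
  "k_assignment k G L \<longleftrightarrow> (\<forall>v\<in>verts G. finite (L v) \<and> card (L v) = k)"

text \<open>Colorings are taken extensional, so that two colorings are equal iff they agree on
  all vertices.\<close>

definition L_colorings :: "'v graph \<Rightarrow> ('v \<Rightarrow> 'c set) \<Rightarrow> ('v \<Rightarrow> 'c) set" where
  "L_colorings G L = {\<phi> \<in> Pi\<^sub>E (verts G) L. \<forall>(u, v) \<in> adj G. \<phi> u \<noteq> \<phi> v}"

definition swap_on :: "'c \<Rightarrow> 'c \<Rightarrow> 'v set \<Rightarrow> ('v \<Rightarrow> 'c) \<Rightarrow> 'v \<Rightarrow> 'c" where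
  "swap_on \<alpha> \<beta> C \<phi> = (\<lambda>v. if v \<in> C then Transposition.transpose \<alpha> \<beta> (\<phi> v) else \<phi> v)"

definition kempe_swap :: "'v graph \<Rightarrow> ('v \<Rightarrow> 'c) \<Rightarrow> ('v \<Rightarrow> 'c) \<Rightarrow> bool" where
  "kempe_swap G \<phi> \<psi> \<longleftrightarrow>
     (\<exists>\<alpha> \<beta>. \<alpha> \<noteq> \<beta> \<and>
        (\<exists>C \<in> conn_components (induced_subgraph G {v \<in> verts G. \<phi> v = \<alpha> \<or> \<phi> v = \<beta>}).
           \<psi> = swap_on \<alpha> \<beta> C \<phi>))"

definition valid_swap_rel :: "'v graph \<Rightarrow> ('v \<Rightarrow> 'c set) \<Rightarrow> ('v \<Rightarrow> 'c) rel" where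
  "valid_swap_rel G L =
     {(\<phi>, \<psi>). \<phi> \<in> L_colorings G L \<and> \<psi> \<in> L_colorings G L \<and> kempe_swap G \<phi> \<psi>}"

definition L_swappable :: "'v graph \<Rightarrow> ('v \<Rightarrow> 'c set) \<Rightarrow> bool" where
  "L_swappable G L \<longleftrightarrow>
     (\<forall>\<phi>\<in>L_colorings G L. \<forall>\<psi>\<in>L_colorings G L. (\<phi>, \<psi>) \<in> (valid_swap_rel G L)\<^sup>*)"

end

theory Submission
  imports Defs
begin

text \<open>Call two list colourings related if they differ pointwise by exchanging two fixed colours
  \<open>\<alpha>\<close>, \<open>\<beta>\<close>. Such a pair is joined by Kempe swaps of single components, so it suffices to
  connect colourings by related pairs, and related pairs can be extended to further vertices like
  ordinary list colourings: a vertex with fewer neighbours than colours can always be added.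

  Hence an edge \<open>xy\<close> with \<open>d x + d y \<le> k + 1\<close> can be deleted. If there is none, then every vertex of
  degree two has two neighbours of degree \<open>k\<close>, and discharging shows that the multigraph on these
  neighbours whose edges are the vertices of degree two has average degree more than three. It
  contains a bridgeless part with at least two independent cycles and one more edge at one of its
  vertices. The edges of \<open>G\<close> along that part, together with one pendant edge \<open>b\<close>, have as many
  colours as neighbours. Every pair of related colourings outside extends to them, because even
  cycles can be coloured from lists of length two, and \<open>b\<close> has a shorter list than its neighbours,
  which makes all extensions of one colouring equivalent.

  Discharging needs the edge bounds for planar and planar bipartite graphs. They come from counting
  the components of the complement of the drawing with the Jordan curve theorem and Janiszewski's
  theorem.\<close>

section \<open>Pairs of list colourings\<close>

text \<open>An exchange of two colours on part of the graph need not carry over to a larger part: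
  its Kempe chain may reach a vertex whose list lacks the other colour. So the colours of both
  colourings are chosen together at each new vertex. Counting still works, because a vertex whose
  colour is neither \<open>\<alpha>\<close> nor \<open>\<beta>\<close> has the same colour in both.

  The constant 15 comes from the discharging. A neighbour of a vertex of degree two has degree
  \<open>k\<close>, hence surplus \<open>k - 6\<close>; six units of it are reserved for vertices of
  degree three to five, and three more must remain, to be weighed against two units for each vertex
  of degree two.

  The resulting density, more than 3/2 edges per vertex, is enough to give up one edge of a minimal
  such multigraph. A minimal part with \<open>3 * card (W Y) \<le> 2 * card Y + 1\<close> that
  avoids this edge has at least two edges across every cut and cannot be the whole multigraph, which
  supplies the pendant edge.\<close>

definition flip :: "'c \<Rightarrow> 'c \<Rightarrow> 'c \<Rightarrow> 'c \<Rightarrow> bool" where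
  "flip \<alpha> \<beta> c d \<longleftrightarrow> c = d \<or> (c = \<alpha> \<and> d = \<beta>) \<or> (c = \<beta> \<and> d = \<alpha>)"

lemma flip_refl [simp]: "flip \<alpha> \<beta> c c"
  by (simp add: flip_def)

lemma flip_sym: "flip \<alpha> \<beta> c d \<Longrightarrow> flip \<alpha> \<beta> d c"
  by (auto simp: flip_def)

lemma flip_pair [simp]: "flip \<alpha> \<beta> \<alpha> \<beta>" "flip \<alpha> \<beta> \<beta> \<alpha>"
  by (auto simp: flip_def)

lemma flip_fixes: "flip \<alpha> \<beta> c d \<Longrightarrow> c \<notin> {\<alpha>, \<beta>} \<or> d \<notin> {\<alpha>, \<beta>} \<Longrightarrow> c = d"
  by (auto simp: flip_def)

text \<open>A colour outside \<open>{\<alpha>, \<beta>}\<close> is used by the same vertices in both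
  colourings, so it is free in both or in neither. If all such colours of \<open>M\<close> are
  taken, counting leaves fewer vertices of \<open>N\<close> coloured from
  \<open>{\<alpha>, \<beta>}\<close> than \<open>M\<close> has of these two colours, hence at most
  one vertex; the colour it does not use, chosen separately in each colouring, is then free.\<close>

lemma flip_pair_choice:
  assumes "finite N" "finite M" "card N < card M"
    and flips: "\<And>u. u \<in> N \<Longrightarrow> flip \<alpha> \<beta> (\<phi> u) (\<psi> u)"
  shows "\<exists>x\<in>M. \<exists>y\<in>M. flip \<alpha> \<beta> x y \<and> (\<forall>u\<in>N. \<phi> u \<noteq> x \<and> \<psi> u \<noteq> y)"
proof (cases "\<exists>c\<in>M - {\<alpha>, \<beta>}. c \<notin> \<phi> ` N")
  case True
  then obtain c where c: "c \<in> M" "c \<notin> {\<alpha>, \<beta>}" "c \<notin> \<phi> ` N" by auto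
  have "\<psi> u \<noteq> c" if "u \<in> N" for u
    using flip_fixes[OF flips[OF that]] c that by (metis imageI)
  then show ?thesis using c by (intro bexI[of _ c]) auto
next
  case False
  define P where "P = {u \<in> N. \<phi> u \<in> {\<alpha>, \<beta>}}"
  have "M - {\<alpha>, \<beta>} \<subseteq> \<phi> ` (N - P)" using False by (auto simp: P_def)
  then have "card (M - {\<alpha>, \<beta>}) \<le> card (N - P)"
    using assms(1) by (meson card_image_le card_mono finite_Diff finite_imageI order_trans)
  moreover have "card N = card P + card (N - P)"
  proof -
    have "P \<subseteq> N" by (auto simp: P_def)
    then show ?thesis using assms(1)
      by (metis add.commute card_Diff_subset card_mono finite_subset le_add_diff_inverse)
  qed
  moreover have "card M = card (M \<inter> {\<alpha>, \<beta>}) + card (M - {\<alpha>, \<beta>})"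
    using card_Un_disjoint[of "M \<inter> {\<alpha>, \<beta>}" "M - {\<alpha>, \<beta>}"] assms(2)
    by (simp add: Int_Diff_Un Int_Diff_disjoint)
  ultimately have PM: "card P < card (M \<inter> {\<alpha>, \<beta>})" using assms(3) by linarith
  have finP: "finite P" using assms(1) by (auto simp: P_def)
  have mem: "\<phi> u \<in> {\<alpha>, \<beta>} \<longleftrightarrow> \<psi> u \<in> {\<alpha>, \<beta>}" if "u \<in> N" for u
    using flips[OF that] by (auto simp: flip_def)
  show ?thesis
  proof (cases "P = {}")
    case True
    from PM obtain c where c: "c \<in> M" "c \<in> {\<alpha>, \<beta>}" by (metis Int_iff card_gt_0_iff ex_in_conv gr_zeroI not_less0)
    have "\<phi> u \<noteq> c \<and> \<psi> u \<noteq> c" if "u \<in> N" for u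
      using mem[OF that] that True c(2) unfolding P_def by blast
    then show ?thesis using c by (intro bexI[of _ c]) auto
  next
    case False
    then have "card P \<ge> 1" using finP by (simp add: Suc_leI card_gt_0_iff)
    moreover have le2: "card (M \<inter> {\<alpha>, \<beta>}) \<le> card {\<alpha>, \<beta>}" by (intro card_mono) auto
    moreover have "card {\<alpha>, \<beta>} \<le> 2" by (simp add: card_insert_if)
    ultimately have "card P = 1" and full: "card (M \<inter> {\<alpha>, \<beta>}) = card {\<alpha>, \<beta>}" and two: "card {\<alpha>, \<beta>} = 2"
      using PM by linarith+
    then obtain u0 where u0: "P = {u0}" by (auto simp: card_1_singleton_iff)
    have ab: "\<alpha> \<noteq> \<beta>" using two by auto
    have "M \<inter> {\<alpha>, \<beta>} = {\<alpha>, \<beta>}" using full by (intro card_subset_eq) auto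
    then have abM: "\<alpha> \<in> M" "\<beta> \<in> M" by auto
    have u0N: "u0 \<in> N" "\<phi> u0 \<in> {\<alpha>, \<beta>}" using u0 by (auto simp: P_def)
    have others: "\<phi> u \<notin> {\<alpha>, \<beta>} \<and> \<psi> u \<notin> {\<alpha>, \<beta>}" if "u \<in> N" "u \<noteq> u0" for u
      using that u0 mem[OF that(1)] by (auto simp: P_def)
    define x where "x = (if \<phi> u0 = \<alpha> then \<beta> else \<alpha>)"
    define y where "y = (if \<psi> u0 = \<alpha> then \<beta> else \<alpha>)"
    have xy: "x \<in> {\<alpha>, \<beta>}" "y \<in> {\<alpha>, \<beta>}" "x \<noteq> \<phi> u0" "y \<noteq> \<psi> u0"
      using ab u0N by (auto simp: x_def y_def)
    have "flip \<alpha> \<beta> x y" using xy(1,2) by (auto simp: flip_def)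
    moreover have "\<phi> u \<noteq> x \<and> \<psi> u \<noteq> y" if "u \<in> N" for u
      using others[OF that] xy by (cases "u = u0") auto
    ultimately show ?thesis using xy abM by blast
  qed
qed

lemma ex_max_card_subset:
  assumes "finite S" "P T0" "\<And>T. P T \<Longrightarrow> T \<subseteq> S"
  shows "\<exists>T. P T \<and> (\<forall>T'. P T' \<longrightarrow> card T' \<le> card T)"
proof -
  have "\<forall>T. P T \<longrightarrow> card T < Suc (card S)"
    using assms by (simp add: card_mono less_Suc_eq_le)
  then show ?thesis using ex_has_greatest_nat[of P T0 card] assms(2) by blast
qed

section \<open>List colourings of a symmetric graph up to two-colour exchanges\<close>

locale sym_graph =
  fixes E :: "'a \<Rightarrow> 'a \<Rightarrow> bool"
  assumes sym: "E u v \<Longrightarrow> E v u" and irrefl: "\<not> E v v"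
begin

definition nb :: "'a \<Rightarrow> 'a set \<Rightarrow> 'a set" where
  "nb v A = {u \<in> A. E v u}"

definition col :: "'a set \<Rightarrow> ('a \<Rightarrow> 'c set) \<Rightarrow> ('a \<Rightarrow> 'c) \<Rightarrow> bool" where
  "col A L \<phi> \<longleftrightarrow> (\<forall>v\<in>A. \<phi> v \<in> L v) \<and> (\<forall>u\<in>A. \<forall>v\<in>A. E u v \<longrightarrow> \<phi> u \<noteq> \<phi> v)"

definition flips :: "'c \<Rightarrow> 'c \<Rightarrow> 'a set \<Rightarrow> ('a \<Rightarrow> 'c) \<Rightarrow> ('a \<Rightarrow> 'c) \<Rightarrow> bool" where
  "flips \<alpha> \<beta> A \<phi> \<psi> \<longleftrightarrow> (\<forall>v\<in>A. flip \<alpha> \<beta> (\<phi> v) (\<psi> v))"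

definition step :: "'a set \<Rightarrow> ('a \<Rightarrow> 'c set) \<Rightarrow> ('a \<Rightarrow> 'c) rel" where
  "step A L = {(\<phi>, \<psi>). col A L \<phi> \<and> col A L \<psi> \<and> (\<exists>\<alpha> \<beta>. flips \<alpha> \<beta> A \<phi> \<psi>)}"

definition eqv :: "'a set \<Rightarrow> ('a \<Rightarrow> 'c set) \<Rightarrow> ('a \<Rightarrow> 'c) rel" where
  "eqv A L = (step A L)\<^sup>*"

definition swappable :: "'a set \<Rightarrow> ('a \<Rightarrow> 'c set) \<Rightarrow> bool" where
  "swappable A L \<longleftrightarrow> (\<forall>\<phi> \<psi>. col A L \<phi> \<longrightarrow> col A L \<psi> \<longrightarrow> (\<phi>, \<psi>) \<in> eqv A L)"

lemma finite_nb [simp]: "finite A \<Longrightarrow> finite (nb v A)"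
  by (simp add: nb_def)

lemma nb_mono: "A \<subseteq> B \<Longrightarrow> nb v A \<subseteq> nb v B"
  by (auto simp: nb_def)

lemma flips_sym: "flips \<alpha> \<beta> A \<phi> \<psi> \<Longrightarrow> flips \<alpha> \<beta> A \<psi> \<phi>"
  by (auto simp: flips_def intro: flip_sym)

lemma col_mono: "col B L \<phi> \<Longrightarrow> A \<subseteq> B \<Longrightarrow> col A L \<phi>"
  by (auto simp: col_def)

lemma col_cong: "(\<And>v. v \<in> A \<Longrightarrow> \<phi> v = \<psi> v) \<Longrightarrow> col A L \<phi> \<longleftrightarrow> col A L \<psi>"
  by (auto simp: col_def)

lemma eqv_refl [simp]: "(\<phi>, \<phi>) \<in> eqv A L"
  by (simp add: eqv_def)

lemma eqv_trans [trans]: "(\<phi>, \<psi>) \<in> eqv A L \<Longrightarrow> (\<psi>, \<eta>) \<in> eqv A L \<Longrightarrow> (\<phi>, \<eta>) \<in> eqv A L"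
  by (simp add: eqv_def)

lemma step_sym: "(\<phi>, \<psi>) \<in> step A L \<Longrightarrow> (\<psi>, \<phi>) \<in> step A L"
  by (auto simp: step_def intro: flips_sym)

lemma eqv_sym: "(\<phi>, \<psi>) \<in> eqv A L \<Longrightarrow> (\<psi>, \<phi>) \<in> eqv A L"
  using step_sym by (metis eqv_def symD symI sym_rtrancl)

lemma step_eqv: "(\<phi>, \<psi>) \<in> step A L \<Longrightarrow> (\<phi>, \<psi>) \<in> eqv A L"
  by (auto simp: eqv_def)

lemma eqv_if_agree:
  assumes "col A L \<phi>" "\<And>v. v \<in> A \<Longrightarrow> \<phi> v = \<psi> v"
  shows "(\<phi>, \<psi>) \<in> eqv A L"
proof -
  \<comment> \<open>Any two colours would do, since equal colours are always related.\<close>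
  have "flips undefined undefined A \<phi> \<psi>" using assms(2) by (simp add: flips_def)
  then have "(\<phi>, \<psi>) \<in> step A L" using assms col_cong[of A \<phi> \<psi> L] by (auto simp: step_def)
  then show ?thesis by (rule step_eqv)
qed

text \<open>The two colours of \<open>v\<close> itself serve as the exchanged pair.\<close>

lemma eqv_if_agree_except_one:
  assumes "col A L \<phi>" "col A L \<psi>" "\<And>u. u \<in> A - {v} \<Longrightarrow> \<phi> u = \<psi> u"
  shows "(\<phi>, \<psi>) \<in> eqv A L"
proof -
  have "flip (\<phi> v) (\<psi> v) (\<phi> u) (\<psi> u)" if "u \<in> A" for u
    using assms(3)[of u] that by (cases "u = v") auto
  then have "(\<phi>, \<psi>) \<in> step A L" using assms by (auto simp: step_def flips_def)
  then show ?thesis by (rule step_eqv)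
qed

lemma swappable_empty: "swappable {} L"
  unfolding swappable_def by (intro allI impI eqv_if_agree) auto

lemma col_insertI:
  assumes "col A L \<phi>" "v \<notin> A" "x \<in> L v" "\<And>u. u \<in> nb v A \<Longrightarrow> \<phi> u \<noteq> x"
  shows "col (insert v A) L (\<phi>(v := x))"
proof -
  have "\<phi> u \<noteq> x" if "u \<in> A" "E u v \<or> E v u" for u
    using that assms(4)[of u] sym by (auto simp: nb_def)
  then show ?thesis using assms(1-3) irrefl[of v] by (auto simp: col_def)
qed

text \<open>A sequence of steps outside \<open>H\<close> is followed on all of \<open>V\<close>:
  \<open>lift\<close> supplies a step above each of its steps, and \<open>same\<close> moves between
  different extensions of one outer colouring, both between two lifted steps and at the end.\<close>

lemma swappable_by_lifting:
  assumes H: "H \<subseteq> V"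
    and sw: "swappable (V - H) L"
    and lift: "\<And>\<alpha> \<beta> \<phi> \<psi>. col (V - H) L \<phi> \<Longrightarrow> col (V - H) L \<psi> \<Longrightarrow> flips \<alpha> \<beta> (V - H) \<phi> \<psi> \<Longrightarrow>
      \<exists>\<phi>' \<psi>'. col V L \<phi>' \<and> col V L \<psi>' \<and> flips \<alpha> \<beta> V \<phi>' \<psi>' \<and>
        (\<forall>u\<in>V - H. \<phi>' u = \<phi> u \<and> \<psi>' u = \<psi> u)"
    and same: "\<And>\<phi> \<psi>. col V L \<phi> \<Longrightarrow> col V L \<psi> \<Longrightarrow> (\<forall>u\<in>V - H. \<phi> u = \<psi> u) \<Longrightarrow> (\<phi>, \<psi>) \<in> eqv V L"
  shows "swappable V L"
  unfolding swappable_def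
proof (intro allI impI)
  fix \<phi> \<psi> assume cols: "col V L \<phi>" "col V L \<psi>"
  have main: "\<forall>\<phi>'. col V L \<phi>' \<longrightarrow> (\<forall>u\<in>V - H. \<phi>' u = \<theta> u) \<longrightarrow>
      (\<exists>\<psi>'. col V L \<psi>' \<and> (\<forall>u\<in>V - H. \<psi>' u = \<theta>' u) \<and> (\<phi>', \<psi>') \<in> eqv V L)"
    if "(\<theta>, \<theta>') \<in> (step (V - H) L)\<^sup>*" for \<theta> \<theta>'
    using that
  proof (induction rule: rtrancl_induct)
    case base
    then show ?case by (metis eqv_refl)
  next
    case (step \<theta>1 \<theta>2)
    show ?case
    proof (intro allI impI)
      fix \<phi>' assume "col V L \<phi>'" "\<forall>u\<in>V - H. \<phi>' u = \<theta> u"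
      then obtain \<psi>1 where \<psi>1: "col V L \<psi>1" "\<forall>u\<in>V - H. \<psi>1 u = \<theta>1 u" "(\<phi>', \<psi>1) \<in> eqv V L"
        using step.IH by blast
      obtain \<alpha> \<beta> where "col (V - H) L \<theta>1" "col (V - H) L \<theta>2" "flips \<alpha> \<beta> (V - H) \<theta>1 \<theta>2"
        using step.hyps by (auto simp: step_def)
      then obtain \<phi>2 \<psi>2 where 2: "col V L \<phi>2" "col V L \<psi>2" "flips \<alpha> \<beta> V \<phi>2 \<psi>2"
        "\<forall>u\<in>V - H. \<phi>2 u = \<theta>1 u \<and> \<psi>2 u = \<theta>2 u" using lift by blast
      have "(\<psi>1, \<phi>2) \<in> eqv V L" using same \<psi>1 2 by simp
      moreover have "(\<phi>2, \<psi>2) \<in> eqv V L" using 2 by (intro step_eqv) (auto simp: step_def)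
      ultimately show "\<exists>\<psi>'. col V L \<psi>' \<and> (\<forall>u\<in>V - H. \<psi>' u = \<theta>2 u) \<and> (\<phi>', \<psi>') \<in> eqv V L"
        using \<psi>1(3) 2 by (meson eqv_trans)
    qed
  qed
  have "(\<phi>, \<psi>) \<in> (step (V - H) L)\<^sup>*"
    using sw cols col_mono[of V L _ "V - H"] by (simp add: swappable_def eqv_def)
  from main[OF this] cols obtain \<psi>' where "col V L \<psi>'" "\<forall>u\<in>V - H. \<psi>' u = \<psi> u" "(\<phi>, \<psi>') \<in> eqv V L"
    by blast
  then show "(\<phi>, \<psi>) \<in> eqv V L" using same cols by (meson eqv_trans)
qed

text \<open>\<open>flip_pair_choice\<close> lifts every step to the new vertex, and two extensions
  of one colouring differ only at \<open>v\<close>.\<close>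

lemma swappable_insert:
  assumes "finite A" "v \<notin> A" "finite (L v)" "card (nb v A) < card (L v)" "swappable A L"
  shows "swappable (insert v A) L"
proof (rule swappable_by_lifting[where H = "{v}"])
  have eq: "insert v A - {v} = A" using assms(2) by auto
  show "swappable (insert v A - {v}) L" using assms(5) eq by simp
  fix \<phi> \<psi> and \<alpha> \<beta>
  assume *: "col (insert v A - {v}) L \<phi>" "col (insert v A - {v}) L \<psi>" "flips \<alpha> \<beta> (insert v A - {v}) \<phi> \<psi>"
  have "flip \<alpha> \<beta> (\<phi> u) (\<psi> u)" if "u \<in> nb v A" for u
    using *(3) that assms(2) by (auto simp: nb_def flips_def)
  from flip_pair_choice[OF finite_nb[OF assms(1)] assms(3,4), of \<alpha> \<beta> \<phi> \<psi>, OF this]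
  obtain x y where xy: "x \<in> L v" "y \<in> L v" "flip \<alpha> \<beta> x y" "\<forall>u\<in>nb v A. \<phi> u \<noteq> x \<and> \<psi> u \<noteq> y"
    by blast
  show "\<exists>\<phi>' \<psi>'. col (insert v A) L \<phi>' \<and> col (insert v A) L \<psi>' \<and> flips \<alpha> \<beta> (insert v A) \<phi>' \<psi>' \<and>
        (\<forall>u\<in>insert v A - {v}. \<phi>' u = \<phi> u \<and> \<psi>' u = \<psi> u)"
    using xy * eq assms(2)
    by (intro exI[of _ "\<phi>(v := x)"] exI[of _ "\<psi>(v := y)"]) (auto simp: flips_def intro: col_insertI)
qed (auto intro: eqv_if_agree_except_one)

text \<open>Once the colours of outer neighbours are struck from the lists on \<open>S\<close>,
  every step on \<open>S\<close> remains a step when the common outer colouring is put back.\<close>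

lemma eqv_fix_outside:
  assumes "S \<subseteq> A" "col A L \<phi>" "col A L \<psi>" "\<And>v. v \<in> A - S \<Longrightarrow> \<phi> v = \<psi> v"
    and sw: "swappable S (\<lambda>s. L s - \<phi> ` nb s (A - S))"
  shows "(\<phi>, \<psi>) \<in> eqv A L"
proof -
  define L' where "L' = (\<lambda>s. L s - \<phi> ` nb s (A - S))"
  define ext where "ext \<theta> = (\<lambda>v. if v \<in> S then \<theta> v else \<phi> v)" for \<theta>
  have colS: "col S L' \<theta>" if "col A L \<theta>" "\<And>v. v \<in> A - S \<Longrightarrow> \<phi> v = \<theta> v" for \<theta>
    using that assms(1) unfolding col_def L'_def nb_def by fastforce
  have colA: "col A L (ext \<theta>)" if "col S L' \<theta>" for \<theta>
    unfolding col_def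
  proof (intro conjI ballI impI)
    fix v assume "v \<in> A" then show "ext \<theta> v \<in> L v"
      using that assms(2) by (auto simp: col_def ext_def L'_def)
  next
    fix u v assume uv: "u \<in> A" "v \<in> A" "E u v"
    have avoid: "\<theta> x \<noteq> \<phi> y" if "x \<in> S" "y \<in> A - S" "E x y" for x y
      using \<open>col S L' \<theta>\<close> that by (auto simp: col_def L'_def nb_def)
    show "ext \<theta> u \<noteq> ext \<theta> v"
      using avoid[of u v] avoid[of v u] uv sym[OF uv(3)] assms(2) that
      by (cases "u \<in> S"; cases "v \<in> S") (auto simp: col_def ext_def)
  qed
  have "(ext \<theta>, ext \<theta>') \<in> eqv A L" if "(\<theta>, \<theta>') \<in> (step S L')\<^sup>*" for \<theta> \<theta>'
    using that
  proof (induction rule: rtrancl_induct)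
    case (step \<theta>1 \<theta>2)
    then obtain \<alpha> \<beta> where "col S L' \<theta>1" "col S L' \<theta>2" "flips \<alpha> \<beta> S \<theta>1 \<theta>2" by (auto simp: step_def)
    then have "(ext \<theta>1, ext \<theta>2) \<in> step A L"
      unfolding step_def using colA
      by (intro CollectI case_prodI conjI exI[of _ \<alpha>] exI[of _ \<beta>]) (auto simp: flips_def ext_def)
    then show ?case using step.IH step_eqv eqv_trans by blast
  qed simp
  moreover have "(\<phi>, \<psi>) \<in> (step S L')\<^sup>*"
    using sw colS assms(2-4) unfolding swappable_def eqv_def L'_def by simp
  ultimately have 1: "(ext \<phi>, ext \<psi>) \<in> eqv A L" by blast
  have "(\<phi>, ext \<phi>) \<in> eqv A L" by (rule eqv_if_agree) (use assms in \<open>auto simp: ext_def\<close>)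
  moreover have "(\<psi>, ext \<psi>) \<in> eqv A L" by (rule eqv_if_agree) (use assms in \<open>auto simp: ext_def\<close>)
  ultimately show ?thesis using 1 eqv_sym eqv_trans by blast
qed

text \<open>\<open>R\<close> is a union of connected components of the subgraph induced by \<open>S\<close>.\<close>

definition closed_in :: "'a set \<Rightarrow> 'a set \<Rightarrow> bool" where
  "closed_in R S \<longleftrightarrow> R \<subseteq> S \<and> (\<forall>u\<in>R. nb u S \<subseteq> R)"

text \<open>The vertices are inserted in an order that ends with \<open>z\<close>, and every other
  vertex comes before one of its neighbours. It then has fewer neighbours present than colours, and
  \<open>z\<close> does so by assumption. \<open>T\<close> is the final segment of the order, grown
  backwards from \<open>z\<close>; \<open>conn\<close> makes it exhaust \<open>S\<close>.\<close>

lemma swappable_if_surplus: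
  assumes fin: "finite S" and finL: "\<And>s. s \<in> S \<Longrightarrow> finite (L s)"
    and deg: "\<And>s. s \<in> S \<Longrightarrow> card (nb s S) \<le> card (L s)"
    and z: "z \<in> S" "card (nb z S) < card (L z)"
    and conn: "\<And>R. closed_in R S \<Longrightarrow> z \<in> R \<Longrightarrow> R = S"
  shows "swappable S L"
proof -
  define good where "good T \<longleftrightarrow> T \<subseteq> S \<and> z \<in> T \<and> (swappable (S - T) L \<longrightarrow> swappable S L)" for T
  have le: "card (nb s (S - T)) \<le> card (nb s S)" for s T
    using fin by (intro card_mono finite_nb nb_mono) auto
  have "good {z}"
  proof -
    have "swappable (insert z (S - {z})) L" if "swappable (S - {z}) L"
      by (rule swappable_insert) (use that z fin finL le[of z "{z}"] in auto)
    then show ?thesis using z by (auto simp: good_def insert_absorb)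
  qed
  then obtain T where T: "good T" and max: "\<And>T'. good T' \<Longrightarrow> card T' \<le> card T"
    using ex_max_card_subset[OF fin, of good "{z}"] unfolding good_def by blast
  have "closed_in T S"
    unfolding closed_in_def
  proof (intro conjI ballI subsetI)
    show "x \<in> S" if "x \<in> T" for x using T that by (auto simp: good_def)
    fix u s assume u: "u \<in> T" and s: "s \<in> nb u S"
    show "s \<in> T"
    proof (rule ccontr)
      assume "s \<notin> T"
      have sS: "s \<in> S" "E s u" using s sym by (auto simp: nb_def)
      have "nb s (S - insert s T) \<subset> nb s S"
        using sS u T by (auto simp: nb_def good_def)
      then have lt: "card (nb s (S - insert s T)) < card (L s)"
        using deg[OF sS(1)] fin by (meson finite_nb order_less_le_trans psubset_card_mono)
      have "swappable S L" if "swappable (S - insert s T) L"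
      proof -
        have "swappable (insert s (S - insert s T)) L"
          by (rule swappable_insert) (use that fin finL sS lt in auto)
        also have "insert s (S - insert s T) = S - T" using sS \<open>s \<notin> T\<close> by auto
        finally show ?thesis using T by (simp add: good_def)
      qed
      then have "good (insert s T)" using T sS by (auto simp: good_def)
      from max[OF this] show False
        using \<open>s \<notin> T\<close> T fin finite_subset by (fastforce simp: good_def)
    qed
  qed
  then have "T = S" using conn T by (auto simp: good_def)
  then show ?thesis using T swappable_empty[of L] by (simp add: good_def)
qed

end

section \<open>Extending pairs of colourings\<close>

text \<open>If some colour \<open>c\<close> outside \<open>{\<alpha>, \<beta>}\<close> is offered at a position but not at its predecessor,
  give it to that position and choose greedily around the cycle. Otherwise one colour can be used on
  all even positions.\<close>

lemma even_cycle_pairs: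
  fixes \<Omega> :: "nat \<Rightarrow> ('c \<times> 'c) set"
  assumes N: "even N" "N > 0"
    and fl: "\<And>i x y. i < N \<Longrightarrow> (x, y) \<in> \<Omega> i \<Longrightarrow> flip \<alpha> \<beta> x y"
    and avoid: "\<And>i x y. i < N \<Longrightarrow> flip \<alpha> \<beta> x y \<Longrightarrow> \<exists>x' y'. (x', y') \<in> \<Omega> i \<and> x' \<noteq> x \<and> y' \<noteq> y"
  shows "\<exists>f g. \<forall>i<N. (f i, g i) \<in> \<Omega> i \<and> f i \<noteq> f (Suc i mod N) \<and> g i \<noteq> g (Suc i mod N)"
proof -
  have alternating: ?thesis
    if "flip \<alpha> \<beta> x y" "\<And>i. i < N \<Longrightarrow> even i \<Longrightarrow> (x, y) \<in> \<Omega> i" for x y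
  proof -
    have "\<forall>i. \<exists>p. i < N \<longrightarrow> p \<in> \<Omega> i \<and> fst p \<noteq> x \<and> snd p \<noteq> y"
      using avoid[OF _ that(1)] by fastforce
    then obtain q where q: "\<And>i. i < N \<Longrightarrow> q i \<in> \<Omega> i \<and> fst (q i) \<noteq> x \<and> snd (q i) \<noteq> y" by metis
    define r where "r i = (if even i then (x, y) else q i)" for i
    have par: "even (Suc i mod N) \<longleftrightarrow> odd i" if "i < N" for i
      using N(1) by (metis dvd_mod_iff even_Suc)
    have "(fst (r i), snd (r i)) \<in> \<Omega> i \<and> fst (r i) \<noteq> fst (r (Suc i mod N)) \<and> snd (r i) \<noteq> snd (r (Suc i mod N))"
      if "i < N" for i
      using q[OF that] q[of "Suc i mod N"] N(2) par[OF that] \<open>\<And>i. i < N \<Longrightarrow> even i \<Longrightarrow> (x, y) \<in> \<Omega> i\<close> that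
      by (cases "even i") (auto simp: r_def)
    then show ?thesis by (intro exI[of _ "fst \<circ> r"] exI[of _ "snd \<circ> r"]) simp
  qed
  show ?thesis
  proof (cases "\<exists>c. c \<notin> {\<alpha>, \<beta>} \<and> (\<exists>i<N. (c, c) \<in> \<Omega> i)")
    case True
    then obtain c k where c: "c \<notin> {\<alpha>, \<beta>}" and k: "k < N" "(c, c) \<in> \<Omega> k" by auto
    show ?thesis
    proof (cases "\<forall>i<N. (c, c) \<in> \<Omega> (Suc i mod N) \<longrightarrow> (c, c) \<in> \<Omega> i")
      case True
      \<comment> \<open>If \<open>c\<close> passes from every position to its predecessor, then it
        is offered all around the cycle.\<close>
      have down: "(c, c) \<in> \<Omega> (j - m)" if "j < N" "(c, c) \<in> \<Omega> j" "m \<le> j" for j m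
        using that(3)
      proof (induction m)
        case (Suc m)
        then have "Suc (j - Suc m) mod N = j - m" using that(1) by (simp add: Suc_diff_Suc)
        then show ?case using True Suc that(1) by (metis Suc_leD diff_le_self le_less_trans)
      qed (use that in simp)
      have "(c, c) \<in> \<Omega> 0" using down[OF k, of k] by simp
      then have "(c, c) \<in> \<Omega> (N - 1)" using True N(2) by (metis Suc_diff_1 diff_less mod_self zero_less_one)
      then have "(c, c) \<in> \<Omega> i" if "i < N" for i
        using down[of "N - 1" "N - 1 - i"] that by simp
      then show ?thesis using alternating[of c c] by simp
    next
      case False
      then obtain i where i: "i < N" "(c, c) \<in> \<Omega> (Suc i mod N)" "(c, c) \<notin> \<Omega> i" by auto
      \<comment> \<open>The positions are renumbered to begin right after \<open>i\<close>, so that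
        \<open>i\<close> itself comes last.\<close>
      define pos where "pos j = (Suc i + j) mod N" for j
      have posN: "pos j < N" for j using N(2) by (simp add: pos_def)
      have "\<exists>s. s 0 = (c, c) \<and> (\<forall>j. s (Suc j) \<in> \<Omega> (pos (Suc j)) \<and>
          (s j \<in> \<Omega> (pos j) \<longrightarrow> fst (s (Suc j)) \<noteq> fst (s j) \<and> snd (s (Suc j)) \<noteq> snd (s j)))"
      proof -
        have "\<exists>p'. p' \<in> \<Omega> (pos (Suc j)) \<and> (p \<in> \<Omega> (pos j) \<longrightarrow> fst p' \<noteq> fst p \<and> snd p' \<noteq> snd p)" for p j
          using avoid[OF posN, of "fst p" "snd p" "Suc j"] avoid[OF posN, of \<alpha> \<alpha> "Suc j"] fl[OF posN, of "fst p" "snd p" j]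
          by (cases "p \<in> \<Omega> (pos j)") auto
        then obtain nx where nx: "\<And>p j. nx j p \<in> \<Omega> (pos (Suc j)) \<and>
            (p \<in> \<Omega> (pos j) \<longrightarrow> fst (nx j p) \<noteq> fst p \<and> snd (nx j p) \<noteq> snd p)" by metis
        show ?thesis by (rule exI[of _ "rec_nat (c, c) nx"]) (use nx in simp)
      qed
      then obtain s where s0: "s 0 = (c, c)" and s1: "\<And>j. s (Suc j) \<in> \<Omega> (pos (Suc j))"
        and s2: "\<And>j. s j \<in> \<Omega> (pos j) \<Longrightarrow> fst (s (Suc j)) \<noteq> fst (s j) \<and> snd (s (Suc j)) \<noteq> snd (s j)"
        by blast
      have sin: "s j \<in> \<Omega> (pos j)" for j
        using s0 s1 i(2) by (cases j) (auto simp: pos_def)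
      \<comment> \<open>The walk closes up: a related pair with \<open>c\<close> in one component
        must be \<open>(c, c)\<close>, and position \<open>i\<close> does not offer that
        pair.\<close>
      have last: "fst (s (N - 1)) \<noteq> fst (s 0) \<and> snd (s (N - 1)) \<noteq> snd (s 0)"
      proof -
        have "pos (N - 1) = i" using i(1) N(2) by (simp add: pos_def)
        then have "s (N - 1) \<in> \<Omega> i" "flip \<alpha> \<beta> (fst (s (N - 1))) (snd (s (N - 1)))"
          using sin[of "N - 1"] fl[OF i(1), of "fst (s (N - 1))" "snd (s (N - 1))"] by auto
        then show ?thesis using i(3) c s0 flip_fixes by (metis fst_conv prod.collapse snd_conv)
      qed
      define inv where "inv p = (p + (N - Suc i)) mod N" for p
      have inv: "inv p < N" "pos (inv p) = p" if "p < N" for p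
      proof -
        have "pos (inv p) = (Suc i + (p + (N - Suc i))) mod N"
          unfolding pos_def inv_def by (rule mod_add_right_eq)
        also have "\<dots> = (p + N) mod N" using i(1) by (intro arg_cong[of _ _ "\<lambda>x. x mod N"]) simp
        finally show "pos (inv p) = p" using that by simp
      qed (use N(2) in \<open>simp add: inv_def\<close>)
      have inv_Suc: "inv (Suc p mod N) = Suc (inv p) mod N" if "p < N" for p
        unfolding inv_def by (simp add: mod_simps)
      have "(fst (s (inv p)), snd (s (inv p))) \<in> \<Omega> p \<and> fst (s (inv p)) \<noteq> fst (s (inv (Suc p mod N)))
          \<and> snd (s (inv p)) \<noteq> snd (s (inv (Suc p mod N)))" if "p < N" for p
      proof (cases "Suc (inv p) = N")
        case True
        then have "inv p = N - 1" "inv (Suc p mod N) = 0" using inv_Suc[OF that] by auto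
        then show ?thesis using last sin[of "inv p"] inv[OF that] by simp
      next
        case False
        then have "inv (Suc p mod N) = Suc (inv p)" using inv_Suc[OF that] inv[OF that] by auto
        then show ?thesis using s2[OF sin, of "inv p"] sin[of "inv p"] inv[OF that] by auto
      qed
      then show ?thesis by (intro exI[of _ "\<lambda>p. fst (s (inv p))"] exI[of _ "\<lambda>p. snd (s (inv p))"]) simp
    qed
  next
    case False
    \<comment> \<open>With no colour outside \<open>{\<alpha>, \<beta>}\<close> on offer, a pair
      that avoids \<open>\<beta>\<close> in both components can only be
      \<open>(\<alpha>, \<alpha>)\<close>.\<close>
    have "(\<alpha>, \<alpha>) \<in> \<Omega> i" if i: "i < N" for i
    proof -
      obtain x y where xy: "(x, y) \<in> \<Omega> i" "x \<noteq> \<beta>" "y \<noteq> \<beta>" using avoid[OF i, of \<beta> \<beta>] by auto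
      have "flip \<alpha> \<beta> x y" using fl[OF i xy(1)] .
      then have "x = y" using xy(2,3) by (auto simp: flip_def)
      then show ?thesis using xy False i by auto
    qed
    then show ?thesis using alternating[of \<alpha> \<alpha>] by simp
  qed
qed

context sym_graph
begin

text \<open>\<open>T\<close> can safely be left to the end. Quantifying over every intermediate
  \<open>U\<close> lets the other vertices be coloured before \<open>T\<close> in any order;
  \<open>U0\<close> carries a prescribed pair of colourings, and nothing is prescribed if it is
  empty.\<close>

definition extends ::
    "'a set \<Rightarrow> ('a \<Rightarrow> 'c set) \<Rightarrow> 'c \<Rightarrow> 'c \<Rightarrow> 'a set \<Rightarrow> ('a \<Rightarrow> 'c) \<Rightarrow> ('a \<Rightarrow> 'c) \<Rightarrow> 'a set \<Rightarrow> bool" where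
  "extends V L \<alpha> \<beta> U0 \<phi>0 \<psi>0 T \<longleftrightarrow> T \<subseteq> V \<and>
     (\<forall>U \<phi> \<psi>. U0 \<subseteq> U \<longrightarrow> U \<subseteq> V - T \<longrightarrow> col U L \<phi> \<longrightarrow> col U L \<psi> \<longrightarrow> flips \<alpha> \<beta> U \<phi> \<psi> \<longrightarrow>
        (\<forall>u\<in>U0. \<phi> u = \<phi>0 u \<and> \<psi> u = \<psi>0 u) \<longrightarrow>
        (\<exists>\<phi>' \<psi>'. col (U \<union> T) L \<phi>' \<and> col (U \<union> T) L \<psi>' \<and> flips \<alpha> \<beta> (U \<union> T) \<phi>' \<psi>' \<and>
           (\<forall>u\<in>U. \<phi>' u = \<phi> u \<and> \<psi>' u = \<psi> u)))"

lemma extendsD: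
  assumes "extends V L \<alpha> \<beta> U0 \<phi>0 \<psi>0 T" "U0 \<subseteq> U" "U \<subseteq> V - T" "col U L \<phi>" "col U L \<psi>" "flips \<alpha> \<beta> U \<phi> \<psi>"
    "\<And>u. u \<in> U0 \<Longrightarrow> \<phi> u = \<phi>0 u \<and> \<psi> u = \<psi>0 u"
  obtains \<phi>' \<psi>' where "col (U \<union> T) L \<phi>'" "col (U \<union> T) L \<psi>'" "flips \<alpha> \<beta> (U \<union> T) \<phi>' \<psi>'"
    "\<And>u. u \<in> U \<Longrightarrow> \<phi>' u = \<phi> u \<and> \<psi>' u = \<psi> u"
proof -
  have "\<exists>\<phi>' \<psi>'. col (U \<union> T) L \<phi>' \<and> col (U \<union> T) L \<psi>' \<and> flips \<alpha> \<beta> (U \<union> T) \<phi>' \<psi>' \<and>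
           (\<forall>u\<in>U. \<phi>' u = \<phi> u \<and> \<psi>' u = \<psi> u)"
    by (rule assms(1)[unfolded extends_def, THEN conjunct2, rule_format, OF assms(2-6)]) (use assms(7) in auto)
  then show ?thesis using that by blast
qed

text \<open>\<open>s\<close> is coloured just before \<open>T\<close>. Its neighbour
  \<open>t\<close> is still uncoloured then, so fewer constraints than colours are present.\<close>

lemma extends_insert:
  assumes T: "extends V L \<alpha> \<beta> U0 \<phi>0 \<psi>0 T" and V: "finite V"
    and s: "s \<in> V" "s \<notin> U0" "s \<notin> T" and t: "t \<in> T" "E s t"
    and L: "finite (L s)" "card (nb s V) \<le> card (L s)"
  shows "extends V L \<alpha> \<beta> U0 \<phi>0 \<psi>0 (insert s T)"
  unfolding extends_def
proof (intro conjI allI impI)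
  have TV: "T \<subseteq> V" using T by (simp add: extends_def)
  then show "insert s T \<subseteq> V" using s by simp
  fix U \<phi> \<psi>
  assume U: "U0 \<subseteq> U" "U \<subseteq> V - insert s T" "col U L \<phi>" "col U L \<psi>" "flips \<alpha> \<beta> U \<phi> \<psi>"
    "\<forall>u\<in>U0. \<phi> u = \<phi>0 u \<and> \<psi> u = \<psi>0 u"
  have finU: "finite U" using U(2) V finite_subset by blast
  have "nb s U \<subset> nb s V" using U(2) t TV by (auto simp: nb_def)
  then have "card (nb s U) < card (L s)"
    using L(2) V by (meson finite_nb order_less_le_trans psubset_card_mono)
  from flip_pair_choice[OF finite_nb[OF finU] L(1) this, of \<alpha> \<beta> \<phi> \<psi>]
  obtain x y where xy: "x \<in> L s" "y \<in> L s" "flip \<alpha> \<beta> x y" "\<forall>u\<in>nb s U. \<phi> u \<noteq> x \<and> \<psi> u \<noteq> y"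
    using U(5) by (auto simp: flips_def nb_def)
  have sU: "s \<notin> U" using U(2) by auto
  obtain \<phi>' \<psi>' where *: "col (insert s U \<union> T) L \<phi>'" "col (insert s U \<union> T) L \<psi>'"
    "flips \<alpha> \<beta> (insert s U \<union> T) \<phi>' \<psi>'"
    "\<And>u. u \<in> insert s U \<Longrightarrow> \<phi>' u = (\<phi>(s := x)) u \<and> \<psi>' u = (\<psi>(s := y)) u"
  proof (rule extendsD[OF T, of "insert s U" "\<phi>(s := x)" "\<psi>(s := y)"])
    show "col (insert s U) L (\<phi>(s := x))" "col (insert s U) L (\<psi>(s := y))"
      using U(3,4) sU xy by (auto intro!: col_insertI)
    show "flips \<alpha> \<beta> (insert s U) (\<phi>(s := x)) (\<psi>(s := y))" using U(5) xy(3) by (auto simp: flips_def)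
  qed (use U s in auto)
  have "insert s U \<union> T = U \<union> insert s T" by auto
  then show "\<exists>\<phi>' \<psi>'. col (U \<union> insert s T) L \<phi>' \<and> col (U \<union> insert s T) L \<psi>' \<and>
      flips \<alpha> \<beta> (U \<union> insert s T) \<phi>' \<psi>' \<and> (\<forall>u\<in>U. \<phi>' u = \<phi> u \<and> \<psi>' u = \<psi> u)"
    using * sU by (intro exI[of _ \<phi>'] exI[of _ \<psi>']) auto
qed

lemma extends_Un:
  assumes T1: "extends V L \<alpha> \<beta> U0 \<phi>0 \<psi>0 T1" and T2: "extends V L \<alpha> \<beta> U0 \<phi>0 \<psi>0 T2"
    and disj: "T1 \<inter> T2 = {}"
  shows "extends V L \<alpha> \<beta> U0 \<phi>0 \<psi>0 (T1 \<union> T2)"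
  unfolding extends_def
proof (intro conjI allI impI)
  have sub: "T1 \<subseteq> V" "T2 \<subseteq> V" using T1 T2 by (auto simp: extends_def)
  then show "T1 \<union> T2 \<subseteq> V" by simp
  fix U \<phi> \<psi>
  assume U: "U0 \<subseteq> U" "U \<subseteq> V - (T1 \<union> T2)" "col U L \<phi>" "col U L \<psi>" "flips \<alpha> \<beta> U \<phi> \<psi>"
    "\<forall>u\<in>U0. \<phi> u = \<phi>0 u \<and> \<psi> u = \<psi>0 u"
  obtain \<phi>1 \<psi>1 where 1: "col (U \<union> T1) L \<phi>1" "col (U \<union> T1) L \<psi>1" "flips \<alpha> \<beta> (U \<union> T1) \<phi>1 \<psi>1"
    "\<And>u. u \<in> U \<Longrightarrow> \<phi>1 u = \<phi> u \<and> \<psi>1 u = \<psi> u"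
    by (rule extendsD[OF T1, of U \<phi> \<psi>]) (use U in auto)
  obtain \<phi>2 \<psi>2 where 2: "col (U \<union> T1 \<union> T2) L \<phi>2" "col (U \<union> T1 \<union> T2) L \<psi>2" "flips \<alpha> \<beta> (U \<union> T1 \<union> T2) \<phi>2 \<psi>2"
    "\<And>u. u \<in> U \<union> T1 \<Longrightarrow> \<phi>2 u = \<phi>1 u \<and> \<psi>2 u = \<psi>1 u"
    by (rule extendsD[OF T2, of "U \<union> T1" \<phi>1 \<psi>1]) (use U 1 sub disj in auto)
  then show "\<exists>\<phi>' \<psi>'. col (U \<union> (T1 \<union> T2)) L \<phi>' \<and> col (U \<union> (T1 \<union> T2)) L \<psi>' \<and>
      flips \<alpha> \<beta> (U \<union> (T1 \<union> T2)) \<phi>' \<psi>' \<and> (\<forall>u\<in>U. \<phi>' u = \<phi> u \<and> \<psi>' u = \<psi> u)"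
    using 1 by (intro exI[of _ \<phi>2] exI[of _ \<psi>2]) (auto simp: Un_assoc)
qed

text \<open>By \<open>extends_insert\<close> a set that can be coloured last grows along edges. A
  largest one inside \<open>S\<close> therefore leaves a union of components, which would contain
  another such set if it were nonempty.\<close>

lemma extends_if_anchored:
  assumes V: "finite V" "S \<subseteq> V - U0"
    and L: "\<And>s. s \<in> S \<Longrightarrow> finite (L s) \<and> card (nb s V) \<le> card (L s)"
    and anchored: "\<And>R. closed_in R S \<Longrightarrow> R \<noteq> {} \<Longrightarrow> \<exists>T. T \<subseteq> R \<and> T \<noteq> {} \<and> extends V L \<alpha> \<beta> U0 \<phi>0 \<psi>0 T"
  shows "extends V L \<alpha> \<beta> U0 \<phi>0 \<psi>0 S"
proof -
  define P where "P T \<longleftrightarrow> T \<subseteq> S \<and> extends V L \<alpha> \<beta> U0 \<phi>0 \<psi>0 T" for T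
  have finS: "finite S" using V finite_subset by blast
  have "P {}" by (auto simp: P_def extends_def)
  then obtain T where T: "P T" and max: "\<And>T'. P T' \<Longrightarrow> card T' \<le> card T"
    using ex_max_card_subset[OF finS, of P "{}"] unfolding P_def by blast
  have finT: "finite T" using T finS finite_subset by (auto simp: P_def)
  have "closed_in (S - T) S"
    unfolding closed_in_def
  proof (intro conjI ballI subsetI)
    fix u s assume u: "u \<in> S - T" and s: "s \<in> nb u S"
    show "s \<in> S - T"
    proof (rule ccontr)
      assume "s \<notin> S - T"
      then have st: "s \<in> T" "E u s" using s by (auto simp: nb_def)
      have "extends V L \<alpha> \<beta> U0 \<phi>0 \<psi>0 (insert u T)"
        by (rule extends_insert[of V L \<alpha> \<beta> U0 \<phi>0 \<psi>0 T u s])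
          (use T u st L[of u] V in \<open>auto simp: P_def\<close>)
      then have "P (insert u T)" using T u by (auto simp: P_def)
      from max[OF this] show False using u finT by auto
    qed
  qed auto
  moreover have False if "closed_in (S - T) S" "S - T \<noteq> {}"
  proof -
    obtain T2 where T2: "T2 \<subseteq> S - T" "T2 \<noteq> {}" "extends V L \<alpha> \<beta> U0 \<phi>0 \<psi>0 T2"
      using anchored[OF \<open>closed_in (S - T) S\<close>] \<open>S - T \<noteq> {}\<close> by blast
    then have "P (T \<union> T2)" using T by (auto simp: P_def intro: extends_Un)
    moreover have "card (T \<union> T2) > card T"
      using T2 finT finS by (intro psubset_card_mono) (auto intro: finite_subset)
    ultimately show False using max leD by blast
  qed
  ultimately have "S = T" using T by (auto simp: P_def)
  then show ?thesis using T by (simp add: P_def)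
qed

text \<open>The equivalence makes the cycle induced, and \<open>N \<ge> 4\<close> makes the two
  neighbours of a position different.\<close>

definition ecycle :: "'a set \<Rightarrow> bool" where
  "ecycle T \<longleftrightarrow> (\<exists>N h. even N \<and> N \<ge> 4 \<and> bij_betw h {..<N::nat} T \<and>
     (\<forall>p<N. \<forall>q<N. E (h p) (h q) \<longleftrightarrow> q = Suc p mod N \<or> p = Suc q mod N))"

lemma ecycle_nonempty:
  assumes "ecycle T"
  shows "T \<noteq> {}"
proof -
  obtain N h where "N \<ge> 4" "bij_betw h {..<N::nat} T" using assms unfolding ecycle_def by blast
  then have "h 0 \<in> T" using bij_betwE[of h "{..<N}" T] by auto
  then show ?thesis by auto
qed

text \<open>Both cycle neighbours of a vertex of \<open>T\<close> are still uncoloured, so after all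
  outer constraints it can avoid one further related pair. This is just what
  \<open>even_cycle_pairs\<close> asks for.\<close>

lemma extends_ecycle:
  assumes "ecycle T" "T \<subseteq> V" "finite V"
    and L: "\<And>s. s \<in> T \<Longrightarrow> finite (L s) \<and> card (nb s V) \<le> card (L s)"
  shows "extends V L \<alpha> \<beta> U0 \<phi>0 \<psi>0 T"
  unfolding extends_def
proof (intro conjI allI impI)
  show "T \<subseteq> V" by fact
  fix U \<phi> \<psi>
  assume U: "U0 \<subseteq> U" "U \<subseteq> V - T" "col U L \<phi>" "col U L \<psi>" "flips \<alpha> \<beta> U \<phi> \<psi>"
    "\<forall>u\<in>U0. \<phi> u = \<phi>0 u \<and> \<psi> u = \<psi>0 u"
  obtain N h where N: "even N" "N \<ge> 4" and bij: "bij_betw h {..<N::nat} T"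
    and adj: "\<And>p q. p < N \<Longrightarrow> q < N \<Longrightarrow> E (h p) (h q) \<longleftrightarrow> q = Suc p mod N \<or> p = Suc q mod N"
    using assms(1) unfolding ecycle_def by blast
  have finU: "finite U" using U(2) assms(3) finite_subset by blast
  have hT: "h p \<in> T" if "p < N" for p using bij that by (auto simp: bij_betw_def)
  have inj: "h p = h q \<longleftrightarrow> p = q" if "p < N" "q < N" for p q
    using bij that by (auto simp: bij_betw_def inj_on_def)
  define \<Omega> where "\<Omega> i = {(x, y). x \<in> L (h i) \<and> y \<in> L (h i) \<and> flip \<alpha> \<beta> x y \<and>
      (\<forall>u\<in>nb (h i) U. \<phi> u \<noteq> x \<and> \<psi> u \<noteq> y)}" for i
  have "\<exists>f g. \<forall>i<N. (f i, g i) \<in> \<Omega> i \<and> f i \<noteq> f (Suc i mod N) \<and> g i \<noteq> g (Suc i mod N)"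
  proof (rule even_cycle_pairs[of N \<Omega> \<alpha> \<beta>])
    fix i x y assume i: "i < N" and xy: "flip \<alpha> \<beta> x y"
    define j where "j = Suc i mod N"
    define l where "l = (i + (N - 1)) mod N"
    have jl: "j < N" "l < N" using N by (auto simp: j_def l_def)
    have lj: "l \<noteq> j" "j \<noteq> i" "l \<noteq> i"
      using i N by (auto simp: j_def l_def mod_if split: if_splits)
    have "Suc l mod N = i" using i N by (simp add: l_def mod_Suc_eq)
    then have El: "E (h i) (h l)" and Ej: "E (h i) (h j)"
      using adj[of i l] adj[of i j] i jl by (auto simp: j_def)
    \<comment> \<open>The next cycle vertex \<open>u\<close> plays the part of one more coloured
      neighbour, with colours \<open>x\<close> and \<open>y\<close>. The previous one,
      \<open>h l\<close>, stays uncoloured and keeps the count strict.\<close>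
    define u where "u = h j"
    have uT: "u \<in> T" "u \<notin> U" using hT jl U(2) by (auto simp: u_def)
    have "insert u (nb (h i) U) \<subset> nb (h i) V"
    proof
      show "insert u (nb (h i) U) \<subseteq> nb (h i) V"
        using U(2) uT assms(2) Ej by (auto simp: nb_def u_def)
      have "h l \<in> nb (h i) V" "h l \<noteq> u" "h l \<notin> U"
        using hT[OF jl(2)] assms(2) El inj[OF jl(2,1)] lj U(2) by (auto simp: nb_def u_def)
      then show "insert u (nb (h i) U) \<noteq> nb (h i) V" by (auto simp: nb_def)
    qed
    then have lt: "card (insert u (nb (h i) U)) < card (L (h i))"
      using L[OF hT[OF i]] assms(3) by (meson finite_nb order_less_le_trans psubset_card_mono)
    have "\<exists>x'\<in>L (h i). \<exists>y'\<in>L (h i). flip \<alpha> \<beta> x' y' \<and>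
        (\<forall>v\<in>insert u (nb (h i) U). (\<phi>(u := x)) v \<noteq> x' \<and> (\<psi>(u := y)) v \<noteq> y')"
      by (rule flip_pair_choice) (use lt finU L[OF hT[OF i]] xy U(5) in \<open>auto simp: flips_def nb_def\<close>)
    then obtain x' y' where x'y': "x' \<in> L (h i)" "y' \<in> L (h i)" "flip \<alpha> \<beta> x' y'"
      "\<And>v. v \<in> insert u (nb (h i) U) \<Longrightarrow> (\<phi>(u := x)) v \<noteq> x' \<and> (\<psi>(u := y)) v \<noteq> y'" by blast
    have "\<phi> v \<noteq> x' \<and> \<psi> v \<noteq> y'" if "v \<in> nb (h i) U" for v
      using x'y'(4)[of v] that uT(2) by (auto simp: nb_def split: if_splits)
    then show "\<exists>x' y'. (x', y') \<in> \<Omega> i \<and> x' \<noteq> x \<and> y' \<noteq> y"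
      using x'y' x'y'(4)[of u] by (auto simp: \<Omega>_def)
  qed (use N in \<open>auto simp: \<Omega>_def\<close>)
  then obtain f g where fg: "\<And>i. i < N \<Longrightarrow> (f i, g i) \<in> \<Omega> i"
    "\<And>i. i < N \<Longrightarrow> f i \<noteq> f (Suc i mod N) \<and> g i \<noteq> g (Suc i mod N)" by blast
  define k where "k = the_inv_into {..<N} h"
  have k: "k t < N" "h (k t) = t" if "t \<in> T" for t
    using that bij the_inv_into_into[of h "{..<N}" t] f_the_inv_into_f[of h "{..<N}" t]
    by (auto simp: k_def bij_betw_def)
  define \<phi>' where "\<phi>' v = (if v \<in> T then f (k v) else \<phi> v)" for v
  define \<psi>' where "\<psi>' v = (if v \<in> T then g (k v) else \<psi> v)" for v
  have ninT: "u \<notin> T" if "u \<in> U" for u using U(2) that by auto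
  have TT: "f (k s) \<noteq> f (k t) \<and> g (k s) \<noteq> g (k t)" if "s \<in> T" "t \<in> T" "E s t" for s t
  proof -
    have "k t = Suc (k s) mod N \<or> k s = Suc (k t) mod N"
      using adj[of "k s" "k t"] k[OF that(1)] k[OF that(2)] that(3) by simp
    then show ?thesis using fg(2)[OF k(1)[OF that(1)]] fg(2)[OF k(1)[OF that(2)]] by metis
  qed
  have TU: "f (k s) \<noteq> \<phi> u \<and> g (k s) \<noteq> \<psi> u" if "s \<in> T" "u \<in> U" "E s u" for s u
    using fg(1)[OF k(1)[OF that(1)]] k(2)[OF that(1)] that by (auto simp: \<Omega>_def nb_def)
  have TL: "f (k s) \<in> L s \<and> g (k s) \<in> L s \<and> flip \<alpha> \<beta> (f (k s)) (g (k s))" if "s \<in> T" for s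
    using fg(1)[OF k(1)[OF that]] k(2)[OF that] by (auto simp: \<Omega>_def)
  have "col (U \<union> T) L \<phi>'"
    unfolding col_def
  proof (intro conjI ballI impI)
    fix u v assume uv: "u \<in> U \<union> T" "v \<in> U \<union> T" "E u v"
    then show "\<phi>' u \<noteq> \<phi>' v"
      using TT[of u v] TU[of u v] TU[of v u] sym[OF uv(3)] U(3) ninT
      by (auto simp: \<phi>'_def col_def)
  qed (use U(3) TL ninT in \<open>auto simp: \<phi>'_def col_def\<close>)
  moreover have "col (U \<union> T) L \<psi>'"
    unfolding col_def
  proof (intro conjI ballI impI)
    fix u v assume uv: "u \<in> U \<union> T" "v \<in> U \<union> T" "E u v"
    then show "\<psi>' u \<noteq> \<psi>' v"
      using TT[of u v] TU[of u v] TU[of v u] sym[OF uv(3)] U(4) ninT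
      by (auto simp: \<psi>'_def col_def)
  qed (use U(4) TL ninT in \<open>auto simp: \<psi>'_def col_def\<close>)
  moreover have "flips \<alpha> \<beta> (U \<union> T) \<phi>' \<psi>'"
    using U(5) TL ninT by (auto simp: flips_def \<phi>'_def \<psi>'_def)
  ultimately show "\<exists>\<phi>' \<psi>'. col (U \<union> T) L \<phi>' \<and> col (U \<union> T) L \<psi>' \<and>
      flips \<alpha> \<beta> (U \<union> T) \<phi>' \<psi>' \<and> (\<forall>u\<in>U. \<phi>' u = \<phi> u \<and> \<psi>' u = \<psi> u)"
    using ninT by (intro exI[of _ \<phi>'] exI[of _ \<psi>']) (auto simp: \<phi>'_def \<psi>'_def)
qed

end

section \<open>Reducible sets\<close>

context sym_graph
begin

text \<open>This is what extends a pair prescribed on \<open>a\<close> and \<open>a'\<close> to all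
  of \<open>H\<close> via \<open>extends_if_anchored\<close>: components with an even cycle are
  anchored there, and the one with \<open>b\<close> is to be anchored at \<open>b\<close>.\<close>

definition linked :: "'a set \<Rightarrow> 'a \<Rightarrow> 'a \<Rightarrow> 'a \<Rightarrow> bool" where
  "linked H b a a' \<longleftrightarrow>
     (\<forall>R. closed_in R (H - {a, a'}) \<longrightarrow> R \<noteq> {} \<longrightarrow> b \<notin> R \<longrightarrow> (\<exists>T. T \<subseteq> R \<and> ecycle T))"

text \<open>Abstracts the edges along a bridgeless part together with the pendant edge
  \<open>b\<close>. The last clause allows a detour over a third neighbour of \<open>b\<close>,
  because deleting two of them may cut off a closed set with neither \<open>b\<close> nor an even
  cycle.\<close>

definition reducible :: "'a set \<Rightarrow> 'a \<Rightarrow> bool" where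
  "reducible H b \<longleftrightarrow> finite H \<and> b \<in> H \<and> nb b H \<noteq> {} \<and>
     (\<forall>a\<in>nb b H. \<forall>a'\<in>nb b H. a \<noteq> a' \<longrightarrow> E a a') \<and>
     (\<forall>a\<in>nb b H. \<not> nb a H \<subseteq> insert b (nb b H)) \<and>
     (\<forall>a\<in>nb b H. \<forall>R. closed_in R (H - {a}) \<longrightarrow> R \<noteq> {} \<longrightarrow> R = H - {a}) \<and>
     (\<forall>a\<in>nb b H. \<exists>T. T \<subseteq> H - {a} \<and> ecycle T) \<and>
     (\<forall>a\<in>nb b H. \<forall>a'\<in>nb b H. a \<noteq> a' \<longrightarrow> linked H b a a' \<or>
        (\<exists>a''\<in>nb b H. a'' \<noteq> a \<and> a'' \<noteq> a' \<and> linked H b a a'' \<and> linked H b a'' a'))"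

lemma reducibleD:
  assumes "reducible H b"
  shows "finite H" "b \<in> H" "nb b H \<noteq> {}"
    and "a \<in> nb b H \<Longrightarrow> a' \<in> nb b H \<Longrightarrow> a \<noteq> a' \<Longrightarrow> E a a'"
    and "a \<in> nb b H \<Longrightarrow> \<not> nb a H \<subseteq> insert b (nb b H)"
    and "a \<in> nb b H \<Longrightarrow> closed_in R (H - {a}) \<Longrightarrow> R \<noteq> {} \<Longrightarrow> R = H - {a}"
    and "a \<in> nb b H \<Longrightarrow> \<exists>T. T \<subseteq> H - {a} \<and> ecycle T"
    and "a \<in> nb b H \<Longrightarrow> a' \<in> nb b H \<Longrightarrow> a \<noteq> a' \<Longrightarrow> linked H b a a' \<or>
        (\<exists>a''\<in>nb b H. a'' \<noteq> a \<and> a'' \<noteq> a' \<and> linked H b a a'' \<and> linked H b a'' a')"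
proof -
  note r1 = assms[unfolded reducible_def]
  note r2 = conjunct2[OF r1]
  note r3 = conjunct2[OF r2]
  note r4 = conjunct2[OF r3]
  note r5 = conjunct2[OF r4]
  note r6 = conjunct2[OF r5]
  note r7 = conjunct2[OF r6]
  show "finite H" "b \<in> H" "nb b H \<noteq> {}" using r1 r2 r3 by simp_all
  show "a \<in> nb b H \<Longrightarrow> a' \<in> nb b H \<Longrightarrow> a \<noteq> a' \<Longrightarrow> E a a'" by (rule conjunct1[OF r4, rule_format])
  show "a \<in> nb b H \<Longrightarrow> \<not> nb a H \<subseteq> insert b (nb b H)" by (rule conjunct1[OF r5, rule_format])
  show "a \<in> nb b H \<Longrightarrow> closed_in R (H - {a}) \<Longrightarrow> R \<noteq> {} \<Longrightarrow> R = H - {a}"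
    by (rule conjunct1[OF r6, rule_format])
  show "a \<in> nb b H \<Longrightarrow> \<exists>T. T \<subseteq> H - {a} \<and> ecycle T" by (rule conjunct1[OF r7, rule_format])
  show "a \<in> nb b H \<Longrightarrow> a' \<in> nb b H \<Longrightarrow> a \<noteq> a' \<Longrightarrow> linked H b a a' \<or>
        (\<exists>a''\<in>nb b H. a'' \<noteq> a \<and> a'' \<noteq> a' \<and> linked H b a a'' \<and> linked H b a'' a')"
    by (rule conjunct2[OF r7, rule_format])
qed

lemma reducible_connected:
  assumes "reducible H b" "closed_in R H" "R \<noteq> {}"
  shows "R = H"
proof -
  obtain a where a: "a \<in> nb b H" using reducibleD(3)[OF assms(1)] by auto
  have ab: "a \<in> H" "b \<in> H" "E a b" "E b a" "a \<noteq> b"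
    using a reducibleD(2)[OF assms(1)] sym[of b a] irrefl[of b] by (auto simp: nb_def)
  have nba: "b \<in> nb a H" using ab by (auto simp: nb_def)
  have "R \<noteq> {a}"
  proof
    assume "R = {a}"
    then have "b \<in> R" using assms(2) nba unfolding closed_in_def by blast
    then show False using \<open>R = {a}\<close> ab by auto
  qed
  then have "R - {a} \<noteq> {}" using assms(3) by auto
  moreover have "closed_in (R - {a}) (H - {a})"
    using assms(2) unfolding closed_in_def nb_def by auto
  ultimately have "R - {a} = H - {a}" using reducibleD(6)[OF assms(1) a] by simp
  then have "b \<in> R" using ab by auto
  then have "a \<in> R" using assms(2) a unfolding closed_in_def by blast
  then show ?thesis using \<open>R - {a} = H - {a}\<close> ab by blast
qed

lemma reducible_ecycle:
  assumes "reducible H b"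
  shows "\<exists>T. T \<subseteq> H \<and> ecycle T"
proof -
  obtain a where "a \<in> nb b H" using reducibleD(3)[OF assms] by auto
  then obtain T where "T \<subseteq> H - {a}" "ecycle T" using reducibleD(7)[OF assms] by metis
  then show ?thesis by blast
qed

text \<open>The vertex \<open>b\<close> has one neighbour less in \<open>H\<close> than each of its neighbours. If all lists are
  as short as possible, then \<open>b\<close> together with its neighbours is a clique with more colours than
  \<open>L b\<close> offers, so some neighbour has a colour outside \<open>L b\<close>. Such a colour makes \<open>b\<close> flexible,
  so all colourings that agree on this neighbour are equivalent.\<close>

lemma swappable_reducible:
  assumes red: "reducible H b"
    and L: "\<And>h. h \<in> H \<Longrightarrow> finite (L h) \<and> card (nb h H) \<le> card (L h)"
  shows "swappable H L"
proof (cases "\<exists>z\<in>H. card (nb z H) < card (L z)")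
  case True
  then obtain z where z: "z \<in> H" "card (nb z H) < card (L z)" by auto
  show ?thesis
  proof (rule swappable_if_surplus[of H L z])
    show "R = H" if "closed_in R H" "z \<in> R" for R
      using reducible_connected[OF red that(1)] that(2) by blast
  qed (use L red z in \<open>auto simp: reducible_def\<close>)
next
  case False
  define A where "A = nb b H"
  have fin: "finite H" and bH: "b \<in> H" and Ane: "A \<noteq> {}"
    and clique: "\<And>a a'. a \<in> A \<Longrightarrow> a' \<in> A \<Longrightarrow> a \<noteq> a' \<Longrightarrow> E a a'"
    and mate: "\<And>a. a \<in> A \<Longrightarrow> \<not> nb a H \<subseteq> insert b A"
    and conn: "\<And>a R. a \<in> A \<Longrightarrow> closed_in R (H - {a}) \<Longrightarrow> R \<noteq> {} \<Longrightarrow> R = H - {a}"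
    and cyc: "\<And>a. a \<in> A \<Longrightarrow> \<exists>T. T \<subseteq> H - {a} \<and> ecycle T"
    and link: "\<And>a a'. a \<in> A \<Longrightarrow> a' \<in> A \<Longrightarrow> a \<noteq> a' \<Longrightarrow> linked H b a a' \<or>
        (\<exists>a''\<in>A. a'' \<noteq> a \<and> a'' \<noteq> a' \<and> linked H b a a'' \<and> linked H b a'' a')"
    unfolding A_def by (fact reducibleD[OF red])+
  have exact: "card (L h) = card (nb h H)" if "h \<in> H" for h
    using False L[OF that] that by (meson antisym not_less)
  have finA: "finite A" using fin by (simp add: A_def)
  have AH: "a \<in> H" "E a b" "E b a" "a \<noteq> b" "b \<in> nb a H" if "a \<in> A" for a
    using that sym[of b a] irrefl[of b] bH by (auto simp: A_def nb_def)
  have cardb: "card (L b) = card A" using exact[OF bH] by (simp add: A_def)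
  \<comment> \<open>\<open>a\<close> is adjacent to \<open>b\<close>, to the rest of the clique and
    to at least one more vertex.\<close>
  have cardA: "card (L a) > card A" if "a \<in> A" for a
  proof -
    have "insert b (A - {a}) \<subset> nb a H"
      using mate[OF that] AH[OF that] clique[OF that] irrefl[of a] by (auto simp: A_def nb_def)
    then have "card (insert b (A - {a})) < card (nb a H)" using fin by (intro psubset_card_mono) auto
    moreover have "card (insert b (A - {a})) = card A"
    proof -
      have "b \<notin> A" using irrefl[of b] by (simp add: A_def nb_def)
      then show ?thesis using finA that card_Suc_Diff1[OF finA that] by simp
    qed
    ultimately show ?thesis using exact[OF AH(1)[OF that]] by simp
  qed

  \<comment> \<open>If \<open>a\<close> has such a colour, then deleting \<open>a\<close> costs
    \<open>z\<close> a neighbour but no colour. Hence \<open>z\<close> has a surplus in the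
    connected rest \<open>H - {a}\<close>.\<close>
  define good where "good a c \<longleftrightarrow> a \<in> A \<and> (\<exists>z\<in>nb a H. c \<notin> L z)" for a c
  have good_b: "good a c" if "a \<in> A" "c \<notin> L b" for a c
    using that AH(5) by (auto simp: good_def)

  have same: "(\<phi>, \<psi>) \<in> eqv H L"
    if g: "good a c" and cols: "col H L \<phi>" "col H L \<psi>" "\<phi> a = c" "\<psi> a = c" for a c \<phi> \<psi>
  proof (rule eqv_fix_outside[of "H - {a}"])
    obtain z where z: "z \<in> nb a H" "c \<notin> L z" and aA: "a \<in> A" using g by (auto simp: good_def)
    have HH: "H - (H - {a}) = {a}" using AH(1)[OF aA] by auto
    show "\<phi> v = \<psi> v" if "v \<in> H - (H - {a})" for v using that cols HH by auto
    have nbS: "card (nb s (H - {a})) \<le> card (L s - \<phi> ` nb s {a})" if "s \<in> H - {a}" for s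
    proof (cases "E s a")
      case True
      then have "nb s H = insert a (nb s (H - {a}))" using AH(1)[OF aA] by (auto simp: nb_def)
      then have "card (nb s H) = Suc (card (nb s (H - {a})))" using fin by (simp add: nb_def)
      moreover have "card (L s) \<le> Suc (card (L s - \<phi> ` nb s {a}))"
      proof -
        have "nb s {a} = {a}" using True by (auto simp: nb_def)
        then show ?thesis by (simp add: card_Diff_singleton_if) linarith
      qed
      ultimately show ?thesis using L[of s] that by simp
    next
      case False
      then have "nb s {a} = {}" "nb s (H - {a}) = nb s H" by (auto simp: nb_def)
      then show ?thesis using L[of s] that by simp
    qed
    have zS: "z \<in> H - {a}" "E z a" using z irrefl[of a] sym[of a z] by (auto simp: nb_def)
    have "nb z (H - {a}) \<subset> nb z H" using zS AH(1)[OF aA] by (auto simp: nb_def)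
    then have "card (nb z (H - {a})) < card (nb z H)" using fin by (intro psubset_card_mono) auto
    moreover have "L z - \<phi> ` nb z {a} = L z" using z(2) cols(3) by (auto simp: nb_def)
    ultimately have zlt: "card (nb z (H - {a})) < card (L z - \<phi> ` nb z {a})"
      using L[of z] zS by simp
    show "swappable (H - {a}) (\<lambda>s. L s - \<phi> ` nb s (H - (H - {a})))"
      unfolding HH
    proof (rule swappable_if_surplus[of "H - {a}" _ z])
      show "R = H - {a}" if "closed_in R (H - {a})" "z \<in> R" for R
        using conn[OF aA that(1)] that(2) by blast
    qed (use fin L nbS zS zlt in auto)
  qed (use cols in auto)

  \<comment> \<open>The step exchanges \<open>c\<close> and \<open>c'\<close>.
    \<open>H - {a}\<close> is connected and has an even cycle, which is coloured last.\<close>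
  have ext1: "\<exists>\<phi>1 \<psi>1. col H L \<phi>1 \<and> col H L \<psi>1 \<and> (\<phi>1, \<psi>1) \<in> eqv H L \<and> \<phi>1 a = c \<and> \<psi>1 a = c'"
    if aA: "a \<in> A" and cc: "c \<in> L a" "c' \<in> L a" for a c c'
  proof -
    have "extends H L c c' {} undefined undefined (H - {a})"
    proof (rule extends_if_anchored)
      fix R assume "closed_in R (H - {a})" "R \<noteq> {}"
      then have "R = H - {a}" using conn[OF aA] by blast
      moreover obtain T where "T \<subseteq> H - {a}" "ecycle T" using cyc[OF aA] by blast
      moreover have "extends H L c c' {} undefined undefined T"
        by (rule extends_ecycle) (use calculation fin L in auto)
      moreover have "T \<noteq> {}" using \<open>ecycle T\<close> by (rule ecycle_nonempty)
      ultimately show "\<exists>T. T \<subseteq> R \<and> T \<noteq> {} \<and> extends H L c c' {} undefined undefined T" by blast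
    qed (use fin L in auto)
    then obtain \<phi>1 \<psi>1 where 1: "col ({a} \<union> (H - {a})) L \<phi>1" "col ({a} \<union> (H - {a})) L \<psi>1"
      "flips c c' ({a} \<union> (H - {a})) \<phi>1 \<psi>1" "\<And>u. u \<in> {a} \<Longrightarrow> \<phi>1 u = c \<and> \<psi>1 u = c'"
      by (rule extendsD[of _ _ _ _ _ _ _ _ "{a}" "\<lambda>_. c" "\<lambda>_. c'"])
        (use AH(1)[OF aA] cc irrefl in \<open>auto simp: col_def flips_def\<close>)
    have "{a} \<union> (H - {a}) = H" using AH(1)[OF aA] by auto
    then show ?thesis using 1 step_eqv[of \<phi>1 \<psi>1 H L] by (auto simp: step_def)
  qed

  have same': "(\<phi>, \<psi>) \<in> eqv H L"
    if g: "good a c" "good a c'" and cols: "col H L \<phi>" "col H L \<psi>" "\<phi> a = c" "\<psi> a = c'" for a c c' \<phi> \<psi>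
  proof -
    have aA: "a \<in> A" using g by (simp add: good_def)
    have "c \<in> L a" "c' \<in> L a" using cols AH(1)[OF aA] by (auto simp: col_def)
    from ext1[OF aA this] obtain \<phi>1 \<psi>1 where 1: "col H L \<phi>1" "col H L \<psi>1" "(\<phi>1, \<psi>1) \<in> eqv H L" "\<phi>1 a = c" "\<psi>1 a = c'"
      by blast
    have "(\<phi>, \<phi>1) \<in> eqv H L" using same[OF g(1)] cols 1 by blast
    also note 1(3)
    also have "(\<psi>1, \<psi>) \<in> eqv H L" using same[OF g(2)] cols 1 by blast
    finally show ?thesis .
  qed

  \<comment> \<open>The colours at \<open>a\<close> and \<open>a'\<close> come from
    \<open>{c, p}\<close> with \<open>c\<close> outside \<open>L b\<close>, so these two neighbours
    of \<open>b\<close> cost it only the colour \<open>p\<close>. Thus \<open>b\<close> can be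
    coloured last and serves as an anchor besides the even cycles.\<close>
  have ext2: "\<exists>\<phi>1 \<psi>1. col H L \<phi>1 \<and> col H L \<psi>1 \<and> (\<phi>1, \<psi>1) \<in> eqv H L \<and>
      \<phi>1 a = x \<and> \<psi>1 a = y \<and> \<phi>1 a' = x' \<and> \<psi>1 a' = y'"
    if a: "a \<in> A" "a' \<in> A" "a \<noteq> a'" "linked H b a a'" and c: "c \<notin> L b" "{x, y, x', y'} \<subseteq> {c, p}"
      and lists: "x \<in> L a" "y \<in> L a" "x' \<in> L a'" "y' \<in> L a'" and ne: "x \<noteq> x'" "y \<noteq> y'"
      and fl: "flip \<alpha> \<beta> x y" "flip \<alpha> \<beta> x' y'"
    for a a' c p x y x' y' \<alpha> \<beta>
  proof -
    define \<phi>0 where "\<phi>0 u = (if u = a then x else x')" for u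
    define \<psi>0 where "\<psi>0 u = (if u = a then y else y')" for u
    have "extends H L \<alpha> \<beta> {a, a'} \<phi>0 \<psi>0 (H - {a, a'})"
    proof (rule extends_if_anchored)
      fix R assume R: "closed_in R (H - {a, a'})" "R \<noteq> {}"
      show "\<exists>T. T \<subseteq> R \<and> T \<noteq> {} \<and> extends H L \<alpha> \<beta> {a, a'} \<phi>0 \<psi>0 T"
      proof (cases "b \<in> R")
        case True
        have "extends H L \<alpha> \<beta> {a, a'} \<phi>0 \<psi>0 {b}"
          unfolding extends_def
        proof (intro conjI allI impI)
          show "{b} \<subseteq> H" using bH by simp
          fix U \<phi> \<psi>
          assume U: "{a, a'} \<subseteq> U" "U \<subseteq> H - {b}" "col U L \<phi>" "col U L \<psi>" "flips \<alpha> \<beta> U \<phi> \<psi>"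
            "\<forall>u\<in>{a, a'}. \<phi> u = \<phi>0 u \<and> \<psi> u = \<psi>0 u"
          define N where "N = nb b U - {a, a'}"
          have "N \<subseteq> A - {a, a'}" using U(2) by (auto simp: N_def A_def nb_def)
          then have "card N \<le> card (A - {a, a'})" using finA by (intro card_mono) auto
          also have "card (A - {a, a'}) = card A - 2"
            using a finA by (simp add: card_Diff_subset)
          finally have "card N \<le> card A - 2" .
          moreover have "card A \<ge> 2" using a finA card_mono[of A "{a, a'}"] by simp
          moreover have "card (L b - {p}) \<ge> card A - 1"
            using cardb by (simp add: card_Diff_singleton_if)
          ultimately have "card N < card (L b - {p})" by linarith
          moreover have "finite N" using finA \<open>N \<subseteq> A - {a, a'}\<close> finite_subset by blast
          ultimately have "\<exists>s\<in>L b - {p}. \<exists>t\<in>L b - {p}. flip \<alpha> \<beta> s t \<and> (\<forall>u\<in>N. \<phi> u \<noteq> s \<and> \<psi> u \<noteq> t)"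
            using L[OF bH] U(5) by (intro flip_pair_choice) (auto simp: flips_def N_def nb_def)
          then obtain s t where st: "s \<in> L b - {p}" "t \<in> L b - {p}" "flip \<alpha> \<beta> s t"
            "\<And>u. u \<in> N \<Longrightarrow> \<phi> u \<noteq> s \<and> \<psi> u \<noteq> t" by blast
          have "\<phi> u \<noteq> s \<and> \<psi> u \<noteq> t" if "u \<in> nb b U" for u
          proof (cases "u \<in> {a, a'}")
            case True
            have "\<phi>0 u \<in> {c, p}" "\<psi>0 u \<in> {c, p}" using c(2) by (simp_all add: \<phi>0_def \<psi>0_def)
            then have "\<phi> u \<in> {c, p}" "\<psi> u \<in> {c, p}" using U(6) True by metis+
            then show ?thesis using st(1,2) c(1) by auto
          next
            case False then show ?thesis using st(4) that by (simp add: N_def)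
          qed
          moreover have "b \<notin> U" using U(2) by auto
          ultimately show "\<exists>\<phi>' \<psi>'. col (U \<union> {b}) L \<phi>' \<and> col (U \<union> {b}) L \<psi>' \<and>
              flips \<alpha> \<beta> (U \<union> {b}) \<phi>' \<psi>' \<and> (\<forall>u\<in>U. \<phi>' u = \<phi> u \<and> \<psi>' u = \<psi> u)"
            using U(3-5) st
            by (intro exI[of _ "\<phi>(b := s)"] exI[of _ "\<psi>(b := t)"]) (auto simp: flips_def intro!: col_insertI)
        qed
        then show ?thesis using True by blast
      next
        case False
        then obtain T where T: "T \<subseteq> R" "ecycle T" using a(4) R unfolding linked_def by blast
        moreover have "T \<noteq> {}" using \<open>ecycle T\<close> by (rule ecycle_nonempty)
        moreover have "extends H L \<alpha> \<beta> {a, a'} \<phi>0 \<psi>0 T"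
          by (rule extends_ecycle) (use T R L fin in \<open>auto simp: closed_in_def\<close>)
        ultimately show ?thesis by blast
      qed
    qed (use fin L in auto)
    then obtain \<phi>1 \<psi>1 where 1: "col ({a, a'} \<union> (H - {a, a'})) L \<phi>1" "col ({a, a'} \<union> (H - {a, a'})) L \<psi>1"
      "flips \<alpha> \<beta> ({a, a'} \<union> (H - {a, a'})) \<phi>1 \<psi>1" "\<And>u. u \<in> {a, a'} \<Longrightarrow> \<phi>1 u = \<phi>0 u \<and> \<psi>1 u = \<psi>0 u"
      by (rule extendsD[of _ _ _ _ _ _ _ _ "{a, a'}" \<phi>0 \<psi>0])
        (use AH(1) a lists ne fl irrefl in \<open>auto simp: col_def flips_def \<phi>0_def \<psi>0_def\<close>)
    have "{a, a'} \<union> (H - {a, a'}) = H" using AH(1) a by auto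
    then show ?thesis using 1(1-3) 1(4)[of a] 1(4)[of a'] step_eqv[of \<phi>1 \<psi>1 H L] a(3)
      by (auto simp: step_def \<phi>0_def \<psi>0_def)
  qed

  have across: "(\<phi>, \<psi>) \<in> eqv H L"
    if a: "a \<in> A" "a' \<in> A" "a \<noteq> a'" "linked H b a a'"
      and cols: "col H L \<phi>" "col H L \<psi>" "\<phi> a \<notin> L b" "\<psi> a' \<notin> L b" for a a' \<phi> \<psi>
  proof -
    define c where "c = \<phi> a"
    define c'' where "c'' = \<psi> a'"
    have cL: "c \<in> L a" "c'' \<in> L a'" using cols AH(1) a by (auto simp: col_def c_def c''_def)
    have g: "good a c" "good a' c''" using good_b a cols by (auto simp: c_def c''_def)
    \<comment> \<open>\<open>a\<close> and \<open>a'\<close> are adjacent. So \<open>p\<close> is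
      the wanted colour \<open>c''\<close> unless that clashes with \<open>c\<close>, and otherwise
      any other colour of \<open>a'\<close>.\<close>
    have "\<exists>p. p \<in> L a' \<and> p \<noteq> c \<and> (c'' \<noteq> c \<longrightarrow> p = c'')"
    proof (cases "c'' = c")
      case True
      have "card A \<ge> 1" using a finA by (metis One_nat_def Suc_leI card_gt_0_iff empty_iff)
      then have "card (L a') > 1" using cardA[OF a(2)] by simp
      then have "\<not> L a' \<subseteq> {c}" using card_mono[of "{c}" "L a'"] by auto
      then show ?thesis using True by blast
    qed (use cL in auto)
    then obtain p where p: "p \<in> L a'" "p \<noteq> c" "c'' \<noteq> c \<Longrightarrow> p = c''" by blast
    show ?thesis
    proof (cases "c'' = c \<and> p \<in> L a")
      case True
      have cb: "c \<notin> L b" using cols by (simp add: c_def)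
      \<comment> \<open>Both vertices want the same colour \<open>c\<close>, so a single step swaps
        \<open>c\<close> and \<open>p\<close> between them.\<close>
      obtain \<phi>1 \<psi>1 where 1: "col H L \<phi>1" "col H L \<psi>1" "(\<phi>1, \<psi>1) \<in> eqv H L"
        "\<phi>1 a = c" "\<psi>1 a' = c"
        using ext2[OF a cb, of c p p c p c p] True p cL by auto
      have "(\<phi>, \<phi>1) \<in> eqv H L" using same[OF g(1)] cols 1 by (simp add: c_def)
      also note 1(3)
      also have "(\<psi>1, \<psi>) \<in> eqv H L" using same[OF g(2)] cols 1 True by (simp add: c''_def)
      finally show ?thesis .
    next
      case False
      have cb: "c \<notin> L b" using cols by (simp add: c_def)
      \<comment> \<open>\<open>\<eta>\<close> already has the right colour at \<open>a\<close>. At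
        \<open>a'\<close> its colour \<open>p\<close> is good, either because it is
        \<open>c''\<close> or because the neighbour \<open>a\<close> lacks it.\<close>
      obtain \<eta> where \<eta>: "col H L \<eta>" "\<eta> a = c" "\<eta> a' = p"
        using ext2[OF a cb, of c c p p p c c] p cL by auto
      have "a \<in> nb a' H" using a AH(1) clique by (auto simp: nb_def)
      then have "good a' p" using False g(2) p(3) a by (auto simp: good_def)
      then have "(\<eta>, \<psi>) \<in> eqv H L" using same'[of a' p c''] g(2) cols \<eta> by (simp add: c''_def)
      moreover have "(\<phi>, \<eta>) \<in> eqv H L" using same[OF g(1)] cols \<eta> by (simp add: c_def)
      ultimately show ?thesis using eqv_trans by blast
    qed
  qed

  have outside: "\<exists>a\<in>A. \<phi> a \<notin> L b" if \<phi>: "col H L \<phi>" for \<phi>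
  proof (rule ccontr)
    assume neg: "\<not> ?thesis"
    have "inj_on \<phi> (insert b A)"
    proof (rule inj_onI, rule ccontr)
      fix u v assume uv: "u \<in> insert b A" "v \<in> insert b A" "\<phi> u = \<phi> v" "u \<noteq> v"
      then have "E u v" using clique AH by auto
      then show False using uv \<phi> AH(1) bH by (auto simp: col_def)
    qed
    moreover have "\<phi> ` insert b A \<subseteq> L b" using neg \<phi> bH by (auto simp: col_def)
    ultimately have "card (insert b A) \<le> card (L b)" using L[OF bH] card_inj_on_le by blast
    moreover have "b \<notin> A" using irrefl by (simp add: A_def nb_def)
    ultimately show False using cardb finA by simp
  qed

  show ?thesis
    unfolding swappable_def
  proof (intro allI impI)
    fix \<phi> \<psi> assume cols: "col H L \<phi>" "col H L \<psi>"
    obtain a a' where a: "a \<in> A" "\<phi> a \<notin> L b" "a' \<in> A" "\<psi> a' \<notin> L b" using outside cols by meson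
    show "(\<phi>, \<psi>) \<in> eqv H L"
    proof (cases "a = a'")
      case True
      then show ?thesis using same'[of a "\<phi> a" "\<psi> a"] good_b a cols by simp
    next
      case False
      from link[OF a(1,3) False] show ?thesis
      proof
        assume "linked H b a a'"
        then show ?thesis using across a False cols by blast
      next
        assume "\<exists>a''\<in>A. a'' \<noteq> a \<and> a'' \<noteq> a' \<and> linked H b a a'' \<and> linked H b a'' a'"
        then obtain a'' where a'': "a'' \<in> A" "a'' \<noteq> a" "a'' \<noteq> a'" "linked H b a a''" "linked H b a'' a'" by blast
        \<comment> \<open>The intermediate neighbour needs a colour outside \<open>L b\<close> too;
          its list is longer than \<open>L b\<close>.\<close>
        have "\<not> L a'' \<subseteq> L b"
          using cardA[OF a''(1)] cardb L[OF bH] card_mono by (metis leD)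
        then obtain c where c: "c \<in> L a''" "c \<notin> L b" by blast
        then obtain \<eta> where "col H L \<eta>" "\<eta> a'' = c" using ext1[OF a''(1) c(1) c(1)] by blast
        then show ?thesis
          using across[of a a'' \<phi> \<eta>] across[of a'' a' \<eta> \<psi>] a a'' cols c eqv_trans by metis
      qed
    qed
  qed
qed

text \<open>Outer pairs extend because \<open>H\<close> is connected and has an even cycle to be
  coloured last. Fixing the outside removes from each list at most one colour per outer neighbour,
  so \<open>swappable_reducible\<close> applies to the extensions of one outer colouring.\<close>

theorem swappable_if_reducible:
  assumes red: "reducible H b" and V: "finite V" "H \<subseteq> V"
    and L: "\<And>h. h \<in> H \<Longrightarrow> finite (L h) \<and> card (nb h V) \<le> card (L h)"
    and sw: "swappable (V - H) L"
  shows "swappable V L"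
proof (rule swappable_by_lifting[OF V(2) sw])
  fix \<alpha> \<beta> \<phi> \<psi>
  assume *: "col (V - H) L \<phi>" "col (V - H) L \<psi>" "flips \<alpha> \<beta> (V - H) \<phi> \<psi>"
  have "extends V L \<alpha> \<beta> {} undefined undefined H"
  proof (rule extends_if_anchored)
    fix R assume "closed_in R H" "R \<noteq> {}"
    then have "R = H" using reducible_connected[OF red] by blast
    moreover obtain T where T: "T \<subseteq> H" "ecycle T" using reducible_ecycle[OF red] by blast
    moreover have "T \<noteq> {}" using \<open>ecycle T\<close> by (rule ecycle_nonempty)
    moreover have "extends V L \<alpha> \<beta> {} undefined undefined T"
      by (rule extends_ecycle) (use T V L in auto)
    ultimately show "\<exists>T. T \<subseteq> R \<and> T \<noteq> {} \<and> extends V L \<alpha> \<beta> {} undefined undefined T" by blast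
  qed (use V L in auto)
  then obtain \<phi>' \<psi>' where 1: "col (V - H \<union> H) L \<phi>'" "col (V - H \<union> H) L \<psi>'" "flips \<alpha> \<beta> (V - H \<union> H) \<phi>' \<psi>'"
    "\<And>u. u \<in> V - H \<Longrightarrow> \<phi>' u = \<phi> u \<and> \<psi>' u = \<psi> u"
    by (rule extendsD[of _ _ _ _ _ _ _ _ "V - H" \<phi> \<psi>]) (use * in auto)
  moreover have "V - H \<union> H = V" using V by auto
  ultimately show "\<exists>\<phi>' \<psi>'. col V L \<phi>' \<and> col V L \<psi>' \<and> flips \<alpha> \<beta> V \<phi>' \<psi>' \<and>
        (\<forall>u\<in>V - H. \<phi>' u = \<phi> u \<and> \<psi>' u = \<psi> u)" by auto
next
  fix \<phi> \<psi> assume cols: "col V L \<phi>" "col V L \<psi>" "\<forall>u\<in>V - H. \<phi> u = \<psi> u"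
  show "(\<phi>, \<psi>) \<in> eqv V L"
  proof (rule eqv_fix_outside[OF V(2) cols(1,2)])
    show "swappable H (\<lambda>s. L s - \<phi> ` nb s (V - H))"
    proof (rule swappable_reducible[OF red])
      fix h assume h: "h \<in> H"
      have "nb h V = nb h H \<union> nb h (V - H)" "nb h H \<inter> nb h (V - H) = {}" using V by (auto simp: nb_def)
      moreover have "finite (nb h H)" "finite (nb h (V - H))"
        using V finite_subset[OF V(2)] by auto
      ultimately have "card (nb h V) = card (nb h H) + card (nb h (V - H))"
        by (metis card_Un_disjoint)
      moreover have "card (\<phi> ` nb h (V - H)) \<le> card (nb h (V - H))"
        by (intro card_image_le) (use V in auto)
      moreover have "card (L h) - card (\<phi> ` nb h (V - H)) \<le> card (L h - \<phi> ` nb h (V - H))"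
        by (rule diff_card_le_card_Diff) (use V in auto)
      ultimately show "finite (L h - \<phi> ` nb h (V - H)) \<and> card (nb h H) \<le> card (L h - \<phi> ` nb h (V - H))"
        using L[OF h] by auto
    qed
  qed (use cols in auto)
qed

end

section \<open>Vertices of degree two as edges of a multigraph\<close>

definition line_adj :: "'v set \<Rightarrow> 'v set \<Rightarrow> bool" where
  "line_adj e f \<longleftrightarrow> e \<noteq> f \<and> e \<inter> f \<noteq> {}"

interpretation line: sym_graph line_adj
  by unfold_locales (auto simp: line_adj_def)

text \<open>Subdividing every edge of a cycle of length \<open>n\<close> gives \<open>2 * n\<close>
  halves. Half \<open>p\<close> lies on edge \<open>p div 2\<close> and ends at vertex
  \<open>Suc p div 2 mod n\<close>; different halves meet iff they agree in one of the two.\<close>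

lemma cycle_index_adjacent:
  fixes n p q :: nat
  assumes "n \<ge> 2" "p < 2 * n" "q < 2 * n"
  shows "(p \<noteq> q \<and> (p div 2 = q div 2 \<or> Suc p div 2 mod n = Suc q div 2 mod n)) \<longleftrightarrow>
    q = Suc p mod (2 * n) \<or> p = Suc q mod (2 * n)"
proof -
  have even_odd: "(a = b \<or> a mod n = Suc b mod n) \<longleftrightarrow>
      2 * b + 1 = Suc (2 * a) mod (2 * n) \<or> 2 * a = Suc (2 * b + 1) mod (2 * n)"
    if "a < n" "b < n" for a b
  proof -
    have "Suc (2 * a) mod (2 * n) = 2 * a + 1" using that by simp
    moreover have "Suc (2 * b + 1) mod (2 * n) = 2 * (Suc b mod n)" by (simp add: mult_mod_right)
    ultimately show ?thesis using that by auto
  qed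
  have evens: "2 * a \<noteq> Suc (2 * b) mod (2 * n)" for a b
    by (metis dvd_mod_iff dvd_triv_left even_Suc)
  have odds: "2 * a + 1 \<noteq> Suc (2 * b + 1) mod (2 * n)" for a b
    by (metis dvd_mod_iff dvd_triv_left even_Suc Suc_eq_plus1)
  consider a b where "p = 2 * a" "q = 2 * b" | a b where "p = 2 * a" "q = 2 * b + 1"
    | a b where "p = 2 * a + 1" "q = 2 * b" | a b where "p = 2 * a + 1" "q = 2 * b + 1"
    by (metis evenE oddE)
  then show ?thesis
  proof cases
    case (1 a b)
    then show ?thesis using evens[of a b] evens[of b a] assms by auto
  next
    case (2 a b)
    then have d: "p div 2 = a" "q div 2 = b" "Suc p div 2 = a" "Suc q div 2 = Suc b" and ne: "p \<noteq> q"
      by presburger+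
    have ab: "a < n" "b < n" using 2 assms by auto
    show ?thesis unfolding d using even_odd[OF ab] ne unfolding 2 by blast
  next
    case (3 a b)
    then have d: "p div 2 = a" "q div 2 = b" "Suc p div 2 = Suc a" "Suc q div 2 = b" and ne: "p \<noteq> q"
      by presburger+
    have ab: "b < n" "a < n" using 3 assms by auto
    show ?thesis unfolding d using even_odd[OF ab] ne unfolding 3 by metis
  next
    case (4 a b)
    moreover have "Suc a mod n = Suc b mod n \<longleftrightarrow> a = b" if "a < n" "b < n"
      using that by (auto simp: mod_Suc split: if_splits)
    ultimately show ?thesis using odds[of a b] odds[of b a] assms by auto
  qed
qed

lemma Suc_div_two_Suc:
  fixes x y :: nat
  assumes "x div 2 = y div 2" "x < y"
  shows "Suc y div 2 = Suc (Suc x div 2)"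
proof -
  have "x = 2 * (x div 2) + x mod 2" "y = 2 * (x div 2) + y mod 2"
    using assms(1) by (metis mult_div_mod_eq)+
  moreover have "x mod 2 < 2" "y mod 2 < 2" by auto
  ultimately have "x = 2 * (x div 2)" "y = Suc (2 * (x div 2))" using assms(2) by linarith+
  then obtain m where "x = 2 * m" "y = Suc (2 * m)" by blast
  then show ?thesis by simp
qed

text \<open>Each \<open>v\<close> in \<open>X\<close> subdivides a multigraph edge, so that edge
  appears in the original graph as two halves meeting in \<open>v\<close>.\<close>

definition halves :: "('v \<Rightarrow> 'v set) \<Rightarrow> 'v set \<Rightarrow> 'v set set" where
  "halves N X = {{v, w} |v w. v \<in> X \<and> w \<in> N v}"

text \<open>The members of \<open>X\<close> are regarded as the edges of a multigraph with vertex set \<open>\<Union> (N ` X)\<close>.\<close>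

lemma ex_ecycle_halves:
  fixes N :: "'v \<Rightarrow> 'v set"
  assumes fin: "finite X" and ne: "X \<noteq> {}" and two: "\<And>v. v \<in> X \<Longrightarrow> card (N v) = 2"
    and disj: "X \<inter> \<Union> (N ` X) = {}" and card: "card (\<Union> (N ` X)) \<le> card X"
  shows "\<exists>T. T \<subseteq> halves N X \<and> line.ecycle T"
proof -
  \<comment> \<open>A minimal edge set with at least as many edges as vertices has no vertex of
    degree one: deleting that vertex with its edge would preserve the inequality.\<close>
  define P where "P Y \<longleftrightarrow> Y \<subseteq> X \<and> Y \<noteq> {} \<and> card (\<Union> (N ` Y)) \<le> card Y" for Y
  have "P X" using ne card by (simp add: P_def)
  then obtain Y where Y: "P Y" and min: "\<And>Z. P Z \<Longrightarrow> card Y \<le> card Z"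
    using exists_least_iff[of "\<lambda>n. \<exists>Z. P Z \<and> card Z = n"] by (metis not_less)
  have YX: "Y \<subseteq> X" and finY: "finite Y" and cY: "card (\<Union> (N ` Y)) \<le> card Y" and Yne: "Y \<noteq> {}"
    using Y fin finite_subset by (auto simp: P_def)
  have finN: "finite (N v)" if "v \<in> X" for v using two[OF that] by (metis card.infinite zero_neq_numeral)
  have other: "\<exists>v'\<in>Y. v' \<noteq> v \<and> w \<in> N v'" if v: "v \<in> Y" "w \<in> N v" for v w
  proof (rule ccontr)
    assume neg: "\<not> ?thesis"
    have "\<Union> (N ` (Y - {v})) \<subseteq> \<Union> (N ` Y) - {w}" using neg by auto
    then have "card (\<Union> (N ` (Y - {v}))) \<le> card (\<Union> (N ` Y) - {w})"
      using finY finN YX by (intro card_mono) auto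
    also have "\<dots> = card (\<Union> (N ` Y)) - 1" using v finY finN YX by (subst card_Diff_singleton) auto
    also have "\<dots> \<le> card (Y - {v})" using cY v finY by (simp add: card_Diff_singleton)
    finally have le: "card (\<Union> (N ` (Y - {v}))) \<le> card (Y - {v})" .
    have "Y - {v} \<noteq> {}"
    proof
      assume "Y - {v} = {}"
      then have "Y = {v}" using v by auto
      then show False using cY two v YX by auto
    qed
    then have "P (Y - {v})" using le YX by (auto simp: P_def)
    from min[OF this] show False using v finY by (metis card_Diff1_less leD)
  qed
  \<comment> \<open>A walk that never turns back: \<open>f n\<close> consists of an edge and the end
    at which it is entered.\<close>
  have "\<exists>f. (\<forall>n. fst (f n) \<in> Y \<and> snd (f n) \<in> N (fst (f n))) \<and>
      (\<forall>n. fst (f (Suc n)) \<noteq> fst (f n) \<and> N (fst (f n)) = {snd (f n), snd (f (Suc n))} \<and> snd (f n) \<noteq> snd (f (Suc n)))"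
  proof -
    have init: "\<exists>x. fst x \<in> Y \<and> snd x \<in> N (fst x)"
    proof -
      obtain v where v: "v \<in> Y" using Yne by auto
      then have "N v \<noteq> {}" using two[of v] YX by auto
      then show ?thesis using v by force
    qed
    have nxt: "\<exists>y. (fst y \<in> Y \<and> snd y \<in> N (fst y)) \<and>
        (fst y \<noteq> fst x \<and> N (fst x) = {snd x, snd y} \<and> snd x \<noteq> snd y)"
      if x: "fst x \<in> Y \<and> snd x \<in> N (fst x)" for x
    proof -
      obtain p q where "N (fst x) = {p, q}" "p \<noteq> q"
        using two[of "fst x"] x YX by (meson card_2_iff subsetD)
      then obtain w where w: "N (fst x) = {snd x, w}" "snd x \<noteq> w" using x by auto
      then obtain v where "v \<in> Y" "v \<noteq> fst x" "w \<in> N v" using other[of "fst x" w] x by auto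
      then show ?thesis using w by (intro exI[of _ "(v, w)"]) auto
    qed
    show ?thesis
      using dependent_nat_choice[of "\<lambda>_ x. fst x \<in> Y \<and> snd x \<in> N (fst x)"
          "\<lambda>_ x y. fst y \<noteq> fst x \<and> N (fst x) = {snd x, snd y} \<and> snd x \<noteq> snd y", OF init nxt] by blast
  qed
  then obtain f where f: "\<And>n. fst (f n) \<in> Y" "\<And>n. fst (f (Suc n)) \<noteq> fst (f n)"
    "\<And>n. N (fst (f n)) = {snd (f n), snd (f (Suc n))}" "\<And>n. snd (f n) \<noteq> snd (f (Suc n))"
    by blast
  define v where "v n = fst (f n)" for n
  define w where "w n = snd (f n)" for n
  have vY: "v n \<in> Y" and vne: "v (Suc n) \<noteq> v n" and Nv: "N (v n) = {w n, w (Suc n)}" and wne: "w n \<noteq> w (Suc n)" for n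
    using f by (auto simp: v_def w_def)
  have "\<not> inj w"
  proof
    assume "inj w"
    moreover have "range w \<subseteq> \<Union> (N ` Y)" using vY Nv by (metis UN_iff image_subsetI insertI1)
    moreover have "finite (\<Union> (N ` Y))" using finY finN YX by auto
    ultimately show False using finite_subset finite_imageD infinite_UNIV_nat by metis
  qed
  then have "\<exists>j. \<exists>i<j. w i = w j" unfolding inj_def by (metis linorder_neqE_nat)
  \<comment> \<open>The first return of the walk to a vertex closes a cycle, from \<open>i\<close>
    to \<open>j\<close>.\<close>
  then obtain j where j: "\<exists>i<j. w i = w j" and jmin: "\<And>l. l < j \<Longrightarrow> \<not> (\<exists>i<l. w i = w l)"
    using exists_least_iff[of "\<lambda>j. \<exists>i<j. w i = w j"] by metis
  obtain i where i: "i < j" "w i = w j" using j by blast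
  define n where "n = j - i"
  have wdist: "w p \<noteq> w q" if "p < q" "q < j" for p q using jmin that by blast
  have "n \<noteq> 1"
  proof
    assume "n = 1"
    then have "j = Suc i" using i(1) by (simp add: n_def)
    then show False using i(2) wne[of i] by simp
  qed
  \<comment> \<open>Length two does occur: two parallel edges give an induced cycle of four
    halves.\<close>
  then have n: "n \<ge> 2" using i by (simp add: n_def)
  have vdist: "v p \<noteq> v q" if "i \<le> p" "p < q" "q < j" for p q
  proof
    assume "v p = v q"
    then have eq: "{w p, w (Suc p)} = {w q, w (Suc q)}" using Nv by metis
    have "w p \<noteq> w q" using wdist that by simp
    then have *: "w p = w (Suc q)" "w (Suc p) = w q" using eq by (auto simp: doubleton_eq_iff)
    have "Suc p = q"
    proof (rule ccontr)
      assume "Suc p \<noteq> q"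
      then show False using wdist[of "Suc p" q] that *(2) by simp
    qed
    then show False using \<open>v p = v q\<close> vne[of p] by simp
  qed
  define \<omega> where "\<omega> m = w (i + m mod n)" for m
  have \<omega>: "\<omega> m = w (i + m)" if "m \<le> n" for m
    using that i n by (cases "m = n") (auto simp: \<omega>_def n_def)
  have \<omega>inj: "\<omega> a = \<omega> b \<longleftrightarrow> a mod n = b mod n" for a b
  proof -
    have "a mod n < n" "b mod n < n" using n by auto
    then have "i + a mod n < j" "i + b mod n < j" using i(1) unfolding n_def by linarith+
    then show ?thesis using wdist[of "i + a mod n" "i + b mod n"] wdist[of "i + b mod n" "i + a mod n"]
      by (cases "a mod n" "b mod n" rule: linorder_cases) (auto simp: \<omega>_def)
  qed
  have vinj: "v (i + a) = v (i + b) \<longleftrightarrow> a = b" if "a < n" "b < n" for a b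
  proof -
    have "i + a < j" "i + b < j" using that by (auto simp: n_def)
    then show ?thesis using vdist[of "i + a" "i + b"] vdist[of "i + b" "i + a"]
      by (cases a b rule: linorder_cases) auto
  qed
  define h where "h p = {v (i + p div 2), \<omega> (Suc p div 2)}" for p
  have hin: "v (i + p div 2) \<in> Y" "\<omega> (Suc p div 2) \<in> N (v (i + p div 2))" if "p < 2 * n" for p
  proof -
    show "v (i + p div 2) \<in> Y" by (rule vY)
    define a where "a = p div 2"
    define c where "c = Suc p div 2"
    have ca: "c = a \<or> c = Suc a" unfolding a_def c_def by presburger
    have "c \<le> n" using that unfolding c_def by presburger
    then have "\<omega> c = w (i + c)" by (rule \<omega>)
    moreover have "i + c = i + a \<or> i + c = Suc (i + a)" using ca by auto
    ultimately have "\<omega> c \<in> N (v (i + a))" using Nv[of "i + a"] by (metis insertCI)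
    then show "\<omega> (Suc p div 2) \<in> N (v (i + p div 2))" by (simp only: a_def c_def)
  qed
  have vw: "v (i + p div 2) \<noteq> \<omega> (Suc q div 2)" if "p < 2 * n" "q < 2 * n" for p q
  proof -
    have "v (i + p div 2) \<in> X" using hin(1)[OF that(1)] YX by (rule subsetD[rotated])
    moreover have "\<omega> (Suc q div 2) \<in> \<Union> (N ` X)" using hin[OF that(2)] YX by (meson UN_I subsetD)
    ultimately show ?thesis using disj by (metis disjoint_iff)
  qed
  have meet: "h p \<inter> h q \<noteq> {} \<longleftrightarrow> p div 2 = q div 2 \<or> Suc p div 2 mod n = Suc q div 2 mod n"
    if "p < 2 * n" "q < 2 * n" for p q
  proof -
    have "p div 2 < n" "q div 2 < n" using that by auto
    note eqs = vinj[OF this] \<omega>inj[of "Suc p div 2" "Suc q div 2"]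
    have "{x, y} \<inter> {x', y'} \<noteq> {} \<longleftrightarrow> x = x' \<or> y = y'" if "x \<noteq> y'" "x' \<noteq> y" for x y x' y' :: 'v
      using that by auto
    from this[OF vw[OF that] vw[OF that(2,1)]] show ?thesis unfolding h_def eqs .
  qed
  have heq: "h p = h q \<longleftrightarrow> p = q" if "p < 2 * n" "q < 2 * n" for p q
  proof
    assume "h p = h q"
    then have "v (i + p div 2) = v (i + q div 2)" "\<omega> (Suc p div 2) = \<omega> (Suc q div 2)"
      using vw[OF that] vw[OF that(2,1)] by (auto simp: h_def doubleton_eq_iff)
    moreover have "p div 2 < n" "q div 2 < n" using that by auto
    ultimately have 1: "p div 2 = q div 2" and 2: "Suc p div 2 mod n = Suc q div 2 mod n"
      using vinj[of "p div 2" "q div 2"] \<omega>inj by blast+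
    show "p = q"
    proof (rule ccontr)
      assume "p \<noteq> q"
      from \<open>p \<noteq> q\<close> have "p < q \<or> q < p" by auto
      then have "\<exists>x. x mod n = Suc x mod n" using 1 2 Suc_div_two_Suc[of p q] Suc_div_two_Suc[of q p] by metis
      then show False using n by (auto simp: mod_Suc split: if_splits)
    qed
  qed simp
  have "line.ecycle (h ` {..<2 * n})"
    unfolding line.ecycle_def
  proof (intro exI[of _ "2 * n"] exI[of _ h] conjI allI impI)
    show "bij_betw h {..<2 * n} (h ` {..<2 * n})"
      using heq by (auto simp: bij_betw_def inj_on_def)
    show "line_adj (h p) (h q) \<longleftrightarrow> q = Suc p mod (2 * n) \<or> p = Suc q mod (2 * n)"
      if "p < 2 * n" "q < 2 * n" for p q
      using cycle_index_adjacent[OF n that] meet[OF that] heq[OF that] unfolding line_adj_def by metis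
  qed (use n in auto)
  moreover have "h ` {..<2 * n} \<subseteq> halves N X"
  proof
    fix e assume "e \<in> h ` {..<2 * n}"
    then obtain p where "p < 2 * n" "e = h p" by auto
    then show "e \<in> halves N X" using hin[of p] YX unfolding halves_def h_def by blast
  qed
  ultimately show ?thesis by blast
qed

text \<open>Two successive minimal choices are made: a dense edge set \<open>E1\<close>, and after
  giving up one edge a nearly dense part \<open>Y\<close>. Minimality of \<open>Y\<close> yields two
  edges across every cut, its density yields a spare cycle, and density of \<open>E1\<close> yields
  an edge outside \<open>Y\<close> for the pendant half \<open>b\<close>.\<close>

lemma ex_reducible_halves:
  fixes N :: "'v \<Rightarrow> 'v set"
  assumes fin: "finite D" and two: "\<And>v. v \<in> D \<Longrightarrow> card (N v) = 2"
    and disj: "D \<inter> \<Union> (N ` D) = {}" and dense: "3 * card (\<Union> (N ` D)) < 2 * card D"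
  shows "\<exists>H b. line.reducible H b \<and> H \<subseteq> halves N D"
proof -
  define W where "W X = \<Union> (N ` X)" for X
  have finN: "finite (N v)" if "v \<in> D" for v using two[OF that] by (metis card.infinite zero_neq_numeral)
  have finW: "finite (W X)" if "X \<subseteq> D" for X
    using that finN finite_subset[OF that fin] by (auto simp: W_def)
  have W2: "card (W X) \<ge> 2" if X: "X \<subseteq> D" "X \<noteq> {}" for X
  proof -
    obtain v where v: "v \<in> X" using X by auto
    then have "card (N v) \<le> card (W X)" using finW[OF X(1)] by (intro card_mono) (auto simp: W_def)
    then show ?thesis using two[of v] v X by auto
  qed

  define P where "P X \<longleftrightarrow> X \<subseteq> D \<and> 3 * card (W X) < 2 * card X" for X
  have "P D" using dense by (simp add: P_def W_def)
  then obtain E1 where E1: "P E1" and min1: "\<And>X. P X \<Longrightarrow> card E1 \<le> card X"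
    using exists_least_iff[of "\<lambda>n. \<exists>Z. P Z \<and> card Z = n"] by (metis not_less)
  have E1D: "E1 \<subseteq> D" and E1d: "3 * card (W E1) < 2 * card E1" using E1 by (auto simp: P_def)
  have finE1: "finite E1" using E1D fin finite_subset by blast
  have E1ne: "E1 \<noteq> {}" using E1d by auto
  then obtain v0 where v0: "v0 \<in> E1" by auto
  have proper1: "2 * card X \<le> 3 * card (W X)" if "X \<subset> E1" for X
  proof (rule ccontr)
    assume "\<not> ?thesis"
    then have "P X" using that E1D by (auto simp: P_def)
    then show False using min1 psubset_card_mono[OF finE1 that] by (metis leD)
  qed

  \<comment> \<open>From \<open>3 * card (W E1) < 2 * card E1\<close>, deleting \<open>v0\<close>
    leaves exactly the slack \<open>+ 1\<close>. Excluding \<open>v0\<close> keeps \<open>Y\<close>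
    a proper part of \<open>E1\<close>.\<close>
  define Q where "Q X \<longleftrightarrow> X \<subseteq> E1 - {v0} \<and> X \<noteq> {} \<and> 3 * card (W X) \<le> 2 * card X + 1" for X
  have "Q (E1 - {v0})"
  proof -
    have "card (W (E1 - {v0})) \<le> card (W E1)" using finW[OF E1D] by (intro card_mono) (auto simp: W_def)
    moreover have "card (E1 - {v0}) = card E1 - 1" using v0 finE1 by simp
    moreover have "E1 - {v0} \<noteq> {}"
    proof
      assume "E1 - {v0} = {}"
      then have "card E1 \<le> 1" using v0 by (metis Diff_eq_empty_iff card.empty card_mono finite.intros is_singletonI is_singleton_altdef)
      then show False using E1d W2[OF E1D E1ne] by linarith
    qed
    ultimately show ?thesis using E1d by (simp add: Q_def)
  qed
  then obtain Y where Y: "Q Y" and min2: "\<And>X. Q X \<Longrightarrow> card Y \<le> card X"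
    using exists_least_iff[of "\<lambda>n. \<exists>Z. Q Z \<and> card Z = n"] by (metis not_less)
  have YE1: "Y \<subseteq> E1 - {v0}" and Yne: "Y \<noteq> {}" and Yd: "3 * card (W Y) \<le> 2 * card Y + 1"
    using Y by (auto simp: Q_def)
  have YD: "Y \<subseteq> D" using YE1 E1D by auto
  have finY: "finite Y" using YD fin finite_subset by blast
  have finWY: "finite (W Y)" using finW[OF YD] .
  have WY2: "card (W Y) \<ge> 2" using W2[OF YD Yne] .
  define ins where "ins U = {v \<in> Y. N v \<subseteq> U}" for U
  define crs where "crs U = {v \<in> Y. N v \<inter> U \<noteq> {} \<and> \<not> N v \<subseteq> U}" for U
  have NW: "N v \<subseteq> W Y" if "v \<in> Y" for v using that by (auto simp: W_def)
  have Nne: "N v \<noteq> {}" if "v \<in> Y" for v using two[of v] that YD by auto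

  \<comment> \<open>The edges inside a proper vertex subset are a smaller set than \<open>Y\<close>,
    so \<open>Q\<close> fails for them.\<close>
  have ins_le: "2 * card (ins U) + 2 \<le> 3 * card U" if U: "U \<subset> W Y" "U \<noteq> {}" for U
  proof (cases "ins U = {}")
    case True
    have "card U \<ge> 1" using U finWY by (metis One_nat_def Suc_leI card_gt_0_iff finite_subset psubset_imp_subset)
    then show ?thesis using True by simp
  next
    case False
    have sub: "W (ins U) \<subseteq> U" by (auto simp: W_def ins_def)
    have "ins U \<noteq> Y" using U sub by auto
    then have "card (ins U) < card Y" using finY by (intro psubset_card_mono) (auto simp: ins_def)
    then have "\<not> Q (ins U)" using min2 by (metis leD)
    moreover have "ins U \<subseteq> E1 - {v0}" using YE1 by (auto simp: ins_def)
    ultimately have "2 * card (ins U) + 1 < 3 * card (W (ins U))" using False by (auto simp: Q_def)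
    moreover have "card (W (ins U)) \<le> card U"
      using sub U finWY by (meson card_mono finite_subset psubset_imp_subset)
    ultimately show ?thesis by linarith
  qed

  have split_Y: "card Y = card (ins U) + card (ins (W Y - U)) + card (crs U)" for U
  proof -
    have "Y = ins U \<union> ins (W Y - U) \<union> crs U" using NW by (auto simp: ins_def crs_def)
    moreover have "ins U \<inter> ins (W Y - U) = {}" "(ins U \<union> ins (W Y - U)) \<inter> crs U = {}"
      using Nne by (auto simp: ins_def crs_def)
    moreover have "finite (ins U)" "finite (ins (W Y - U))" "finite (crs U)"
      using finY by (auto simp: ins_def crs_def)
    ultimately show ?thesis by (metis card_Un_disjoint finite_UnI)
  qed
  have split_W: "card (W Y) = card U + card (W Y - U)" if "U \<subseteq> W Y" for U
    using that finWY by (metis card_Diff_subset card_mono finite_subset le_add_diff_inverse)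

  \<comment> \<open>Adding \<open>ins_le\<close> for both sides of the cut to the density of
    \<open>Y\<close> gives \<open>2 * card (crs U) \<ge> 3\<close>. So \<open>Y\<close> is connected
    and has no bridge.\<close>
  have crs_ge: "card (crs U) \<ge> 2" if U: "U \<subset> W Y" "U \<noteq> {}" for U
  proof -
    have "W Y - U \<subset> W Y" "W Y - U \<noteq> {}" "U \<subseteq> W Y" using U by auto
    then show ?thesis
      using ins_le[OF U] ins_le[of "W Y - U"] split_Y[of U] split_W[of U] Yd by linarith
  qed

  \<comment> \<open>Otherwise \<open>Y\<close> and the rest of \<open>E1\<close> would be proper
    parts without a common vertex, neither of them dense, and \<open>E1\<close> would not be dense
    either.\<close>
  have "\<exists>vb\<in>E1 - Y. N vb \<inter> W Y \<noteq> {}"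
  proof (rule ccontr)
    assume neg: "\<not> ?thesis"
    have "W E1 = W Y \<union> W (E1 - Y)" "W Y \<inter> W (E1 - Y) = {}" using neg YE1 by (auto simp: W_def)
    moreover have "finite (W (E1 - Y))" using E1D by (intro finW) auto
    ultimately have "card (W E1) = card (W Y) + card (W (E1 - Y))" using finWY by (simp add: card_Un_disjoint)
    moreover have "card E1 = card Y + card (E1 - Y)"
      using YE1 finE1 finY by (metis card_Diff_subset card_mono le_add_diff_inverse subset_Diff_insert Diff_subset subset_trans)
    moreover have "2 * card Y \<le> 3 * card (W Y)" using YE1 v0 by (intro proper1) auto
    moreover have "2 * card (E1 - Y) \<le> 3 * card (W (E1 - Y))" using YE1 Yne by (intro proper1) auto
    ultimately show False using E1d by linarith
  qed
  then obtain vb w0 where vb: "vb \<in> E1" "vb \<notin> Y" and w0: "w0 \<in> N vb" "w0 \<in> W Y" by auto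
  have vbD: "vb \<in> D" using vb E1D by auto
  define b where "b = {vb, w0}"
  define H where "H = insert b (halves N Y)"

  have DW: "v \<notin> W D" if "v \<in> D" for v using disj that by (auto simp: W_def)
  have half_eq: "{v, w} = {v', w'} \<longleftrightarrow> v = v' \<and> w = w'" if "v \<in> D" "v' \<in> D" "w \<in> W D" "w' \<in> W D" for v v' w w'
    using DW that by (auto simp: doubleton_eq_iff)
  have half_adj: "line_adj {v, w} {v', w'} \<longleftrightarrow> (v = v' \<or> w = w') \<and> \<not> (v = v' \<and> w = w')"
    if "v \<in> D" "v' \<in> D" "w \<in> W D" "w' \<in> W D" for v v' w w'
    using DW that half_eq[OF that] unfolding line_adj_def by auto
  have WYD: "W Y \<subseteq> W D" using YD by (auto simp: W_def)
  have half_H: "{v, w} \<in> H \<longleftrightarrow> (v \<in> Y \<and> w \<in> N v) \<or> (v = vb \<and> w = w0)" if "v \<in> D" "w \<in> W D" for v w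
  proof -
    have "{v, w} \<in> halves N Y \<longleftrightarrow> v \<in> Y \<and> w \<in> N v"
    proof
      assume "{v, w} \<in> halves N Y"
      then obtain v' w' where "{v, w} = {v', w'}" "v' \<in> Y" "w' \<in> N v'" by (auto simp: halves_def)
      moreover from this have "v = v' \<and> w = w'" using half_eq[of v v' w w'] that YD NW WYD by blast
      ultimately show "v \<in> Y \<and> w \<in> N v" by simp
    qed (auto simp: halves_def)
    moreover have "{v, w} = b \<longleftrightarrow> v = vb \<and> w = w0" using half_eq[of v vb w w0] that vbD w0 WYD b_def by auto
    ultimately show ?thesis by (auto simp: H_def)
  qed
  have H_cases: "\<exists>v w. h = {v, w} \<and> v \<in> D \<and> w \<in> W Y \<and> w \<in> N v \<and> (v \<in> Y \<or> (v = vb \<and> w = w0))" if "h \<in> H" for h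
    using that YD NW vbD w0 by (auto simp: H_def halves_def b_def) blast
  have bH: "b \<in> H" by (simp add: H_def)
  have finH: "finite H"
  proof -
    have "halves N Y \<subseteq> (\<lambda>(v, w). {v, w}) ` (Y \<times> W Y)" using NW by (auto simp: halves_def)
    then show ?thesis using finY finWY by (auto simp: H_def intro: finite_subset)
  qed
  have nbb: "line.nb b H = {{v, w0} |v. v \<in> Y \<and> w0 \<in> N v}"
  proof (intro subset_antisym subsetI)
    fix h assume "h \<in> line.nb b H"
    then have h: "h \<in> H" "line_adj b h" by (auto simp: line.nb_def)
    then obtain v w where vw: "h = {v, w}" "v \<in> D" "w \<in> W Y" "w \<in> N v" "v \<in> Y \<or> (v = vb \<and> w = w0)"
      using H_cases by blast
    then have "(vb = v \<or> w0 = w) \<and> \<not> (vb = v \<and> w0 = w)"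
      using h(2) half_adj[of vb v w0 w] vbD w0 WYD b_def by auto
    then show "h \<in> {{v, w0} |v. v \<in> Y \<and> w0 \<in> N v}" using vw vb by auto
  next
    fix h assume "h \<in> {{v, w0} |v. v \<in> Y \<and> w0 \<in> N v}"
    then obtain v where v: "h = {v, w0}" "v \<in> Y" "w0 \<in> N v" by auto
    then have "line_adj b h" using half_adj[of vb v w0 w0] vbD YD w0 WYD vb b_def by auto
    then show "h \<in> line.nb b H" using v half_H[of v w0] YD w0 WYD by (auto simp: line.nb_def)
  qed

  define pts where "pts R = {w \<in> W Y. \<exists>v\<in>D. w \<in> N v \<and> {v, w} \<in> R}" for R
  \<comment> \<open>The halves at one multigraph vertex are pairwise adjacent, so a closed set
    contains all of those in \<open>S\<close> or none.\<close>
  have spread: "{v, w} \<in> R" if R: "line.closed_in R S" and S: "S \<subseteq> H" and vw: "w \<in> pts R" "v \<in> D" "{v, w} \<in> S" for R S v w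
  proof -
    obtain v' where v': "v' \<in> D" "{v', w} \<in> R" "w \<in> W D" using vw WYD by (auto simp: pts_def)
    show ?thesis
    proof (cases "v' = v")
      case False
      then have "line_adj {v', w} {v, w}" using half_adj[of v' v w w] v' vw by auto
      then show ?thesis using R v' vw unfolding line.closed_in_def line.nb_def by blast
    qed (use v' in simp)
  qed
  have pts_ne: "pts R \<noteq> {}" if R: "R \<subseteq> H" "R \<noteq> {}" for R
  proof -
    obtain h where h: "h \<in> R" using R by auto
    then obtain v w where "h = {v, w}" "v \<in> D" "w \<in> W Y" "w \<in> N v" using H_cases[of h] R by blast
    then have "w \<in> pts R" using h by (auto simp: pts_def)
    then show ?thesis by auto
  qed
  \<comment> \<open>The two halves of an edge are adjacent, so an edge that leaves
    \<open>pts R\<close> must have lost a half.\<close>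
  have no_cross: "{v, x} \<notin> S \<or> {v, y} \<notin> S"
    if R: "line.closed_in R S" and S: "S \<subseteq> H" and v: "v \<in> Y" "N v = {x, y}" "x \<in> pts R" "y \<notin> pts R" for R S v x y
  proof (rule ccontr)
    assume "\<not> ?thesis"
    then have in_S: "{v, x} \<in> S" "{v, y} \<in> S" by auto
    have vD: "v \<in> D" and xy: "x \<in> W D" "y \<in> W D" "y \<in> W Y" using v YD NW[of v] WYD by auto
    have "{v, x} \<in> R" using spread[OF R S v(3) vD in_S(1)] .
    moreover have "x \<noteq> y" using v by auto
    ultimately have "{v, y} \<in> R"
      using R in_S half_adj[of v v x y] vD xy unfolding line.closed_in_def line.nb_def by blast
    then show False using v vD xy by (auto simp: pts_def)
  qed
  have crs_cases: "\<exists>x y. N v = {x, y} \<and> x \<in> U \<and> y \<notin> U" if v: "v \<in> crs U" for v U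
  proof -
    have "v \<in> D" using v YD by (auto simp: crs_def)
    then obtain x y where xy: "N v = {x, y}" using two[of v] by (auto simp: card_2_iff)
    then show ?thesis using v by (auto simp: crs_def)
  qed

  \<comment> \<open>Only \<open>v1\<close> has lost a half, but at least two edges cross any
    cut.\<close>
  have conn: "R = H - {{v1, w0}}" if v1: "v1 \<in> Y" "w0 \<in> N v1" and R: "line.closed_in R (H - {{v1, w0}})" "R \<noteq> {}" for v1 R
  proof -
    define S where "S = H - {{v1, w0}}"
    have RS: "line.closed_in R S" "S \<subseteq> H" "R \<subseteq> H" using R by (auto simp: S_def line.closed_in_def)
    have "pts R = W Y"
    proof (rule ccontr)
      assume "pts R \<noteq> W Y"
      then have U: "pts R \<subset> W Y" by (auto simp: pts_def)
      have "card (crs (pts R)) \<ge> 2" using crs_ge[OF U pts_ne[OF RS(3) R(2)]] .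
      then have "\<not> crs (pts R) \<subseteq> {v1}" using card_mono[of "{v1}" "crs (pts R)"] by auto
      then obtain v where v: "v \<in> crs (pts R)" "v \<noteq> v1" by auto
      then obtain x y where xy: "N v = {x, y}" "x \<in> pts R" "y \<notin> pts R" using crs_cases by blast
      have vY: "v \<in> Y" using v by (simp add: crs_def)
      have "{v, z} \<in> S" if "z \<in> N v" for z
        using half_H[of v z] half_eq[of v v1 z w0] vY v v1 YD NW[OF vY] WYD that w0 by (auto simp: S_def)
      then show False using no_cross[OF RS(1,2) vY xy] xy by auto
    qed
    have "h \<in> R" if h: "h \<in> S" for h
    proof -
      obtain v w where "h = {v, w}" "v \<in> D" "w \<in> W Y" using H_cases h RS(2) by blast
      then show ?thesis using spread[OF RS(1,2), of w v] \<open>pts R = W Y\<close> h by simp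
    qed
    then show ?thesis using RS(1) by (auto simp: S_def line.closed_in_def)
  qed

  \<comment> \<open>Density with \<open>card (W Y) \<ge> 2\<close> gives
    \<open>card Y > card (W Y)\<close>, so one edge can be spared and a cycle remains.\<close>
  have cyc: "\<exists>T. T \<subseteq> H - {{v1, w0}} \<and> line.ecycle T" if v1: "v1 \<in> Y" "w0 \<in> N v1" for v1
  proof -
    have c1: "card (Y - {v1}) = card Y - 1" using v1 finY by simp
    have c2: "card (W (Y - {v1})) \<le> card (W Y)" using finWY by (intro card_mono) (auto simp: W_def)
    have c3: "card (W Y) \<le> card (Y - {v1})" using c1 Yd WY2 by linarith
    then have "card (Y - {v1}) \<ge> 2" using WY2 by linarith
    then have "Y - {v1} \<noteq> {}" by (metis card.empty not_numeral_le_zero)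
    moreover have "(Y - {v1}) \<inter> \<Union> (N ` (Y - {v1})) = {}" using disj YD by auto
    moreover have "card (\<Union> (N ` (Y - {v1}))) \<le> card (Y - {v1})" using c2 c3 by (simp add: W_def)
    moreover have "card (N v) = 2" if "v \<in> Y - {v1}" for v using two that YD by auto
    ultimately obtain T where T: "T \<subseteq> halves N (Y - {v1})" "line.ecycle T"
      using ex_ecycle_halves[of "Y - {v1}" N] finY by blast
    have "halves N (Y - {v1}) \<subseteq> H - {{v1, w0}}"
    proof
      fix h assume "h \<in> halves N (Y - {v1})"
      then obtain v w where h: "h = {v, w}" "v \<in> Y" "v \<noteq> v1" "w \<in> N v" by (auto simp: halves_def)
      then show "h \<in> H - {{v1, w0}}"
        using half_H[of v w] half_eq[of v v1 w w0] v1 YD NW[OF h(2)] WYD w0 by auto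
    qed
    then show ?thesis using T by blast
  qed

  \<comment> \<open>A closed set that violates \<open>linked\<close> misses \<open>w0\<close>, can
    be left only along \<open>v1\<close> and \<open>v2\<close>, and has no even cycle. This forces
    it onto a single vertex \<open>z\<close> with no further edges in \<open>Y\<close>.\<close>
  have unlinked: "\<exists>z. z \<noteq> w0 \<and> {v \<in> Y. z \<in> N v} = {v1, v2}"
    if v12: "v1 \<in> Y" "w0 \<in> N v1" "v2 \<in> Y" "w0 \<in> N v2" "v1 \<noteq> v2"
      and nl: "\<not> line.linked H b {v1, w0} {v2, w0}" for v1 v2
  proof -
    define S where "S = H - {{v1, w0}, {v2, w0}}"
    obtain R where R: "line.closed_in R S" "R \<noteq> {}" "b \<notin> R" "\<And>T. T \<subseteq> R \<Longrightarrow> \<not> line.ecycle T"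
      using nl unfolding line.linked_def S_def by blast
    have RS: "S \<subseteq> H" "R \<subseteq> H" using R by (auto simp: S_def line.closed_in_def)
    define U where "U = pts R"
    have bS: "b \<in> S" using half_eq[of vb v1 w0 w0] half_eq[of vb v2 w0 w0] vbD v12 YD w0 WYD vb bH
      by (auto simp: S_def b_def)
    have "w0 \<notin> U" using spread[OF R(1) RS(1), of w0 vb] bS R(3) vbD by (auto simp: b_def U_def)
    then have Up: "U \<subset> W Y" using w0 by (auto simp: U_def pts_def)
    have Une: "U \<noteq> {}" using pts_ne[OF RS(2) R(2)] by (simp add: U_def)
    have in_S: "{v, z} \<in> S" if "v \<in> Y" "z \<in> N v" "v \<notin> {v1, v2}" for v z
      using half_H[of v z] half_eq[of v v1 z w0] half_eq[of v v2 z w0] that v12 YD NW[OF that(1)] WYD w0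
      by (auto simp: S_def)
    have "crs U \<subseteq> {v1, v2}"
    proof
      fix v assume v: "v \<in> crs U"
      then obtain x y where xy: "N v = {x, y}" "x \<in> U" "y \<notin> U" using crs_cases by blast
      have vY: "v \<in> Y" using v by (simp add: crs_def)
      show "v \<in> {v1, v2}"
      proof (rule ccontr)
        assume "v \<notin> {v1, v2}"
        then show False using no_cross[OF R(1) RS(1) vY, of x y] xy in_S[OF vY] by (auto simp: U_def)
      qed
    qed
    moreover have "card {v1, v2} \<le> card (crs U)" using crs_ge[OF Up Une] v12(5) by simp
    ultimately have crsU: "crs U = {v1, v2}" by (metis card_seteq finite.emptyI finite_insert)
    have halves_R: "halves N (ins U) \<subseteq> R"
    proof
      fix h assume "h \<in> halves N (ins U)"
      then obtain v w where h: "h = {v, w}" "v \<in> Y" "N v \<subseteq> U" "w \<in> N v" by (auto simp: halves_def ins_def)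
      have "v \<notin> {v1, v2}" using h(3) crsU by (auto simp: crs_def)
      then show "h \<in> R" using spread[OF R(1) RS(1), of w v] in_S[OF h(2,4)] h YD by (auto simp: U_def)
    qed
    \<comment> \<open>Since only two edges leave \<open>U\<close>, the density of \<open>Y\<close>
      and the bound for the other side force many edges inside \<open>U\<close>.\<close>
    have "card (W Y - U) + card U = card (W Y)" using split_W[of U] Up by auto
    moreover have "2 * card (ins (W Y - U)) + 2 \<le> 3 * card (W Y - U)" using ins_le[of "W Y - U"] Up Une by auto
    moreover have "card Y = card (ins U) + card (ins (W Y - U)) + 2" using split_Y[of U] crsU v12(5) by simp
    ultimately have lower: "2 * card (ins U) + 3 \<ge> 3 * card U" using Yd by linarith
    \<comment> \<open>With two or more vertices, \<open>U\<close> would have at least as many inner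
      edges as vertices, hence an even cycle of halves within \<open>R\<close>.\<close>
    have "card U = 1"
    proof (rule ccontr)
      assume "card U \<noteq> 1"
      moreover have "card U \<noteq> 0" using Une Up finWY by (meson card_eq_0_iff finite_subset psubset_imp_subset)
      ultimately have "card U \<le> card (ins U)" "card (ins U) \<noteq> 0" using lower by linarith+
      then have "ins U \<noteq> {}" by auto
      moreover have "card (\<Union> (N ` ins U)) \<le> card (ins U)"
      proof -
        have "\<Union> (N ` ins U) \<subseteq> U" by (auto simp: ins_def)
        then have "card (\<Union> (N ` ins U)) \<le> card U" using Up finWY by (meson card_mono finite_subset psubset_imp_subset)
        then show ?thesis using \<open>card U \<le> card (ins U)\<close> by linarith
      qed
      moreover have "ins U \<inter> \<Union> (N ` ins U) = {}" "finite (ins U)" using disj YD finY by (auto simp: ins_def)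
      moreover have "card (N v) = 2" if "v \<in> ins U" for v using two that YD by (auto simp: ins_def)
      ultimately obtain T where "T \<subseteq> halves N (ins U)" "line.ecycle T"
        using ex_ecycle_halves[of "ins U" N] by blast
      then show False using R(4) halves_R by blast
    qed
    then obtain z where z: "U = {z}" by (auto simp: card_1_singleton_iff)
    have "{v \<in> Y. z \<in> N v} = crs U"
    proof -
      have "N v \<noteq> {z}" if "v \<in> Y" for v using two[of v] that YD by auto
      then show ?thesis unfolding crs_def z by (auto simp: subset_singleton_iff)
    qed
    then show ?thesis using crsU z \<open>w0 \<notin> U\<close> by (intro exI[of _ z]) auto
  qed

  \<comment> \<open>If \<open>v1\<close> and \<open>v2\<close> are not linked, then they are
    parallel edges from \<open>w0\<close> to a vertex \<open>z\<close> that has no other edge. Every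
    third edge \<open>v3\<close> at \<open>w0\<close> is linked to both, because a failure would
    need a vertex other than \<open>w0\<close> shared by \<open>v3\<close> and one of them, and that
    could only be \<open>z\<close>.\<close>
  have links: "line.linked H b {v1, w0} {v2, w0} \<or> (\<exists>v3. v3 \<in> Y \<and> w0 \<in> N v3 \<and> v3 \<noteq> v1 \<and> v3 \<noteq> v2 \<and>
      line.linked H b {v1, w0} {v3, w0} \<and> line.linked H b {v3, w0} {v2, w0})"
    if v12: "v1 \<in> Y" "w0 \<in> N v1" "v2 \<in> Y" "w0 \<in> N v2" "v1 \<noteq> v2" for v1 v2
  proof (cases "line.linked H b {v1, w0} {v2, w0}")
    case False
    then obtain z where z: "z \<noteq> w0" "{v \<in> Y. z \<in> N v} = {v1, v2}" using unlinked[OF v12] by blast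
    have pair: "N v = {w0, z}" if "v \<in> {v1, v2}" for v
    proof -
      have "v \<in> Y" "w0 \<in> N v" "z \<in> N v" using that v12 z by auto
      moreover from this obtain x y where "N v = {x, y}" using two[of v] YD by (auto simp: card_2_iff)
      ultimately show ?thesis using z(1) by auto
    qed
    \<comment> \<open>If there were no third edge at \<open>w0\<close>, then \<open>Y\<close> would
      consist of two edges on two vertices, too few for its density.\<close>
    have "\<exists>v3. v3 \<in> Y \<and> w0 \<in> N v3 \<and> v3 \<notin> {v1, v2}"
    proof (rule ccontr)
      assume neg: "\<not> ?thesis"
      define U where "U = {w0, z}"
      have touch: "v \<in> {v1, v2}" if "v \<in> Y" "N v \<inter> U \<noteq> {}" for v
        using that neg z(2) by (auto simp: U_def)
      have "crs U = {}"
      proof (rule ccontr)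
        assume "crs U \<noteq> {}"
        then obtain v where "v \<in> Y" "N v \<inter> U \<noteq> {}" "\<not> N v \<subseteq> U" by (auto simp: crs_def)
        then show False using touch[of v] pair[of v] by (auto simp: U_def)
      qed
      moreover have "U \<subseteq> W Y" using NW[OF v12(1)] pair[of v1] by (auto simp: U_def)
      ultimately have "U = W Y" using crs_ge[of U] by (auto simp: U_def)
      then have "Y \<subseteq> {v1, v2}" using touch NW Nne by blast
      then have "card Y \<le> 2" using card_mono[of "{v1, v2}" Y] card_insert_le_m1[of 2 "{v2}" v1] by (auto simp: card_insert_if split: if_splits)
      moreover have "card (W Y) = 2" unfolding \<open>U = W Y\<close>[symmetric] U_def using z(1) by simp
      ultimately show False using Yd by linarith
    qed
    then obtain v3 where v3: "v3 \<in> Y" "w0 \<in> N v3" "v3 \<noteq> v1" "v3 \<noteq> v2" by auto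
    have "line.linked H b {v1, w0} {v3, w0}"
    proof (rule ccontr)
      assume "\<not> ?thesis"
      then obtain z' where z': "z' \<noteq> w0" "{v \<in> Y. z' \<in> N v} = {v1, v3}"
        using unlinked[OF v12(1,2) v3(1,2)] v3(3) by blast
      then have "z' \<in> N v1" by auto
      then have "z' = z" using pair[of v1] z'(1) by auto
      then show False using z z' v3 by auto
    qed
    moreover have "line.linked H b {v3, w0} {v2, w0}"
    proof (rule ccontr)
      assume "\<not> ?thesis"
      then obtain z' where z': "z' \<noteq> w0" "{v \<in> Y. z' \<in> N v} = {v3, v2}"
        using unlinked[OF v3(1,2) v12(3,4)] v3(4) by blast
      then have "z' \<in> N v2" by auto
      then have "z' = z" using pair[of v2] z'(1) by auto
      then show False using z z' v3 by auto
    qed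
    ultimately show ?thesis using v3 by blast
  qed simp

  have "line.reducible H b"
    unfolding line.reducible_def
  proof (intro conjI)
    have "\<exists>v\<in>Y. w0 \<in> N v" using w0 by (auto simp: W_def)
    then show "line.nb b H \<noteq> {}" unfolding nbb by auto
    have eqw0: "{v, w0} = {v', w0} \<longleftrightarrow> v = v'" if "v \<in> Y" "v' \<in> Y" for v v'
      using half_eq[of v v' w0 w0] that YD w0 WYD by auto
    show "\<forall>a\<in>line.nb b H. \<forall>a'\<in>line.nb b H. a \<noteq> a' \<longrightarrow> line_adj a a'"
      unfolding nbb by (auto simp: line_adj_def)
    show "\<forall>a\<in>line.nb b H. \<not> line.nb a H \<subseteq> insert b (line.nb b H)"
    proof
      fix a assume "a \<in> line.nb b H"
      then obtain v where v: "a = {v, w0}" "v \<in> Y" "w0 \<in> N v" unfolding nbb by auto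
      have "v \<in> D" using v YD by auto
      then obtain x y where "N v = {x, y}" "x \<noteq> y" using two[of v] by (auto simp: card_2_iff)
      then obtain w where w: "w \<in> N v" "w \<noteq> w0" by (cases "x = w0") auto
      have wD: "w \<in> W D" "v \<in> D" "w0 \<in> W D" using w v NW[of v] WYD YD w0 by auto
      have "{v, w} \<in> line.nb a H"
        using half_H[of v w] half_adj[of v v w0 w] wD v w by (auto simp: line.nb_def)
      moreover have "{v, w} \<notin> insert b (line.nb b H)"
      proof -
        have "{v, w} \<noteq> {v', w0}" if "v' \<in> D" for v' using half_eq[of v v' w w0] wD w that by auto
        then have "{v, w} \<noteq> b" "{v, w} \<notin> line.nb b H" unfolding nbb unfolding b_def using vbD YD by auto
        then show ?thesis by simp
      qed
      ultimately show "\<not> line.nb a H \<subseteq> insert b (line.nb b H)" by blast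
    qed
    show "\<forall>a\<in>line.nb b H. \<forall>R. line.closed_in R (H - {a}) \<longrightarrow> R \<noteq> {} \<longrightarrow> R = H - {a}"
      using conn unfolding nbb by blast
    show "\<forall>a\<in>line.nb b H. \<exists>T. T \<subseteq> H - {a} \<and> line.ecycle T"
      using cyc unfolding nbb by blast
    show "\<forall>a\<in>line.nb b H. \<forall>a'\<in>line.nb b H. a \<noteq> a' \<longrightarrow> line.linked H b a a' \<or>
        (\<exists>a''\<in>line.nb b H. a'' \<noteq> a \<and> a'' \<noteq> a' \<and> line.linked H b a a'' \<and> line.linked H b a'' a')"
    proof (intro ballI impI)
      fix a a' assume "a \<in> line.nb b H" "a' \<in> line.nb b H" and ne: "a \<noteq> a'"
      then obtain v1 v2 where v12: "a = {v1, w0}" "v1 \<in> Y" "w0 \<in> N v1" "a' = {v2, w0}" "v2 \<in> Y" "w0 \<in> N v2"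
        unfolding nbb by auto
      have "v1 \<noteq> v2" using ne v12 by auto
      from links[OF v12(2,3,5,6) this] show "line.linked H b a a' \<or>
        (\<exists>a''\<in>line.nb b H. a'' \<noteq> a \<and> a'' \<noteq> a' \<and> line.linked H b a a'' \<and> line.linked H b a'' a')"
      proof
        assume "\<exists>v3. v3 \<in> Y \<and> w0 \<in> N v3 \<and> v3 \<noteq> v1 \<and> v3 \<noteq> v2 \<and>
          line.linked H b {v1, w0} {v3, w0} \<and> line.linked H b {v3, w0} {v2, w0}"
        then obtain v3 where v3: "v3 \<in> Y" "w0 \<in> N v3" "v3 \<noteq> v1" "v3 \<noteq> v2"
          "line.linked H b {v1, w0} {v3, w0}" "line.linked H b {v3, w0} {v2, w0}" by blast
        then have "{v3, w0} \<in> line.nb b H" "{v3, w0} \<noteq> a" "{v3, w0} \<noteq> a'"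
          using eqw0 v12 unfolding nbb by auto
        moreover have "line.linked H b a {v3, w0} \<and> line.linked H b {v3, w0} a'" using v3 v12 by simp
        ultimately show ?thesis by (intro disjI2 bexI[of _ "{v3, w0}"] conjI) simp_all
      qed (use v12 in simp)
    qed
  qed (use finH bH in auto)
  moreover have "H \<subseteq> halves N D"
    using YD vbD w0(1) unfolding H_def halves_def b_def by blast
  ultimately show ?thesis by blast
qed

section \<open>Faces of plane graphs\<close>

abbreviation ends :: "(real \<Rightarrow> complex) \<Rightarrow> complex set" where
  "ends g \<equiv> {pathstart g, pathfinish g}"

abbreviation faces :: "complex set \<Rightarrow> complex set set" where
  "faces X \<equiv> components (- X)"

text \<open>The ends are left out because a face may have a vertex on its boundary without bordering
  the edges there.\<close>

definition touches :: "complex set \<Rightarrow> (real \<Rightarrow> complex) \<Rightarrow> bool" where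
  "touches W g \<longleftrightarrow> closure W \<inter> (path_image g - ends g) \<noteq> {}"

lemma connected_componentI: "connected T \<Longrightarrow> T \<subseteq> S \<Longrightarrow> x \<in> T \<Longrightarrow> y \<in> T \<Longrightarrow> connected_component S x y"
  unfolding connected_component_def by blast

lemma connected_subset_disjoint_open:
  assumes "connected S" "open P" "open Q" "P \<inter> Q = {}" "S \<subseteq> P \<union> Q"
  shows "S \<subseteq> P \<or> S \<subseteq> Q"
proof -
  have "P \<inter> Q \<inter> S = {}" using assms(4) by auto
  from connectedD[OF assms(1-3) this assms(5)] show ?thesis using assms(5) by auto
qed

lemma faces_eqI: "W \<in> faces X \<Longrightarrow> W' \<in> faces X \<Longrightarrow> x \<in> W \<Longrightarrow> y \<in> W' \<Longrightarrow> connected_component (- X) x y \<Longrightarrow> W = W'"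
  by (smt (verit) componentsE connected_component_eq mem_Collect_eq)

text \<open>A disc stays connected when one point is deleted. Its image under the inverse
  parametrisation would be a set of reals with at least three points, which deleting a middle one
  disconnects.\<close>

lemma interior_arc_empty:
  fixes g :: "real \<Rightarrow> complex"
  assumes "arc g"
  shows "interior (path_image g) = {}"
proof (rule ccontr)
  assume "interior (path_image g) \<noteq> {}"
  then obtain x r where r: "r > 0" "ball x r \<subseteq> path_image g" by (metis equals0I mem_interior)
  obtain h where h: "homeomorphism {0..1} (path_image g) g h" using assms homeomorphism_arc by blast
  define I where "I = h ` ball x r"
  have conI: "connected (h ` (ball x r - T))" if "finite T" for T
  proof (rule connected_continuous_image)
    show "continuous_on (ball x r - T) h"
      using h r(2) by (meson Diff_subset continuous_on_subset homeomorphism_cont2 subset_trans)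
    show "connected (ball x r - T)" using that by (intro connected_open_delete_finite) auto
  qed
  have inj: "inj_on h (ball x r)" using homeomorphism_apply2[OF h] r(2) by (intro inj_on_inverseI[of _ g]) auto
  have "infinite (ball x r)" using r(1) by (simp add: uncountable_ball uncountable_infinite)
  then have "infinite I" using inj by (simp add: I_def finite_image_iff)
  then obtain S where S: "S \<subseteq> I" "card S = 3" by (metis infinite_arbitrarily_large)
  obtain t1 t2 t3 where t: "t1 \<in> I" "t2 \<in> I" "t3 \<in> I" "t1 < t2" "t2 < t3"
  proof -
    obtain p q s where "S = {p, q, s}" "p \<noteq> q" "q \<noteq> s" "p \<noteq> s" using S(2) by (auto simp: card_3_iff)
    then show ?thesis using S(1) that by (metis insert_subset linorder_neqE)
  qed
  obtain z where z: "z \<in> ball x r" "h z = t2" using t by (auto simp: I_def)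
  have "h ` (ball x r - {z}) = I - {t2}" using inj z by (auto simp: I_def inj_on_def)
  then have "connected (I - {t2})" using conI[of "{z}"] by simp
  then have "t2 \<in> I - {t2}"
    using t connectedD_interval[of "I - {t2}" t1 t3 t2] by auto
  then show False by simp
qed

text \<open>Once \<open>g\<close> is erased, a face touching it merges with the open arc, so all
  such faces end up in one component.\<close>

lemma touching_reaches_arc:
  assumes B: "closed B" and g: "arc g" "path_image g \<inter> B \<subseteq> ends g"
    and W: "W \<in> faces (B \<union> path_image g)" "touches W g"
    and y: "y \<in> W" and p: "p \<in> path_image g - ends g"
  shows "connected_component (- B) y p"
proof -
  obtain x where x: "x \<in> closure W" "x \<in> path_image g - ends g" using W(2) by (auto simp: touches_def)
  have sub: "path_image g - ends g \<subseteq> - B" using g(2) by auto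
  have WB: "W \<subseteq> - B" using in_components_subset[OF W(1)] by auto
  obtain r where r: "r > 0" "ball x r \<subseteq> - B"
    using x sub B by (metis open_Compl openE subsetD)
  obtain y' where y': "y' \<in> W" "y' \<in> ball x r" using x(1) r(1) by (metis closure_approachable dist_commute mem_ball)
  have "connected_component (- B) y y'"
    by (rule connected_componentI[of W]) (use in_components_connected[OF W(1)] WB y y' in auto)
  moreover have "connected_component (- B) y' x"
    by (rule connected_componentI[of "ball x r"]) (use r y' in auto)
  moreover have "connected_component (- B) x p"
    by (rule connected_componentI[of "path_image g - ends g"])
      (use connected_simple_path_endless[OF arc_imp_simple_path[OF g(1)]] sub x p in auto)
  ultimately show ?thesis by (meson connected_component_trans)
qed

lemma arc_interior_nonempty:
  fixes g :: "real \<Rightarrow> complex"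
  assumes "arc g"
  shows "path_image g - ends g \<noteq> {}"
  using nonempty_simple_path_endless[OF arc_imp_simple_path[OF assms]] by simp

text \<open>The frontier of such a face lies in \<open>B\<close> alone, so no connected set avoiding
  \<open>B\<close> can leave the face.\<close>

lemma face_untouched:
  assumes B: "closed B" and g: "arc g" "ends g \<subseteq> B"
    and W: "W \<in> faces (B \<union> path_image g)" "\<not> touches W g"
  shows "W \<in> faces B"
proof -
  have cl: "closed (B \<union> path_image g)" using B g by (simp add: closed_arc_image closed_Un)
  have oW: "open W" using W(1) cl open_components by blast
  have fr: "frontier W \<subseteq> B \<union> path_image g"
    using frontier_of_components_closed_complement[OF cl W(1)] .
  have fB: "frontier W \<inter> - B = {}"
    using fr W(2) g(2) closure_Un_frontier[of W] by (auto simp: touches_def)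
  have WB: "W \<subseteq> - B" using in_components_subset[OF W(1)] by auto
  show ?thesis
    unfolding in_components_maximal
  proof (intro conjI allI impI)
    show "W \<noteq> {}" "connected W" using W(1) in_components_nonempty in_components_connected by auto
    fix D assume D: "D \<noteq> {} \<and> W \<subseteq> D \<and> D \<subseteq> - B \<and> connected D"
    show "D = W"
    proof (rule ccontr)
      assume "D \<noteq> W"
      then have "D \<inter> W \<noteq> {}" "D - W \<noteq> {}" using D \<open>W \<noteq> {}\<close> by auto
      then have "D \<inter> frontier W \<noteq> {}" using D connected_Int_frontier by blast
      then show False using fB D by auto
    qed
  qed (use WB in auto)
qed

text \<open>An arc has empty interior and cannot fill the open set \<open>K\<close>.\<close>

lemma ex_face_in_face:
  assumes B: "closed B" and g: "arc g" and K: "K \<in> faces B"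
  shows "\<exists>W\<in>faces (B \<union> path_image g). W \<subseteq> K"
proof -
  have "open K" using K B open_components by blast
  moreover have "K \<noteq> {}" using K in_components_nonempty by auto
  ultimately have "\<not> K \<subseteq> path_image g" using interior_arc_empty[OF g] interior_maximal by blast
  then obtain y where y: "y \<in> K" "y \<notin> path_image g" by auto
  then have yX: "y \<in> - (B \<union> path_image g)" using in_components_subset[OF K] by auto
  define W where "W = connected_component_set (- (B \<union> path_image g)) y"
  have W: "W \<in> faces (B \<union> path_image g)" "y \<in> W" using yX by (auto simp: W_def componentsI)
  have "W \<subseteq> K"
    by (rule components_maximal[OF K]) (use W y in \<open>auto simp: in_components_connected dest: in_components_subset\<close>)
  then show ?thesis using W by blast
qed

text \<open>\<open>c\<close> is an arc that closes \<open>g\<close> up to a Jordan curve. At most one face on each side of this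
  curve touches \<open>g\<close>, by Janiszewski's theorem.\<close>

lemma faces_closing_arc:
  assumes B: "compact B" and g: "arc g" "path_image g \<inter> B \<subseteq> ends g"
    and c: "arc c" "path_image c \<subseteq> B" "pathstart c = pathfinish g" "pathfinish c = pathstart g"
    and X: "X = B \<union> path_image g"
  shows "card {W \<in> faces X. touches W g} \<le> 2 \<and> finite {W \<in> faces X. touches W g}"
    and "\<exists>y z. y \<notin> X \<and> z \<notin> X \<and> connected_component (- B) y z \<and> \<not> connected_component (- X) y z"
proof -
  define C where "C = path_image (g +++ c)"
  have Cim: "C = path_image g \<union> path_image c"
    using c by (simp add: C_def path_image_join)
  have ec: "ends g \<subseteq> path_image c" using c by (metis insert_subset empty_subsetI pathfinish_in_path_image pathstart_in_path_image)
  have sp: "simple_path (g +++ c)"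
    by (rule simple_path_join_loop) (use g c in auto)
  have loop: "pathfinish (g +++ c) = pathstart (g +++ c)" using c by simp
  note J = Jordan_inside_outside[OF sp loop, folded C_def]
  have io: "inside C \<subseteq> - C" "outside C \<subseteq> - C" using J by blast+
  have CB: "C \<inter> B = path_image c" using Cim g(2) c(2) ec by auto
  have cC: "compact C" using sp unfolding C_def by (simp add: compact_simple_path_image)
  have clB: "closed B" using B compact_imp_closed by blast
  have CX: "C \<union> B = X" using X Cim c(2) by auto
  obtain p where p: "p \<in> path_image g - ends g" using arc_interior_nonempty[OF g(1)] by auto
  have side: "W \<subseteq> inside C \<or> W \<subseteq> outside C" if W: "W \<in> faces X" for W
  proof -
    have "W \<subseteq> inside C \<union> outside C" using in_components_subset[OF W] CX J by auto
    moreover have "connected W" using W in_components_connected by auto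
    ultimately show ?thesis using J by (intro connected_subset_disjoint_open) auto
  qed
  \<comment> \<open>The two faces are joined off \<open>B\<close> through \<open>p\<close> and off
    \<open>C\<close> within one side. The set \<open>C \<inter> B\<close> is the arc
    \<open>c\<close>, hence connected, as Janiszewski's theorem requires.\<close>
  have same: "W = W'" if W: "W \<in> faces X" "touches W g" "W' \<in> faces X" "touches W' g"
    and S: "S = inside C \<or> S = outside C" "W \<subseteq> S" "W' \<subseteq> S" for W W' S
  proof -
    obtain y z where yz: "y \<in> W" "z \<in> W'" using W in_components_nonempty by blast
    have "connected_component (- B) y p" "connected_component (- B) z p"
      using touching_reaches_arc[OF clB g] W yz p X by blast+
    then have "connected_component (- B) y z" by (meson connected_component_sym connected_component_trans)
    moreover have "connected_component (- C) y z"
      by (rule connected_componentI[of S]) (use S yz J io in auto)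
    moreover have "connected (C \<inter> B)" using CB c by (simp add: connected_arc_image)
    ultimately have "connected_component (- (C \<union> B)) y z" using Janiszewski[OF cC clB] by blast
    then show ?thesis using faces_eqI[OF W(1,3) yz] CX by simp
  qed
  define T where "T = {W \<in> faces X. touches W g}"
  have inj: "inj_on (\<lambda>W. W \<subseteq> inside C) T"
  proof (rule inj_onI)
    fix W W' assume W: "W \<in> T" "W' \<in> T" and eq: "(W \<subseteq> inside C) = (W' \<subseteq> inside C)"
    then show "W = W'"
      using same[of W W' "inside C"] same[of W W' "outside C"] side[of W] side[of W'] by (auto simp: T_def)
  qed
  have "finite T" using inj finite_imageD by (metis finite finite_imageD)
  moreover have "card T \<le> card (UNIV :: bool set)" using inj by (intro card_inj_on_le[of "\<lambda>W. W \<subseteq> inside C"]) auto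
  ultimately show "card {W \<in> faces X. touches W g} \<le> 2 \<and> finite {W \<in> faces X. touches W g}"
    by (simp add: T_def)
  have "p \<notin> B" using p g(2) by auto
  then obtain r where r: "r > 0" "ball p r \<subseteq> - B" using clB by (metis ComplI open_Compl openE)
  \<comment> \<open>Every point of a Jordan curve borders both sides, so near \<open>p\<close> there
    are points of both, joined within a ball that misses \<open>B\<close>.\<close>
  have "p \<in> C" using p Cim by auto
  then have "p \<in> closure (inside C)" "p \<in> closure (outside C)" using J by (auto simp: closure_Un_frontier)
  then obtain y z where y: "y \<in> inside C" "y \<in> ball p r" and z: "z \<in> outside C" "z \<in> ball p r"
    using r(1) by (metis closure_approachable dist_commute mem_ball)
  have "y \<notin> X" "z \<notin> X" using y z r io CX by auto
  moreover have "connected_component (- B) y z"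
    by (rule connected_componentI[of "ball p r"]) (use r y z in auto)
  moreover have "\<not> connected_component (- X) y z"
  proof
    assume "connected_component (- X) y z"
    then obtain S where S: "connected S" "S \<subseteq> - X" "y \<in> S" "z \<in> S" by (auto simp: connected_component_def)
    then have "S \<subseteq> inside C \<union> outside C" using CX J by auto
    then have "S \<subseteq> inside C \<or> S \<subseteq> outside C"
      using S J by (intro connected_subset_disjoint_open) auto
    then show False using S J y z by blast
  qed
  ultimately show "\<exists>y z. y \<notin> X \<and> z \<notin> X \<and> connected_component (- B) y z \<and> \<not> connected_component (- X) y z"
    by blast
qed

text \<open>The complement of an arc is connected. \<open>B1\<close> and then \<open>B2\<close> are
  added by Janiszewski's theorem; each meets what is already there in a single point.\<close>

lemma arc_joining_separated_sets:
  fixes g :: "real \<Rightarrow> complex"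
  assumes B: "compact B1" "compact B2" "B1 \<inter> B2 = {}" and g: "arc g"
    "path_image g \<inter> B1 = {pathstart g}" "path_image g \<inter> B2 = {pathfinish g}"
    and yz: "connected_component (- (B1 \<union> B2)) y z" "y \<notin> path_image g" "z \<notin> path_image g"
  shows "connected_component (- (B1 \<union> B2 \<union> path_image g)) y z"
proof -
  have cl: "closed B1" "closed B2" using B by (simp_all add: compact_imp_closed)
  have cg: "compact (path_image g)" using g by (simp add: compact_arc_image)
  have "connected (- path_image g)" using connected_arc_complement[OF g(1)] by simp
  then have "connected_component (- path_image g) y z"
    using yz connected_componentI[of "- path_image g"] by auto
  moreover have "connected_component (- B1) y z" "connected_component (- B2) y z"
    by (rule connected_component_of_subset[OF yz(1)]; auto)+
  moreover have "connected (path_image g \<inter> B1)" using g by simp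
  ultimately have "connected_component (- (path_image g \<union> B1)) y z"
    using Janiszewski[OF cg cl(1)] by blast
  moreover have "(path_image g \<union> B1) \<inter> B2 = {pathfinish g}" using g B(3) by auto
  moreover have "compact (path_image g \<union> B1)" using cg B by auto
  ultimately have "connected_component (- (path_image g \<union> B1 \<union> B2)) y z"
    using Janiszewski[of "path_image g \<union> B1" B2 y z] cl \<open>connected_component (- B2) y z\<close> by simp
  then show ?thesis by (simp add: Un_ac)
qed

section \<open>Drawings of plane graphs\<close>

locale plane_graph =
  fixes V :: "'v set" and \<E> :: "'v set set" and pos :: "'v \<Rightarrow> complex" and \<gamma> :: "'v set \<Rightarrow> real \<Rightarrow> complex"
  assumes pos_inj: "inj_on pos V"
    and edge: "e \<in> \<E> \<Longrightarrow> e \<subseteq> V \<and> card e = 2"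
    and arc: "e \<in> \<E> \<Longrightarrow> arc (\<gamma> e)"
    and ends: "e \<in> \<E> \<Longrightarrow> ends (\<gamma> e) = pos ` e"
    and no_vertex: "e \<in> \<E> \<Longrightarrow> (path_image (\<gamma> e) - pos ` e) \<inter> pos ` V = {}"
    and no_crossing: "e \<in> \<E> \<Longrightarrow> f \<in> \<E> \<Longrightarrow> f \<noteq> e \<Longrightarrow> (path_image (\<gamma> e) - pos ` e) \<inter> path_image (\<gamma> f) = {}"
begin

definition drawing :: "'v set set \<Rightarrow> 'v set \<Rightarrow> complex set" where
  "drawing F X = pos ` X \<union> (\<Union>e\<in>F. path_image (\<gamma> e))"

definition reach :: "'v set set \<Rightarrow> 'v rel" where
  "reach F = {(u, v). {u, v} \<in> F}\<^sup>*"

definition subgraph :: "'v set set \<Rightarrow> 'v set \<Rightarrow> bool" where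
  "subgraph F X \<longleftrightarrow> finite F \<and> finite X \<and> F \<subseteq> \<E> \<and> X \<subseteq> V \<and> \<Union> F \<subseteq> X"

lemma subgraph_mono: "subgraph F X \<Longrightarrow> F' \<subseteq> F \<Longrightarrow> subgraph F' X"
  unfolding subgraph_def by (meson Union_mono finite_subset subset_trans)

lemma reach_mono: "F' \<subseteq> F \<Longrightarrow> (u, v) \<in> reach F' \<Longrightarrow> (u, v) \<in> reach F"
  unfolding reach_def by (erule rtrancl_mono[THEN subsetD, rotated]) auto

lemma reach_sym: "(u, v) \<in> reach F \<Longrightarrow> (v, u) \<in> reach F"
proof -
  have "sym {(u, v). {u, v} \<in> F}" by (auto simp: sym_def insert_commute)
  then show "(u, v) \<in> reach F \<Longrightarrow> (v, u) \<in> reach F"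
    unfolding reach_def by (metis sym_rtrancl symD)
qed

lemma reach_trans: "(u, v) \<in> reach F \<Longrightarrow> (v, w) \<in> reach F \<Longrightarrow> (u, w) \<in> reach F"
  unfolding reach_def by (rule rtrancl_trans)

lemma reach_edge: "{u, v} \<in> F \<Longrightarrow> (u, v) \<in> reach F"
  unfolding reach_def by auto

lemma drawing_insert: "drawing (insert e F) X = drawing F X \<union> path_image (\<gamma> e)"
  by (auto simp: drawing_def)

lemma compact_drawing: "subgraph F X \<Longrightarrow> compact (drawing F X)"
  unfolding drawing_def subgraph_def using arc
  by (intro compact_Un compact_UN) (auto intro: compact_arc_image finite_imp_compact)

lemma edge_meets_drawing:
  assumes "subgraph F X" "e \<in> \<E>" "e \<notin> F"
  shows "path_image (\<gamma> e) \<inter> drawing F X \<subseteq> ends (\<gamma> e)"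
  using assms no_vertex[OF assms(2)] no_crossing[OF assms(2)] ends[OF assms(2)]
  unfolding drawing_def subgraph_def by blast

lemma edge_ends:
  assumes "e \<in> \<E>"
  obtains u v where "e = {u, v}" "u \<noteq> v" "u \<in> V" "v \<in> V" "pathstart (\<gamma> e) = pos u" "pathfinish (\<gamma> e) = pos v"
proof -
  obtain a b where ab: "e = {a, b}" "a \<noteq> b" using edge[OF assms] by (auto simp: card_2_iff)
  have ne: "pathstart (\<gamma> e) \<noteq> pathfinish (\<gamma> e)" using arc_distinct_ends[OF arc[OF assms]] by simp
  have "{pathstart (\<gamma> e), pathfinish (\<gamma> e)} = {pos a, pos b}" using ends[OF assms] ab by simp
  then have "pathstart (\<gamma> e) = pos a \<and> pathfinish (\<gamma> e) = pos b \<or> pathstart (\<gamma> e) = pos b \<and> pathfinish (\<gamma> e) = pos a"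
    using ne by (auto simp: doubleton_eq_iff)
  moreover have "e = {b, a}" "a \<in> V" "b \<in> V" using ab edge[OF assms] by auto
  ultimately show ?thesis using that[of a b] that[of b a] ab by metis
qed

lemma pos_in_edge:
  assumes "e \<in> \<E>" "x \<in> V" "pos x \<in> path_image (\<gamma> e)"
  shows "x \<in> e"
proof -
  have "pos x \<in> pos ` e" using assms no_vertex[OF assms(1)] by blast
  then show ?thesis using pos_inj assms edge[OF assms(1)] by (meson inj_on_image_mem_iff)
qed

lemma reach_path_component:
  assumes F: "subgraph F X" and uv: "(u, v) \<in> reach F" "u \<in> X"
  shows "path_component (drawing F X) (pos u) (pos v)"
  using uv(1) unfolding reach_def
proof (induction rule: rtrancl_induct)
  case base
  then show ?case using uv(2) by (simp add: drawing_def path_component_refl_eq)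
next
  case (step a b)
  then have e: "{a, b} \<in> F" "{a, b} \<in> \<E>" using F by (auto simp: subgraph_def)
  have "path_connected (path_image (\<gamma> {a, b}))"
    using arc[OF e(2)] by (simp add: arc_imp_path path_connected_path_image)
  moreover have "pos a \<in> path_image (\<gamma> {a, b})" "pos b \<in> path_image (\<gamma> {a, b})"
    using ends[OF e(2)] pathstart_in_path_image[of "\<gamma> {a, b}"] pathfinish_in_path_image[of "\<gamma> {a, b}"]
    by (auto simp: doubleton_eq_iff)
  moreover have "path_image (\<gamma> {a, b}) \<subseteq> drawing F X" using e by (auto simp: drawing_def)
  ultimately have "path_component (drawing F X) (pos a) (pos b)"
    by (meson path_component_of_subset path_connected_component)
  then show ?case using step.IH path_component_trans by blast
qed

lemma reach_arc:
  assumes F: "subgraph F X" and uv: "(u, v) \<in> reach F" "u \<in> X" "v \<in> X" "u \<noteq> v"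
  obtains c where "arc c" "path_image c \<subseteq> drawing F X" "pathstart c = pos u" "pathfinish c = pos v"
proof -
  obtain p where p: "path p" "path_image p \<subseteq> drawing F X" "pathstart p = pos u" "pathfinish p = pos v"
    using reach_path_component[OF F uv(1,2)] by (auto simp: path_component_def)
  have "pos u \<noteq> pos v" using uv F pos_inj by (auto simp: subgraph_def inj_on_def)
  then obtain c where "arc c" "path_image c \<subseteq> path_image p" "pathstart c = pos u" "pathfinish c = pos v"
    using path_contains_arc[OF p(1,3,4)] by metis
  then show ?thesis using that p by blast
qed

text \<open>The vertices reachable from \<open>u\<close> with their edges form one compact set, all
  the rest the other. An edge of the first has no end in common with an edge of the second, so their
  arcs do not meet.\<close>

lemma unreachable_separation:
  assumes F: "subgraph F X" and uv: "(u, v) \<notin> reach F" "u \<in> X" "v \<in> X"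
  obtains B1 B2 where "compact B1" "compact B2" "B1 \<inter> B2 = {}" "drawing F X = B1 \<union> B2" "pos u \<in> B1" "pos v \<in> B2"
proof -
  define R where "R = {x. (u, x) \<in> reach F}"
  define F1 where "F1 = {e \<in> F. e \<subseteq> R}"
  define F2 where "F2 = {e \<in> F. e \<inter> R = {}}"
  have FF: "F = F1 \<union> F2"
  proof -
    have "e \<subseteq> R \<or> e \<inter> R = {}" if e: "e \<in> F" for e
    proof -
      have "card e = 2" using edge[of e] e F by (auto simp: subgraph_def)
      then obtain a b where ab: "e = {a, b}" by (auto simp: card_2_iff)
      then have "(a, b) \<in> reach F" "(b, a) \<in> reach F" using reach_edge reach_sym e by auto
      then show ?thesis using ab reach_trans by (auto simp: R_def)
    qed
    then show ?thesis by (auto simp: F1_def F2_def)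
  qed
  define B1 where "B1 = drawing F1 (X \<inter> R)"
  define B2 where "B2 = drawing F2 (X - R)"
  have sub: "subgraph F1 (X \<inter> R)" "subgraph F2 (X - R)"
    using F by (auto simp: subgraph_def F1_def F2_def)
  have "drawing F X = B1 \<union> B2" using FF by (auto simp: drawing_def B1_def B2_def)
  moreover have "B1 \<inter> B2 = {}"
  proof -
    have XV: "X \<subseteq> V" and FE: "F \<subseteq> \<E>" using F by (auto simp: subgraph_def)
    have 1: "pos ` (X \<inter> R) \<inter> pos ` (X - R) = {}"
      using inj_on_image_Int[OF pos_inj, of "X \<inter> R" "X - R"] XV by auto
    have 2: "pos x \<notin> path_image (\<gamma> e)" if "x \<in> X" "e \<in> F" "x \<notin> e" for x e
      using pos_in_edge[of e x] that XV FE by auto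
    have 3: "path_image (\<gamma> e) \<inter> path_image (\<gamma> f) = {}" if ef: "e \<in> F1" "f \<in> F2" for e f
    proof -
      have ed: "e \<in> \<E>" "f \<in> \<E>" "e \<inter> f = {}" using ef FE by (auto simp: F1_def F2_def)
      then have "e \<noteq> f" using edge[of e] by auto
      have "pos ` e \<inter> pos ` f = {}"
        using inj_on_image_Int[OF pos_inj, of e f] edge[OF ed(1)] edge[OF ed(2)] ed(3) by auto
      then show ?thesis using no_crossing[OF ed(1,2)] no_crossing[OF ed(2,1)] \<open>e \<noteq> f\<close> by blast
    qed
    show ?thesis
    proof (rule ccontr)
      assume "B1 \<inter> B2 \<noteq> {}"
      then obtain z where z: "z \<in> B1" "z \<in> B2" by auto
      from z(1) consider x where "x \<in> X \<inter> R" "z = pos x" | e where "e \<in> F1" "z \<in> path_image (\<gamma> e)"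
        by (auto simp: B1_def drawing_def)
      then show False
      proof cases
        case (1 x)
        from z(2) consider y where "y \<in> X - R" "z = pos y" | f where "f \<in> F2" "z \<in> path_image (\<gamma> f)"
          by (auto simp: B2_def drawing_def)
        then show False
        proof cases
          case (1 y)
          then show False using \<open>x \<in> X \<inter> R\<close> \<open>z = pos x\<close> \<open>pos ` (X \<inter> R) \<inter> pos ` (X - R) = {}\<close> by blast
        next
          case (2 f)
          then show False using 1 \<open>\<And>x e. x \<in> X \<Longrightarrow> e \<in> F \<Longrightarrow> x \<notin> e \<Longrightarrow> pos x \<notin> path_image (\<gamma> e)\<close>[of x f]
            by (auto simp: F2_def)
        qed
      next
        case (2 e)
        from z(2) consider y where "y \<in> X - R" "z = pos y" | f where "f \<in> F2" "z \<in> path_image (\<gamma> f)"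
          by (auto simp: B2_def drawing_def)
        then show False
        proof cases
          case (1 y)
          then show False using 2 \<open>\<And>x e. x \<in> X \<Longrightarrow> e \<in> F \<Longrightarrow> x \<notin> e \<Longrightarrow> pos x \<notin> path_image (\<gamma> e)\<close>[of y e]
            by (auto simp: F1_def)
        next
          case (2 f)
          then show False using 3[OF \<open>e \<in> F1\<close>, of f] \<open>z \<in> path_image (\<gamma> e)\<close> by blast
        qed
      qed
    qed
  qed
  moreover have "u \<in> R" "v \<notin> R" using uv by (auto simp: R_def reach_def)
  then have "pos u \<in> B1" "pos v \<in> B2" using uv by (auto simp: B1_def B2_def drawing_def)
  moreover have "compact B1" "compact B2" using compact_drawing sub by (auto simp: B1_def B2_def)
  ultimately show ?thesis using that by blast
qed

text \<open>The new edge meets each of two separated compact parts only in one of its ends, and such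
  an arc does not split a face.\<close>

lemma add_bridge:
  assumes F: "subgraph (insert e F) X" "e \<notin> F" and e: "e = {u, v}" "(u, v) \<notin> reach F"
    and yz: "connected_component (- drawing F X) y z" "y \<notin> drawing (insert e F) X" "z \<notin> drawing (insert e F) X"
  shows "connected_component (- drawing (insert e F) X) y z"
proof -
  have F': "subgraph F X" using F subgraph_mono by blast
  have eE: "e \<in> \<E>" and uvX: "u \<in> X" "v \<in> X" using F e by (auto simp: subgraph_def)
  obtain a b where ab: "e = {a, b}" "pathstart (\<gamma> e) = pos a" "pathfinish (\<gamma> e) = pos b"
    using edge_ends[OF eE] by metis
  have nr: "(a, b) \<notin> reach F" "a \<in> X" "b \<in> X" using e ab uvX reach_sym by (auto simp: doubleton_eq_iff)
  obtain B1 B2 where B: "compact B1" "compact B2" "B1 \<inter> B2 = {}" "drawing F X = B1 \<union> B2" "pos a \<in> B1" "pos b \<in> B2"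
    using unreachable_separation[OF F' nr] by blast
  have meet: "path_image (\<gamma> e) \<inter> (B1 \<union> B2) \<subseteq> {pos a, pos b}"
    using edge_meets_drawing[OF F' eE F(2)] ab B(4) by simp
  have in_im: "pos a \<in> path_image (\<gamma> e)" "pos b \<in> path_image (\<gamma> e)"
    using ab(2,3) by (metis pathstart_in_path_image, metis pathfinish_in_path_image)
  have "connected_component (- (B1 \<union> B2 \<union> path_image (\<gamma> e))) y z"
  proof (rule arc_joining_separated_sets[OF B(1-3) arc[OF eE]])
    show "path_image (\<gamma> e) \<inter> B1 = {pathstart (\<gamma> e)}" "path_image (\<gamma> e) \<inter> B2 = {pathfinish (\<gamma> e)}"
      using meet in_im B ab by auto
  qed (use yz B(4) in \<open>auto simp: drawing_insert\<close>)
  then show ?thesis using B(4) by (simp add: drawing_insert)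
qed

text \<open>If the ends of \<open>e\<close> stay connected without \<open>e\<close>, an arc between
  them closes \<open>e\<close> up to a Jordan curve. Otherwise \<open>e\<close> is a bridge, and at
  most one face touches it.\<close>

lemma faces_touching_edge:
  assumes F: "subgraph F X" and e: "e \<in> F"
  shows "finite {W \<in> faces (drawing F X). touches W (\<gamma> e)} \<and> card {W \<in> faces (drawing F X). touches W (\<gamma> e)} \<le> 2"
proof -
  define F0 where "F0 = F - {e}"
  have Fe: "F = insert e F0" "e \<notin> F0" using e by (auto simp: F0_def)
  have F': "subgraph F0 X" using F subgraph_mono by (auto simp: F0_def)
  have eE: "e \<in> \<E>" using F e by (auto simp: subgraph_def)
  obtain u v where uv: "e = {u, v}" "u \<noteq> v" "pathstart (\<gamma> e) = pos u" "pathfinish (\<gamma> e) = pos v"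
    using edge_ends[OF eE] by metis
  have uvX: "u \<in> X" "v \<in> X" using F e uv by (auto simp: subgraph_def)
  define B where "B = drawing F0 X"
  have X: "drawing F X = B \<union> path_image (\<gamma> e)" using Fe by (simp add: B_def drawing_insert)
  have B: "compact B" "path_image (\<gamma> e) \<inter> B \<subseteq> ends (\<gamma> e)"
    using compact_drawing[OF F'] edge_meets_drawing[OF F' eE Fe(2)] by (auto simp: B_def)
  show ?thesis
  proof (cases "(v, u) \<in> reach F0")
    case True
    obtain c where "arc c" "path_image c \<subseteq> B" "pathstart c = pos v" "pathfinish c = pos u"
      using reach_arc[OF F' True uvX(2,1)] uv(2) unfolding B_def by metis
    then show ?thesis using faces_closing_arc(1)[OF B(1) arc[OF eE] B(2) _ _ _ _ X, of c] uv by auto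
  next
    case False
    then have nr: "(u, v) \<notin> reach F0" using reach_sym by blast
    obtain p where p: "p \<in> path_image (\<gamma> e) - ends (\<gamma> e)" using arc_interior_nonempty[OF arc[OF eE]] by blast
    have one: "W = W'" if W: "W \<in> faces (drawing F X)" "touches W (\<gamma> e)" "W' \<in> faces (drawing F X)" "touches W' (\<gamma> e)" for W W'
    proof -
      obtain y z where yz: "y \<in> W" "z \<in> W'" using W in_components_nonempty by blast
      have "connected_component (- B) y p" "connected_component (- B) z p"
        using touching_reaches_arc[OF compact_imp_closed[OF B(1)] arc[OF eE] B(2)] W yz p X by metis+
      then have "connected_component (- drawing F0 X) y z"
        unfolding B_def by (meson connected_component_sym connected_component_trans)
      moreover have "y \<notin> drawing F X" "z \<notin> drawing F X"
        using yz in_components_subset[OF W(1)] in_components_subset[OF W(3)] by auto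
      ultimately have "connected_component (- drawing F X) y z"
        using add_bridge[of e F0 X u v y z] F Fe uv nr by simp
      then show ?thesis using faces_eqI[OF W(1,3) yz] by simp
    qed
    define T where "T = {W \<in> faces (drawing F X). touches W (\<gamma> e)}"
    have "T \<subseteq> {W}" if "W \<in> T" for W using one that by (auto simp: T_def)
    then have "T = {} \<or> (\<exists>W. T = {W})" by blast
    then show ?thesis unfolding T_def[symmetric] by auto
  qed
qed

text \<open>A face that is not already present before the edge is added touches the edge, and at
  most two faces do.\<close>

lemma finite_faces:
  assumes "subgraph F X"
  shows "finite (faces (drawing F X))"
proof -
  have "finite F" using assms by (simp add: subgraph_def)
  then show ?thesis using assms
  proof (induction F rule: finite_induct)
    case empty
    have "connected (- pos ` X)"
      using connected_open_delete_finite[of UNIV "pos ` X"] connected_UNIV empty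
      by (simp add: subgraph_def Compl_eq_Diff_UNIV)
    then have "components (- pos ` X) \<subseteq> {- pos ` X}" using components_eq_sing_iff by (metis components_empty empty_subsetI order_refl)
    then show ?case using finite_subset by (auto simp: drawing_def)
  next
    case (insert e F)
    have F': "subgraph F X" using insert.prems subgraph_mono by blast
    have eE: "e \<in> \<E>" using insert.prems by (auto simp: subgraph_def)
    have "ends (\<gamma> e) \<subseteq> drawing F X"
      using ends[OF eE] insert.prems by (auto simp: drawing_def subgraph_def)
    then have "faces (drawing (insert e F) X) \<subseteq> faces (drawing F X) \<union> {W \<in> faces (drawing (insert e F) X). touches W (\<gamma> e)}"
      using face_untouched[OF compact_imp_closed[OF compact_drawing[OF F']] arc[OF eE]] by (auto simp: drawing_insert)
    then show ?case using insert.IH[OF F'] faces_touching_edge[OF insert.prems, of e] finite_subset by blast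
  qed
qed

text \<open>\<open>h\<close> picks a new face inside every old one, injectively. If the edge closes
  a cycle, some old face contains two new ones, and one of them is not picked.\<close>

lemma card_faces_insert:
  assumes F: "subgraph (insert e F) X" "e \<notin> F" and e: "e = {u, v}"
  shows "card (faces (drawing F X)) + (if (u, v) \<in> reach F then 1 else 0) \<le> card (faces (drawing (insert e F) X))"
proof -
  have F': "subgraph F X" using F subgraph_mono by blast
  have eE: "e \<in> \<E>" using F by (auto simp: subgraph_def)
  define B where "B = drawing F X"
  define Y where "Y = drawing (insert e F) X"
  have Y: "Y = B \<union> path_image (\<gamma> e)" by (simp add: B_def Y_def drawing_insert)
  have B: "compact B" "closed B" "path_image (\<gamma> e) \<inter> B \<subseteq> ends (\<gamma> e)"
    using compact_drawing[OF F'] edge_meets_drawing[OF F' eE F(2)] compact_imp_closed by (auto simp: B_def)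
  have fin: "finite (faces B)" "finite (faces Y)"
    using finite_faces[OF F'] finite_faces[OF F(1)] by (auto simp: B_def Y_def)
  have "\<forall>K\<in>faces B. \<exists>W\<in>faces Y. W \<subseteq> K" using ex_face_in_face[OF B(2) arc[OF eE]] Y by blast
  then obtain h where h: "\<And>K. K \<in> faces B \<Longrightarrow> h K \<in> faces Y \<and> h K \<subseteq> K" by metis
  have K_eq: "K = K'" if "K \<in> faces B" "K' \<in> faces B" "W \<in> faces Y" "W \<subseteq> K" "W \<subseteq> K'" for K K' W
  proof -
    have "W \<noteq> {}" using that in_components_nonempty by blast
    then have "K \<inter> K' \<noteq> {}" using that by blast
    then show ?thesis using that components_eq by blast
  qed
  have inj: "inj_on h (faces B)" using K_eq h by (metis inj_onI)
  have img: "card (h ` faces B) = card (faces B)" "h ` faces B \<subseteq> faces Y" using inj h by (auto simp: card_image)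
  show ?thesis
  proof (cases "(u, v) \<in> reach F")
    case False
    then show ?thesis using img card_mono[OF fin(2) img(2)] by (simp add: B_def Y_def)
  next
    case True
    obtain a b where ab: "e = {a, b}" "a \<noteq> b" "pathstart (\<gamma> e) = pos a" "pathfinish (\<gamma> e) = pos b"
      using edge_ends[OF eE] by metis
    have "(b, a) \<in> reach F" "a \<in> X" "b \<in> X"
      using True e ab reach_sym F(1) by (auto simp: doubleton_eq_iff subgraph_def)
    then obtain c where c: "arc c" "path_image c \<subseteq> B" "pathstart c = pos b" "pathfinish c = pos a"
      using reach_arc[OF F', of b a] ab(2) unfolding B_def by metis
    obtain y z where yz: "y \<notin> Y" "z \<notin> Y" "connected_component (- B) y z" "\<not> connected_component (- Y) y z"
      using faces_closing_arc(2)[OF B(1) arc[OF eE] B(3) c(1,2) _ _ Y] c ab by metis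
    define K where "K = connected_component_set (- B) y"
    define W1 where "W1 = connected_component_set (- Y) y"
    define W2 where "W2 = connected_component_set (- Y) z"
    have yzB: "y \<notin> B" "z \<notin> B" using yz Y by auto
    have K: "K \<in> faces B" using yzB by (auto simp: K_def componentsI)
    have Kz: "K = connected_component_set (- B) z" using yz(3) connected_component_eq unfolding K_def by fastforce
    have W: "W1 \<in> faces Y" "W2 \<in> faces Y" using yz by (auto simp: W1_def W2_def componentsI)
    have "- Y \<subseteq> - B" using Y by auto
    then have "W1 \<subseteq> connected_component_set (- B) y" "W2 \<subseteq> connected_component_set (- B) z"
      unfolding W1_def W2_def by (simp_all add: connected_component_mono)
    then have WK: "W1 \<subseteq> K" "W2 \<subseteq> K" using K_def Kz by simp_all
    have "z \<in> W2" using yz by (simp add: W2_def)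
    then have "W1 \<noteq> W2" using yz(4) by (auto simp: W1_def)
    have "\<exists>W\<in>faces Y. W \<notin> h ` faces B"
    proof (rule ccontr)
      assume "\<not> ?thesis"
      then have im: "W1 \<in> h ` faces B" "W2 \<in> h ` faces B" using W by simp_all
      obtain K1 where K1: "W1 = h K1" "K1 \<in> faces B" using im(1) by (rule imageE)
      obtain K2 where K2: "W2 = h K2" "K2 \<in> faces B" using im(2) by (rule imageE)
      have "K1 = K" using K_eq[OF K1(2) K W(1)] WK h[OF K1(2)] K1 by simp
      moreover have "K2 = K" using K_eq[OF K2(2) K W(2)] WK h[OF K2(2)] K2 by simp
      ultimately show False using K1 K2 \<open>W1 \<noteq> W2\<close> by simp
    qed
    then have "card (h ` faces B) < card (faces Y)" using img(2) fin(2) by (intro psubset_card_mono) auto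
    then show ?thesis using True img by (simp add: B_def Y_def)
  qed
qed

section \<open>Euler's inequality\<close>

definition classes :: "'v set set \<Rightarrow> 'v set \<Rightarrow> 'v set set" where
  "classes F X = (\<lambda>x. {y \<in> X. (x, y) \<in> reach F}) ` X"

text \<open>Joining two classes removes both, creates at most one new class and leaves the others
  unchanged.\<close>

lemma card_classes_insert:
  assumes F: "subgraph (insert e F) X" and e: "e = {u, v}"
  shows "card (classes (insert e F) X) + (if (u, v) \<in> reach F then 0 else 1) \<le> card (classes F X)"
proof -
  define cl where "cl F x = {y \<in> X. (x, y) \<in> reach F}" for F x
  have uvX: "u \<in> X" "v \<in> X" and finX: "finite X" using F e by (auto simp: subgraph_def)
  have fin: "finite (classes F X)" using finX by (simp add: classes_def)
  show ?thesis
  proof (cases "(u, v) \<in> reach F")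
    case True
    have "{(a, b). {a, b} \<in> insert e F} \<subseteq> reach F"
      using True reach_sym[OF True] reach_edge e by (auto simp: doubleton_eq_iff)
    then have "reach (insert e F) = reach F"
      unfolding reach_def by (intro rtrancl_subset) auto
    then show ?thesis using True by (simp add: classes_def)
  next
    case False
    have stay: "(x, y) \<in> reach F" if "(x, y) \<in> reach (insert e F)" "(u, x) \<notin> reach F" "(v, x) \<notin> reach F" for x y
      using that(1) unfolding reach_def
    proof (induction rule: rtrancl_induct)
      case (step y z)
      then have xy: "(x, y) \<in> reach F" by (simp add: reach_def)
      then have "y \<noteq> u" "y \<noteq> v" using that(2,3) reach_sym by blast+
      then have "{y, z} \<in> F" using step.hyps(2) e by (auto simp: doubleton_eq_iff)
      then show ?case using xy reach_edge reach_trans unfolding reach_def[symmetric] by blast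
    qed simp
    have up: "(x, y) \<in> reach (insert e F)" if "(x, y) \<in> reach F" for x y
      using reach_mono that by blast
    have uv': "(u, v) \<in> reach (insert e F)" using e by (intro reach_edge) auto
    have cl_eq: "cl (insert e F) x = cl (insert e F) u" if "(u, x) \<in> reach (insert e F)" for x
      using that reach_trans reach_sym unfolding cl_def by blast
    have "classes (insert e F) X \<subseteq> insert (cl (insert e F) u) (classes F X - {cl F u, cl F v})"
    proof
      fix C assume "C \<in> classes (insert e F) X"
      then obtain x where x: "x \<in> X" "C = cl (insert e F) x" by (auto simp: classes_def cl_def)
      show "C \<in> insert (cl (insert e F) u) (classes F X - {cl F u, cl F v})"
      proof (cases "(u, x) \<in> reach F \<or> (v, x) \<in> reach F")
        case True
        then have "(u, x) \<in> reach (insert e F)" using up uv' reach_trans by blast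
        then show ?thesis using cl_eq x by blast
      next
        case False
        then have "cl (insert e F) x = cl F x" using stay up unfolding cl_def by blast
        moreover have "x \<in> cl F x" "x \<notin> cl F u" "x \<notin> cl F v" using x False by (auto simp: cl_def reach_def)
        moreover have "cl F x \<in> classes F X" using x by (auto simp: classes_def cl_def)
        ultimately show ?thesis using x by auto
      qed
    qed
    then have "card (classes (insert e F) X) \<le> card (insert (cl (insert e F) u) (classes F X - {cl F u, cl F v}))"
      using fin by (intro card_mono) auto
    also have "\<dots> \<le> Suc (card (classes F X - {cl F u, cl F v}))" by (simp add: card_insert_le_m1 card_insert_if fin)
    also have "\<dots> < card (classes F X)"
    proof -
      have "v \<in> cl F v" "v \<notin> cl F u" using False uvX by (auto simp: cl_def reach_def)
      then have "cl F u \<noteq> cl F v" by auto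
      moreover have "{cl F u, cl F v} \<subseteq> classes F X" using uvX by (auto simp: classes_def cl_def)
      ultimately have "card (classes F X - {cl F u, cl F v}) = card (classes F X) - 2" "2 \<le> card (classes F X)"
        using fin card_mono[of "classes F X" "{cl F u, cl F v}"] by (auto simp: card_Diff_subset)
      then show ?thesis by linarith
    qed
    finally show ?thesis using False by simp
  qed
qed

text \<open>Each further edge creates a face or merges two classes. The number of classes is
  therefore carried through the induction and only at the end bounded below by one.\<close>

lemma euler_inequality:
  assumes "subgraph F X" "X \<noteq> {}"
  shows "card F + 2 \<le> card (faces (drawing F X)) + card X"
proof -
  have "finite F" using assms by (simp add: subgraph_def)
  then have "card F + card (classes F X) + 1 \<le> card (faces (drawing F X)) + card X"
    using assms(1)
  proof (induction F rule: finite_induct)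
    case empty
    have fX: "finite (pos ` X)" using empty by (simp add: subgraph_def)
    have "drawing {} X \<noteq> UNIV" using fX finite_subset[of UNIV "pos ` X"] infinite_UNIV_char_0 by (auto simp: drawing_def)
    then have "faces (drawing {} X) \<noteq> {}" by auto
    then have "1 \<le> card (faces (drawing {} X))" using finite_faces[OF empty]
      by (simp add: Suc_leI card_gt_0_iff)
    moreover have "card (classes {} X) \<le> card X" unfolding classes_def using empty
      by (intro card_image_le) (simp add: subgraph_def)
    ultimately show ?case by simp
  next
    case (insert e F)
    have F': "subgraph F X" using insert.prems subgraph_mono by blast
    obtain u v where uv: "e = {u, v}" using edge[of e] insert.prems by (auto simp: subgraph_def card_2_iff)
    show ?case
      using insert.IH[OF F'] card_faces_insert[OF insert.prems insert.hyps(2) uv]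
        card_classes_insert[OF insert.prems uv] insert.hyps
      by (auto split: if_splits)
  qed
  moreover have "card (classes F X) \<ge> 1"
    using assms by (simp add: classes_def Suc_leI card_gt_0_iff subgraph_def)
  ultimately show ?thesis by linarith
qed

section \<open>Edges along a face and the edge bounds\<close>

lemma forest_complement_connected:
  assumes F: "subgraph F X" and forest: "\<And>u v. {u, v} \<in> F \<Longrightarrow> (u, v) \<notin> reach (F - {{u, v}})"
  shows "connected (- drawing F X)"
proof -
  have "finite F" using F by (simp add: subgraph_def)
  have "F' \<subseteq> F \<Longrightarrow> connected (- drawing F' X)" if "finite F'" for F'
    using that
  proof (induction F' rule: finite_induct)
    case empty
    have "connected (- pos ` X)"
      using connected_open_delete_finite[of UNIV "pos ` X"] connected_UNIV F
      by (simp add: subgraph_def Compl_eq_Diff_UNIV)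
    then show ?case by (simp add: drawing_def)
  next
    case (insert e F')
    obtain u v where uv: "e = {u, v}" using edge[of e] insert.prems F by (auto simp: subgraph_def card_2_iff)
    have sub: "subgraph (insert e F') X" using F insert.prems subgraph_mono by blast
    \<comment> \<open>No edge of a forest lies on a cycle, so each one is a bridge over what has
      been drawn before.\<close>
    have "(u, v) \<notin> reach F'" using forest[of u v] reach_mono[of F' "F - {{u, v}}"] insert uv by blast
    then have "connected_component (- drawing (insert e F') X) y z"
      if "y \<in> - drawing (insert e F') X" "z \<in> - drawing (insert e F') X" for y z
    proof -
      have "connected (- drawing F' X)" using insert by blast
      then have "connected_component (- drawing F' X) y z"
        using that connected_componentI[of "- drawing F' X"] by (auto simp: drawing_insert)
      then show ?thesis using add_bridge[OF sub insert.hyps(2) uv \<open>(u, v) \<notin> reach F'\<close>] that by simp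
    qed
    then show ?case by (simp add: connected_iff_connected_component)
  qed
  then show ?thesis using \<open>finite F\<close> by blast
qed

text \<open>If the touched edges formed a forest, the complement of their drawing would be
  connected. As it avoids the frontier of \<open>W\<close>, it would lie in \<open>W\<close>, and
  \<open>W\<close> would be the only face. The cycle is expressed by an edge whose ends stay
  connected without it.\<close>

lemma face_edges_contain_cycle:
  assumes F: "subgraph F X" and W: "W \<in> faces (drawing F X)" and two: "card (faces (drawing F X)) \<ge> 2"
  obtains u v where "{u, v} \<in> F" "touches W (\<gamma> {u, v})"
    "(u, v) \<in> reach ({e \<in> F. touches W (\<gamma> e)} - {{u, v}})"
proof -
  define D where "D = {e \<in> F. touches W (\<gamma> e)}"
  have DF: "D \<subseteq> F" by (auto simp: D_def)
  then have sub: "subgraph D X" using F subgraph_mono by blast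
  have "\<not> connected (- drawing D X)"
  proof
    assume con: "connected (- drawing D X)"
    have cl: "closed (drawing F X)" using compact_drawing[OF F] compact_imp_closed by blast
    have fr: "frontier W \<subseteq> drawing F X" using frontier_of_components_closed_complement[OF cl W] .
    have frD: "frontier W \<subseteq> drawing D X"
    proof
      fix x assume x: "x \<in> frontier W"
      show "x \<in> drawing D X"
      proof (cases "x \<in> pos ` X")
        case False
        then obtain e where e: "e \<in> F" "x \<in> path_image (\<gamma> e)" using x fr by (auto simp: drawing_def)
        have "e \<in> \<E>" "e \<subseteq> X" using e F by (auto simp: subgraph_def)
        then have "x \<notin> ends (\<gamma> e)" unfolding ends[OF \<open>e \<in> \<E>\<close>] using False by blast
        then have "touches W (\<gamma> e)" using x e closure_Un_frontier[of W] by (auto simp: touches_def)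
        then show ?thesis using e by (auto simp: D_def drawing_def)
      qed (auto simp: drawing_def)
    qed
    have DX: "drawing D X \<subseteq> drawing F X" using DF by (auto simp: drawing_def)
    have WF: "W \<subseteq> - drawing F X" using in_components_subset[OF W] .
    have "- drawing D X \<subseteq> W"
    proof (rule ccontr)
      assume "\<not> ?thesis"
      moreover have "- drawing D X \<inter> W \<noteq> {}" using WF DX in_components_nonempty[OF W] by blast
      ultimately have "- drawing D X \<inter> frontier W \<noteq> {}" using connected_Int_frontier[OF con, of W] by blast
      then show False using frD by blast
    qed
    then have "- drawing F X \<subseteq> W" using DX by blast
    then have "faces (drawing F X) \<subseteq> {W}"
      using W WF in_components_connected[OF W] components_eq_sing_iff by (metis order_refl subset_antisym in_components_nonempty)
    then have "card (faces (drawing F X)) \<le> 1" using card_mono[of "{W}"] by auto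
    then show False using two by linarith
  qed
  then obtain u v where "{u, v} \<in> D" "(u, v) \<in> reach (D - {{u, v}})"
    using forest_complement_connected[OF sub] by blast
  then show ?thesis using that by (auto simp: D_def)
qed

lemma reach_ends:
  assumes "(u, v) \<in> reach D" "u \<noteq> v"
  shows "\<exists>x. {u, x} \<in> D" "\<exists>y. {y, v} \<in> D"
proof -
  have r: "(u, v) \<in> {(a, b). {a, b} \<in> D}\<^sup>*" using assms(1) by (simp add: reach_def)
  from r show "\<exists>x. {u, x} \<in> D" by (rule converse_rtranclE) (use assms(2) in auto)
  from r show "\<exists>y. {y, v} \<in> D" by (rule rtranclE) (use assms(2) in auto)
qed

text \<open>Double counting: an edge touches at most two faces.\<close>

lemma faces_edges_count:
  assumes F: "subgraph F X" and m: "\<And>W. W \<in> faces (drawing F X) \<Longrightarrow> m \<le> card {e \<in> F. touches W (\<gamma> e)}"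
  shows "m * card (faces (drawing F X)) \<le> 2 * card F"
proof -
  define P where "P = faces (drawing F X)"
  have fin: "finite P" "finite F" using finite_faces[OF F] F by (auto simp: P_def subgraph_def)
  have "m * card P = (\<Sum>W\<in>P. m)" by simp
  also have "\<dots> \<le> (\<Sum>W\<in>P. card {e \<in> F. touches W (\<gamma> e)})" by (intro sum_mono) (use m in \<open>auto simp: P_def\<close>)
  also have "\<dots> = (\<Sum>W\<in>P. \<Sum>e\<in>F. if touches W (\<gamma> e) then 1 else 0)"
    using fin by (intro sum.cong) (auto simp: sum.If_cases Int_def)
  also have "\<dots> = (\<Sum>e\<in>F. \<Sum>W\<in>P. if touches W (\<gamma> e) then 1 else 0)" by (rule sum.swap)
  also have "\<dots> = (\<Sum>e\<in>F. card {W \<in> P. touches W (\<gamma> e)})"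
    using fin by (intro sum.cong) (auto simp: sum.If_cases Int_def)
  also have "\<dots> \<le> (\<Sum>e\<in>F. 2)" by (intro sum_mono) (use faces_touching_edge[OF F] in \<open>auto simp: P_def\<close>)
  finally show ?thesis by (simp add: P_def)
qed

text \<open>Each face touches an edge on a cycle and a further edge at either end of it, hence at
  least three edges as the graph is simple. So
  \<open>3 * card (faces (drawing F X)) \<le> 2 * card F\<close>, to be combined with Euler's
  inequality.\<close>

theorem planar_edge_bound:
  assumes F: "subgraph F X" and X: "X \<noteq> {}"
  shows "card F < 3 * card X"
proof (cases "card (faces (drawing F X)) \<ge> 2")
  case False
  have "card X \<ge> 1" using X F by (simp add: Suc_leI card_gt_0_iff subgraph_def)
  then show ?thesis using euler_inequality[OF F X] False by linarith
next
  case True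
  have "3 \<le> card {e \<in> F. touches W (\<gamma> e)}" if W: "W \<in> faces (drawing F X)" for W
  proof -
    define D where "D = {e \<in> F. touches W (\<gamma> e)}"
    obtain u v where uv: "{u, v} \<in> D" "(u, v) \<in> reach (D - {{u, v}})"
      by (rule face_edges_contain_cycle[OF F W True]) (auto simp: D_def)
    have finD: "finite D" using F by (simp add: D_def subgraph_def)
    have "card {u, v} = 2" using uv edge[of "{u, v}"] F by (auto simp: D_def subgraph_def)
    then have "u \<noteq> v" by auto
    then obtain x y where xy: "{u, x} \<in> D - {{u, v}}" "{y, v} \<in> D - {{u, v}}" using reach_ends[OF uv(2)] by blast
    then have "{u, x} \<noteq> {y, v}" using \<open>u \<noteq> v\<close> by (auto simp: doubleton_eq_iff)
    moreover have "{u, v} \<noteq> {u, x}" "{u, v} \<noteq> {y, v}" using xy by auto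
    ultimately have "card {{u, v}, {u, x}, {y, v}} = 3" by simp
    moreover have "{{u, v}, {u, x}, {y, v}} \<subseteq> D" using uv xy by auto
    ultimately show ?thesis using card_mono[OF finD] by (metis D_def)
  qed
  then have "3 * card (faces (drawing F X)) \<le> 2 * card F" using faces_edges_count[OF F] by blast
  then show ?thesis using euler_inequality[OF F X] by linarith
qed

text \<open>Here each face touches at least four edges. If only \<open>{u, v}\<close>,
  \<open>{u, x}\<close> and \<open>{y, v}\<close> were available, then \<open>x\<close> and
  \<open>y\<close> would lie on different sides of the bipartition, and a walk from \<open>u\<close>
  avoiding \<open>{u, v}\<close> would get no further than \<open>x\<close>.\<close>

theorem planar_bipartite_edge_bound:
  assumes F: "subgraph F X" and bip: "\<And>e. e \<in> F \<Longrightarrow> \<exists>s t. e = {s, t} \<and> s \<in> S \<and> t \<notin> S"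
  shows "card F \<le> 2 * card X"
proof (cases "X = {}")
  case True
  then have "F = {}" using F edge by (fastforce simp: subgraph_def)
  then show ?thesis by simp
next
  case X: False
  show ?thesis
  proof (cases "card (faces (drawing F X)) \<ge> 2")
    case False
    then show ?thesis using euler_inequality[OF F X] by linarith
  next
    case True
    have "4 \<le> card {e \<in> F. touches W (\<gamma> e)}" if W: "W \<in> faces (drawing F X)" for W
    proof (rule ccontr)
      define D where "D = {e \<in> F. touches W (\<gamma> e)}"
      assume "\<not> 4 \<le> card {e \<in> F. touches W (\<gamma> e)}"
      then have small: "card D \<le> 3" by (simp add: D_def)
      obtain u0 v0 where uv0: "{u0, v0} \<in> D" "(u0, v0) \<in> reach (D - {{u0, v0}})"
        by (rule face_edges_contain_cycle[OF F W True]) (auto simp: D_def)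
      have finD: "finite D" using F by (simp add: D_def subgraph_def)
      have DF: "D \<subseteq> F" by (auto simp: D_def)
      obtain u v where uv: "{u, v} \<in> D" "(u, v) \<in> reach (D - {{u, v}})" "u \<in> S" "v \<notin> S"
      proof -
        obtain s t where "{u0, v0} = {s, t}" "s \<in> S" "t \<notin> S" using bip uv0 DF by blast
        then show ?thesis using that[of u0 v0] that[of v0 u0] uv0 reach_sym[OF uv0(2)]
          by (auto simp: doubleton_eq_iff insert_commute)
      qed
      have "u \<noteq> v" using uv by auto
      then obtain x y where xy: "{u, x} \<in> D - {{u, v}}" "{y, v} \<in> D - {{u, v}}" using reach_ends[OF uv(2)] by blast
      have xS: "x \<notin> S" using bip[of "{u, x}"] xy DF uv by (auto simp: doubleton_eq_iff)
      have yS: "y \<in> S" using bip[of "{y, v}"] xy DF uv by (auto simp: doubleton_eq_iff)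
      have ne: "x \<noteq> v" "y \<noteq> u" using xy by auto
      have three: "card {{u, v}, {u, x}, {y, v}} = 3"
      proof -
        have "{u, v} \<noteq> {u, x}" "{u, v} \<noteq> {y, v}" "{u, x} \<noteq> {y, v}"
          using \<open>u \<noteq> v\<close> ne by (auto simp: doubleton_eq_iff)
        then show ?thesis by simp
      qed
      moreover have sub3: "{{u, v}, {u, x}, {y, v}} \<subseteq> D" using uv xy by auto
      ultimately have D: "D = {{u, v}, {u, x}, {y, v}}" using card_seteq[OF finD sub3] small by auto
      have "z \<in> {u, x}" if "(u, z) \<in> reach (D - {{u, v}})" for z
        using that unfolding reach_def
      proof (induction rule: rtrancl_induct)
        case (step a b)
        have "{a, b} = {u, x} \<or> {a, b} = {y, v}" using step.hyps(2) D by auto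
        then show ?case using step.IH ne uv xS yS by (auto simp: doubleton_eq_iff)
      qed simp
      then show False using uv ne \<open>u \<noteq> v\<close> by blast
    qed
    then have "4 * card (faces (drawing F X)) \<le> 2 * card F" using faces_edges_count[OF F] by blast
    then show ?thesis using euler_inequality[OF F X] by linarith
  qed
qed

end

section \<open>From pairs of colourings to Kempe swaps\<close>

text \<open>Along an edge whose ends have the colours \<open>\<alpha>\<close> and
  \<open>\<beta>\<close>, both ends change or neither does. So the Kempe component of a vertex where
  the colourings differ consists of such vertices, and swapping it produces exactly the colours of
  \<open>\<psi>\<close> there, which respect the lists.\<close>

lemma flips_valid_swaps:
  fixes J :: "'a graph" and L :: "'a \<Rightarrow> 'c set"
  assumes fin: "finite (verts J)" and inc: "\<And>e. e \<in> edges J \<Longrightarrow> e \<subseteq> verts J"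
    and \<phi>: "\<phi> \<in> L_colorings J L" and \<psi>: "\<psi> \<in> L_colorings J L"
    and fl: "\<And>v. v \<in> verts J \<Longrightarrow> flip \<alpha> \<beta> (\<phi> v) (\<psi> v)"
  shows "(\<phi>, \<psi>) \<in> (valid_swap_rel J L)\<^sup>*"
  using \<phi> fl
proof (induction "card {v \<in> verts J. \<phi> v \<noteq> \<psi> v}" arbitrary: \<phi> rule: less_induct)
  case less
  show ?case
  proof (cases "\<forall>v\<in>verts J. \<phi> v = \<psi> v")
    case True
    then have "\<phi> = \<psi>" using less.prems(1) \<psi> by (auto simp: L_colorings_def intro: PiE_ext)
    then show ?thesis by simp
  next
    case False
    then obtain v0 where v0: "v0 \<in> verts J" "\<phi> v0 \<noteq> \<psi> v0" by auto
    have ab: "\<alpha> \<noteq> \<beta>" using less.prems(2)[OF v0(1)] v0(2) by (auto simp: flip_def)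
    have proper: "\<phi> u \<noteq> \<phi> v" "\<psi> u \<noteq> \<psi> v" if "(u, v) \<in> adj J" for u v
      using that less.prems(1) \<psi> by (auto simp: L_colorings_def)
    define M where "M = {v \<in> verts J. \<phi> v = \<alpha> \<or> \<phi> v = \<beta>}"
    define K where "K = induced_subgraph J M"
    define C where "C = (adj K)\<^sup>* `` {v0}"
    have adjK: "(x, y) \<in> adj K \<longleftrightarrow> (x, y) \<in> adj J \<and> x \<in> M \<and> y \<in> M" for x y
      by (auto simp: adj_def K_def induced_subgraph_def)
    have v0M: "v0 \<in> M" using less.prems(2)[OF v0(1)] v0 by (auto simp: flip_def M_def)
    have CM: "x \<in> M \<and> \<phi> x \<noteq> \<psi> x" if "x \<in> C" for x
    proof -
      have "(v0, x) \<in> (adj K)\<^sup>*" using that by (simp add: C_def)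
      then show ?thesis
      proof (induction rule: rtrancl_induct)
        case base
        then show ?case using v0 v0M by simp
      next
        case (step x y)
        then have xy: "(x, y) \<in> adj J" "x \<in> M" "y \<in> M" by (auto simp: adjK)
        have "flip \<alpha> \<beta> (\<phi> x) (\<psi> x)" "flip \<alpha> \<beta> (\<phi> y) (\<psi> y)" using xy less.prems(2) by (auto simp: M_def)
        then show ?case using step.IH proper[OF xy(1)] xy by (auto simp: flip_def M_def)
      qed
    qed
    have CV: "C \<subseteq> verts J" using CM by (auto simp: M_def)
    define \<phi>1 where "\<phi>1 = swap_on \<alpha> \<beta> C \<phi>"
    have \<phi>1: "\<phi>1 v = (if v \<in> C then \<psi> v else \<phi> v)" for v
    proof (cases "v \<in> C")
      case True
      then have "flip \<alpha> \<beta> (\<phi> v) (\<psi> v)" "\<phi> v \<noteq> \<psi> v" using CM[OF True] less.prems(2) CV by auto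
      then show ?thesis using True by (auto simp: \<phi>1_def swap_on_def flip_def)
    qed (simp add: \<phi>1_def swap_on_def)
    have leave: "\<phi> v \<notin> {\<alpha>, \<beta>} \<and> \<psi> u \<in> {\<alpha>, \<beta>}" if "(u, v) \<in> adj J" "u \<in> C" "v \<notin> C" for u v
    proof -
      have "v \<in> verts J" using that(1) inc by (auto simp: adj_def)
      moreover have "v \<notin> M"
      proof
        assume "v \<in> M"
        then have "(u, v) \<in> adj K" using that CM by (simp add: adjK)
        then have "v \<in> C" using that(2) unfolding C_def by (auto intro: rtrancl_into_rtrancl)
        then show False using that by simp
      qed
      ultimately show ?thesis using CM[OF that(2)] less.prems(2)[of u] that CV by (auto simp: M_def flip_def)
    qed
    have swap_adj: "(v, u) \<in> adj J" if "(u, v) \<in> adj J" for u v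
      using that by (simp add: adj_def insert_commute)
    have col1: "\<phi>1 \<in> L_colorings J L"
      unfolding L_colorings_def
    proof (intro CollectI conjI)
      show "\<phi>1 \<in> Pi\<^sub>E (verts J) L"
        using less.prems(1) \<psi> CV by (auto simp: L_colorings_def \<phi>1 PiE_def extensional_def)
      have "\<phi>1 u \<noteq> \<phi>1 v" if "(u, v) \<in> adj J" for u v
        using proper[OF that] leave[OF that] leave[OF swap_adj[OF that]] by (auto simp: \<phi>1)
      then show "\<forall>(u, v)\<in>adj J. \<phi>1 u \<noteq> \<phi>1 v" by auto
    qed
    have "C \<in> conn_components K"
      unfolding conn_components_def C_def using v0M by (auto simp: K_def induced_subgraph_def M_def intro: quotientI)
    then have "kempe_swap J \<phi> \<phi>1"
      unfolding kempe_swap_def using ab by (auto simp: \<phi>1_def K_def M_def)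
    then have "(\<phi>, \<phi>1) \<in> valid_swap_rel J L" using less.prems(1) col1 by (simp add: valid_swap_rel_def)
    moreover have "(\<phi>1, \<psi>) \<in> (valid_swap_rel J L)\<^sup>*"
    proof (rule less.hyps)
      have "v0 \<in> C" by (simp add: C_def)
      then have "{v \<in> verts J. \<phi>1 v \<noteq> \<psi> v} \<subset> {v \<in> verts J. \<phi> v \<noteq> \<psi> v}" using v0 by (auto simp: \<phi>1)
      then show "card {v \<in> verts J. \<phi>1 v \<noteq> \<psi> v} < card {v \<in> verts J. \<phi> v \<noteq> \<psi> v}"
        using fin by (intro psubset_card_mono) auto
      show "flip \<alpha> \<beta> (\<phi>1 v) (\<psi> v)" if "v \<in> verts J" for v using less.prems(2)[OF that] by (simp add: \<phi>1)
    qed (rule col1)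
    ultimately show ?thesis by (rule converse_rtrancl_into_rtrancl)
  qed
qed

lemma adj_line_graph: "(e, f) \<in> adj (line_graph G) \<longleftrightarrow> e \<in> edges G \<and> f \<in> edges G \<and> line_adj e f"
  unfolding adj_def line_graph_def line_adj_def by (auto simp: doubleton_eq_iff)

lemma L_swappable_line_graph:
  fixes G :: "'v graph"
  assumes fin: "finite (edges G)" and sw: "line.swappable (edges G) L"
  shows "L_swappable (line_graph G) L"
proof -
  let ?J = "line_graph G"
  let ?E = "edges G"
  have vJ: "verts ?J = ?E" by (simp add: line_graph_def)
  have col: "\<phi> \<in> L_colorings ?J L \<longleftrightarrow> \<phi> \<in> extensional ?E \<and> line.col ?E L \<phi>" for \<phi>
    unfolding L_colorings_def line.col_def PiE_def vJ by (auto simp: adj_line_graph)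
  have colr: "restrict \<theta> ?E \<in> L_colorings ?J L" if "line.col ?E L \<theta>" for \<theta>
    using that line.col_cong[of ?E "restrict \<theta> ?E" \<theta> L] by (simp add: col)
  have steps: "(restrict \<theta> ?E, restrict \<theta>' ?E) \<in> (valid_swap_rel ?J L)\<^sup>*" if "(\<theta>, \<theta>') \<in> line.eqv ?E L" for \<theta> \<theta>'
    using that unfolding line.eqv_def
  proof (induction rule: rtrancl_induct)
    case (step \<theta>1 \<theta>2)
    then obtain \<alpha> \<beta> where s: "line.col ?E L \<theta>1" "line.col ?E L \<theta>2" "line.flips \<alpha> \<beta> ?E \<theta>1 \<theta>2"
      by (auto simp: line.step_def)
    have "(restrict \<theta>1 ?E, restrict \<theta>2 ?E) \<in> (valid_swap_rel ?J L)\<^sup>*"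
    proof (rule flips_valid_swaps)
      show "e \<subseteq> verts ?J" if "e \<in> edges ?J" for e using that by (auto simp: line_graph_def)
      show "flip \<alpha> \<beta> (restrict \<theta>1 ?E v) (restrict \<theta>2 ?E v)" if "v \<in> verts ?J" for v
        using that s(3) by (simp add: vJ line.flips_def)
    qed (use fin colr s in \<open>auto simp: vJ\<close>)
    then show ?case using step.IH by (rule rtrancl_trans[rotated])
  qed simp
  show ?thesis
    unfolding L_swappable_def
  proof (intro ballI)
    fix \<phi> \<psi> assume "\<phi> \<in> L_colorings ?J L" "\<psi> \<in> L_colorings ?J L"
    then have "(\<phi>, \<psi>) \<in> line.eqv ?E L" "restrict \<phi> ?E = \<phi>" "restrict \<psi> ?E = \<psi>"
      using sw by (auto simp: col line.swappable_def extensional_restrict)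
    then show "(\<phi>, \<psi>) \<in> (valid_swap_rel ?J L)\<^sup>*" using steps by fastforce
  qed
qed

section \<open>Discharging\<close>

lemma handshake:
  assumes "finite F" "finite A" "\<And>e. e \<in> F \<Longrightarrow> card (e \<inter> A) = c"
  shows "(\<Sum>x\<in>A. card {e \<in> F. x \<in> e}) = c * card F"
proof -
  have "(\<Sum>x\<in>A. card {e \<in> F. x \<in> e}) = (\<Sum>x\<in>A. \<Sum>e\<in>F. if x \<in> e then 1 else 0)"
    using assms by (intro sum.cong) (auto simp: sum.If_cases Int_def)
  also have "\<dots> = (\<Sum>e\<in>F. \<Sum>x\<in>A. if x \<in> e then 1 else 0)" by (rule sum.swap)
  also have "\<dots> = (\<Sum>e\<in>F. card (e \<inter> A))"
    using assms by (intro sum.cong) (auto simp: sum.If_cases Int_def conj_commute)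
  also have "\<dots> = c * card F" using assms(3) by simp
  finally show ?thesis .
qed

text \<open>\<open>e\<close> itself is counted at both of its ends but is not its own
  neighbour.\<close>

lemma card_line_nb:
  assumes "finite F" "e \<in> F" "e = {x, y}"
  shows "card (line.nb e F) + 2 \<le> card {f \<in> F. x \<in> f} + card {f \<in> F. y \<in> f}"
proof -
  let ?X = "{f \<in> F. x \<in> f}" and ?Y = "{f \<in> F. y \<in> f}"
  have "line.nb e F \<subseteq> (?X - {e}) \<union> (?Y - {e})"
    using assms(3) by (auto simp: line.nb_def line_adj_def)
  then have "card (line.nb e F) \<le> card ((?X - {e}) \<union> (?Y - {e}))" using assms(1) by (intro card_mono) auto
  also have "\<dots> \<le> card (?X - {e}) + card (?Y - {e})" by (rule card_Un_le)
  finally have "card (line.nb e F) \<le> card (?X - {e}) + card (?Y - {e})" .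
  moreover have "card ?X = Suc (card (?X - {e}))" "card ?Y = Suc (card (?Y - {e}))"
    using assms card_Suc_Diff1[of ?X e] card_Suc_Diff1[of ?Y e] by simp_all
  ultimately show ?thesis by linarith
qed

context plane_graph
begin

text \<open>The planar edge bound for the graph without the vertices of degree two limits the sum of
  \<open>d x - 6\<close> over the remaining vertices, where \<open>d\<close> refers to the whole graph. The vertices of degree
  at most five only have neighbours of degree at least twelve, and the bipartite edge bound shows
  that six units from each of the latter pay for the former.\<close>

lemma many_two_vertices:
  assumes F: "finite F" "F \<subseteq> \<E>" "F \<noteq> {}"
    and d_def: "\<And>x. d x = card {e \<in> F. x \<in> e}"
    and k: "k \<ge> 15" "\<And>x. d x \<le> k"
    and heavy: "\<And>x y. {x, y} \<in> F \<Longrightarrow> d x + d y \<ge> k + 2"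
    and D: "D = {x \<in> \<Union> F. d x = 2}"
    and N: "N = (\<lambda>v. {w. {v, w} \<in> F})"
  shows "\<And>v. v \<in> D \<Longrightarrow> card (N v) = 2" "finite D" "D \<inter> \<Union> (N ` D) = {}"
    "3 * card (\<Union> (N ` D)) < 2 * card D"
proof -
  define X where "X = \<Union> F"
  have two: "card e = 2" "e \<subseteq> V" if "e \<in> F" for e using that F(2) edge by auto
  have fine: "finite e" if "e \<in> F" for e using two[OF that] by (metis card.infinite zero_neq_numeral)
  have finX: "finite X" using F fine by (auto simp: X_def)
  then show finD: "finite D" unfolding D X_def by (rule rev_finite_subset) auto
  have XV: "X \<subseteq> V" using two by (auto simp: X_def)
  have mem: "\<exists>y. e = {x, y} \<and> x \<noteq> y" if "e \<in> F" "x \<in> e" for e x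
    using two(1)[OF that(1)] that(2) by (auto simp: card_2_iff)
  have dNv: "card (N v) = d v" for v
  proof -
    have "bij_betw (\<lambda>w. {v, w}) (N v) {e \<in> F. v \<in> e}"
      unfolding bij_betw_def
    proof
      show "inj_on (\<lambda>w. {v, w}) (N v)" by (auto simp: inj_on_def doubleton_eq_iff)
      show "(\<lambda>w. {v, w}) ` N v = {e \<in> F. v \<in> e}" using mem unfolding N by (auto simp: image_iff)
    qed
    then show ?thesis by (simp add: d_def bij_betw_same_card)
  qed
  show "card (N v) = 2" if "v \<in> D" for v using that dNv by (simp add: D)
  define W where "W = \<Union> (N ` D)"
  have Wk: "d w = k" "w \<in> X" if "w \<in> W" for w
  proof -
    obtain v where v: "{v, w} \<in> F" "d v = 2" using \<open>w \<in> W\<close> unfolding W_def N D by blast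
    then show "d w = k" using heavy[OF v(1)] k(2)[of w] by linarith
    show "w \<in> X" using v by (auto simp: X_def)
  qed
  have DW: "D \<inter> W = {}" using Wk k(1) by (fastforce simp: D)
  then show "D \<inter> \<Union> (N ` D) = {}" by (simp add: W_def)
  have d2: "d x \<ge> 2" if x: "x \<in> X" for x
  proof -
    obtain e where "e \<in> F" "x \<in> e" using x by (auto simp: X_def)
    then obtain y where "{x, y} \<in> F" using mem by metis
    then show ?thesis using heavy[of x y] k(2)[of y] by linarith
  qed
  define X' where "X' = X - D"
  define F' where "F' = {e \<in> F. e \<inter> D = {}}"
  \<comment> \<open>An edge at a vertex of degree at most 5 has its other end of degree at least
    \<open>k + 2 - 5 \<ge> 12\<close>, so \<open>S\<close> has neighbours only in
    \<open>B\<close>.\<close>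
  define S where "S = {x \<in> X. 3 \<le> d x \<and> d x \<le> 5}"
  define B where "B = {x \<in> X. 12 \<le> d x}"
  have fins: "finite X'" "finite S" "finite B" "finite F'" "finite W"
    using finX F(1) Wk(2) finite_subset[of W X] by (auto simp: X'_def S_def B_def F'_def)
  \<comment> \<open>Vertices of degree at most 5 are pairwise non-adjacent, because adjacent degrees
    add up to at least 17.\<close>
  have inter_one: "card (e \<inter> A) = 1" if e: "e \<in> F" "e \<inter> A \<noteq> {}" and A: "\<And>x. x \<in> A \<Longrightarrow> d x \<le> 5" for e A
  proof -
    obtain x where x: "x \<in> e" "x \<in> A" using e(2) by auto
    then obtain y where y: "e = {x, y}" "x \<noteq> y" using mem[OF e(1)] by blast
    have "y \<notin> A" using heavy[of x y] e(1) y A[OF x(2)] A[of y] k(1) by fastforce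
    then have "e \<inter> A = {x}" using y x by auto
    then show ?thesis by simp
  qed
  have cover: "(\<Sum>x\<in>A. d x) = card {e \<in> F. e \<inter> A \<noteq> {}}" if "finite A" "\<And>x. x \<in> A \<Longrightarrow> d x \<le> 5" for A
  proof -
    have "(\<Sum>x\<in>A. d x) = (\<Sum>x\<in>A. card {e \<in> {e \<in> F. e \<inter> A \<noteq> {}}. x \<in> e})"
      unfolding d_def by (intro sum.cong arg_cong[of _ _ card]) auto
    also have "\<dots> = 1 * card {e \<in> F. e \<inter> A \<noteq> {}}"
      using F(1) that inter_one by (intro handshake) auto
    finally show ?thesis by simp
  qed
  have hs: "(\<Sum>x\<in>X. d x) = 2 * card F"
    unfolding d_def
  proof (rule handshake)
    fix e assume e: "e \<in> F"
    then have "e \<inter> X = e" by (auto simp: X_def)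
    then show "card (e \<inter> X) = 2" using two[OF e] by simp
  qed (use F finX in auto)
  have dD: "(\<Sum>x\<in>D. d x) = 2 * card D" by (simp add: D)
  have "card F = card F' + card {e \<in> F. e \<inter> D \<noteq> {}}"
  proof -
    have "F = F' \<union> {e \<in> F. e \<inter> D \<noteq> {}}" "F' \<inter> {e \<in> F. e \<inter> D \<noteq> {}} = {}" by (auto simp: F'_def)
    then show ?thesis using F(1) by (metis card_Un_disjoint finite_Un)
  qed
  then have cF: "card F = card F' + 2 * card D" using cover[OF finD] dD by (auto simp: D)
  have "X = X' \<union> D" "X' \<inter> D = {}" by (auto simp: X'_def D X_def)
  then have "(\<Sum>x\<in>X. d x) = (\<Sum>x\<in>X'. d x) + (\<Sum>x\<in>D. d x)"
    using fins finD by (simp add: sum.union_disjoint)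
  \<comment> \<open>Each of the \<open>2 * card D\<close> edges at \<open>D\<close> has exactly one
    end in \<open>X'\<close>.\<close>
  then have sumX': "(\<Sum>x\<in>X'. d x) = 2 * card F' + 2 * card D" using hs cF dD by linarith
  have "X' \<noteq> {}"
  proof -
    obtain e where e: "e \<in> F" using F(3) by auto
    then obtain x where "x \<in> e" using two[OF e] by fastforce
    then obtain y where y: "e = {x, y}" using mem[OF e] by blast
    then have "d x \<noteq> 2 \<or> d y \<noteq> 2" using heavy[of x y] e k(1) by auto
    then show ?thesis using y e by (auto simp: X'_def X_def D)
  qed
  moreover have "subgraph F' X'"
    using F XV fins by (auto simp: subgraph_def F'_def X'_def X_def)
  ultimately have "card F' < 3 * card X'" using planar_edge_bound by blast
  then have up: "(\<Sum>x\<in>X'. d x) < 6 * card X' + 2 * card D" using sumX' by linarith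
  \<comment> \<open>The edges at \<open>S\<close> form a bipartite plane graph on
    \<open>S \<union> B\<close>.\<close>
  have low: "(\<Sum>x\<in>S. d x) \<le> 2 * card S + 2 * card B"
  proof -
    define F'' where "F'' = {e \<in> F. e \<inter> S \<noteq> {}}"
    have nbS: "\<exists>t. e = {s, t} \<and> t \<in> B" if e: "e \<in> F" "s \<in> e" "s \<in> S" for e s
    proof -
      obtain t where t: "e = {s, t}" using mem e by blast
      then have "d s + d t \<ge> k + 2" "t \<in> X" using heavy[of s t] e by (auto simp: X_def)
      then have "t \<in> B" using e(3) k(1) by (auto simp: S_def B_def)
      then show ?thesis using t by blast
    qed
    have SB: "S \<inter> B = {}" by (auto simp: S_def B_def)
    have "subgraph F'' (S \<union> B)"
      unfolding subgraph_def
    proof (intro conjI)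
      show "\<Union> F'' \<subseteq> S \<union> B"
      proof
        fix z assume "z \<in> \<Union> F''"
        then obtain e s where e: "e \<in> F" "s \<in> e" "s \<in> S" "z \<in> e" by (auto simp: F''_def)
        then show "z \<in> S \<union> B" using nbS[OF e(1-3)] by auto
      qed
    qed (use F fins XV in \<open>auto simp: F''_def S_def B_def\<close>)
    moreover have "\<exists>s t. e = {s, t} \<and> s \<in> S \<and> t \<notin> S" if e: "e \<in> F''" for e
    proof -
      obtain s where s: "e \<in> F" "s \<in> e" "s \<in> S" using e by (auto simp: F''_def)
      then show ?thesis using nbS[OF s] SB by blast
    qed
    ultimately have "card F'' \<le> 2 * card (S \<union> B)" using planar_bipartite_edge_bound by blast
    moreover have "card (S \<union> B) = card S + card B" using fins SB by (simp add: card_Un_disjoint)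
    moreover have "(\<Sum>x\<in>S. d x) = card F''" using cover[OF fins(2)] by (auto simp: S_def F''_def)
    ultimately show ?thesis by simp
  qed
  have sub: "S \<subseteq> X'" "B \<subseteq> X'" "W \<subseteq> X'"
    using Wk DW by (auto simp: S_def B_def X'_def D)
  \<comment> \<open>In \<open>W\<close> the degree is \<open>k \<ge> 15\<close>, which leaves at
    least 9 = 3 + 6 units; elsewhere in \<open>B\<close> it is at least 12, which leaves 6. On
    \<open>S\<close> the claim amounts to \<open>4 * d x \<ge> 12\<close>.\<close>
  have point: "int (d x) - 6 \<ge> (if x \<in> W then 3 else 0) + (if x \<in> B then 6 else 0) - (if x \<in> S then 3 * (int (d x) - 2) else 0)"
    if x: "x \<in> X'" for x
  proof -
    have xX: "x \<in> X" "d x \<noteq> 2" using x by (auto simp: X'_def D X_def)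
    then have d3: "d x \<ge> 3" using d2[of x] by linarith
    show ?thesis using xX d3 Wk[of x] k(1) by (auto simp: S_def B_def)
  qed
  define dS where "dS = (\<Sum>x\<in>S. d x)"
  define dX where "dX = (\<Sum>x\<in>X'. d x)"
  have "(\<Sum>x\<in>X'. int (d x) - 6) \<ge> (\<Sum>x\<in>X'. (if x \<in> W then 3 else 0) + (if x \<in> B then 6 else 0) - (if x \<in> S then 3 * (int (d x) - 2) else 0))"
    by (intro sum_mono point)
  also have "(\<Sum>x\<in>X'. (if x \<in> W then 3 else 0) + (if x \<in> B then 6 else 0) - (if x \<in> S then 3 * (int (d x) - 2) else 0))
      = 3 * int (card W) + 6 * int (card B) - (\<Sum>x\<in>S. 3 * (int (d x) - 2))"
    using sub fins by (simp add: sum.distrib sum_subtractf sum.inter_restrict[symmetric] Int_absorb1)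
  finally have "3 * int (card W) + 6 * int (card B) - (\<Sum>x\<in>S. 3 * (int (d x) - 2)) \<le> (\<Sum>x\<in>X'. int (d x) - 6)" .
  moreover have "(\<Sum>x\<in>S. 3 * (int (d x) - 2)) = 3 * (int dS - 2 * int (card S))"
    unfolding dS_def by (simp add: sum_distrib_left[symmetric] sum_subtractf)
  moreover have "(\<Sum>x\<in>X'. int (d x) - 6) = int dX - 6 * int (card X')"
    unfolding dX_def by (simp add: sum_subtractf)
  ultimately have "3 * int (card W) + 6 * int (card B) - 3 * (int dS - 2 * int (card S)) \<le> int dX - 6 * int (card X')"
    by (simp only:)
  moreover have "dX < 6 * card X' + 2 * card D" "dS \<le> 2 * card S + 2 * card B"
    using up low by (simp_all only: dX_def dS_def)
  then have "int dX < 6 * int (card X') + 2 * int (card D)" "int dS \<le> 2 * int (card S) + 2 * int (card B)"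
    by linarith+
  \<comment> \<open>By \<open>low\<close>, the six units from each vertex of \<open>B\<close> cover
    the whole deficit of \<open>S\<close>.\<close>
  ultimately have "3 * int (card W) < 2 * int (card D)" by (simp add: algebra_simps)
  then have "3 * card W < 2 * card D" by linarith
  then show "3 * card (\<Union> (N ` D)) < 2 * card D" by (simp add: W_def)
qed

text \<open>Passing to a subset of the edges preserves the degree bound and the lists. The induction
  runs over all proper subsets, because a reducible set is removed as a whole.\<close>

lemma swappable_edges:
  assumes F: "finite F" "F \<subseteq> \<E>" and k: "k \<ge> 15" "\<And>x. card {e \<in> \<E>. x \<in> e} \<le> k" and finE: "finite \<E>"
    and L: "\<And>e. e \<in> \<E> \<Longrightarrow> finite (L e) \<and> card (L e) = k"
  shows "line.swappable F L"
  using F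
proof (induction F rule: finite_psubset_induct)
  case (psubset F)
  have fin: "finite F" and FE: "F \<subseteq> \<E>" using psubset by auto
  define d where "d x = card {e \<in> F. x \<in> e}" for x
  have dk: "d x \<le> k" for x
  proof -
    have "d x \<le> card {e \<in> \<E>. x \<in> e}" unfolding d_def using finE FE by (intro card_mono) auto
    then show ?thesis using k(2)[of x] by linarith
  qed
  consider "F = {}" | x y where "{x, y} \<in> F" "d x + d y \<le> k + 1" | "F \<noteq> {}" "\<And>x y. {x, y} \<in> F \<Longrightarrow> d x + d y \<ge> k + 2"
    by fastforce
  then show ?case
  proof cases
    case 1
    then show ?thesis using line.swappable_empty by simp
  next
    case (2 x y)
    let ?e = "{x, y}"
    have "line.nb ?e (F - {?e}) \<subseteq> line.nb ?e F" by (rule line.nb_mono) auto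
    then have "card (line.nb ?e (F - {?e})) \<le> card (line.nb ?e F)" using fin by (intro card_mono) auto
    moreover have "card (line.nb ?e F) + 2 \<le> d x + d y"
      unfolding d_def by (rule card_line_nb) (use fin 2 in auto)
    ultimately have lt: "card (line.nb ?e (F - {?e})) < card (L ?e)" using 2 L[of ?e] FE by auto
    have "line.swappable (insert ?e (F - {?e})) L"
      by (rule line.swappable_insert) (use fin L[of ?e] FE 2 lt psubset.IH[of "F - {?e}"] in auto)
    then show ?thesis using 2 by (simp add: insert_absorb)
  next
    case 3
    define D where "D = {x \<in> \<Union> F. d x = 2}"
    define N where "N = (\<lambda>v. {w. {v, w} \<in> F})"
    have two: "\<And>v. v \<in> D \<Longrightarrow> card (N v) = 2" "finite D" "D \<inter> \<Union> (N ` D) = {}" "3 * card (\<Union> (N ` D)) < 2 * card D"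
      using many_two_vertices[OF fin FE 3(1) d_def k(1) dk 3(2) D_def N_def] by auto
    obtain H b where H: "line.reducible H b" "H \<subseteq> halves N D"
      using ex_reducible_halves[of D N] two by blast
    have half: "\<exists>v w. h = {v, w} \<and> h \<in> F \<and> d v = 2" if "h \<in> H" for h
    proof -
      have "h \<in> halves N D" using that H(2) by (rule subsetD[rotated])
      then obtain v w where "h = {v, w}" "v \<in> D" "w \<in> N v" by (auto simp: halves_def)
      then show ?thesis by (intro exI[of _ v] exI[of _ w]) (simp add: N_def D_def)
    qed
    have HF: "H \<subseteq> F" using half by blast
    have "b \<in> H" using H(1) by (simp add: line.reducible_def)
    show ?thesis
    proof (rule line.swappable_if_reducible[OF H(1) fin HF])
      \<comment> \<open>One end of \<open>h\<close> has degree two and the other at most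
        \<open>k\<close>, so \<open>h\<close> meets at most \<open>k\<close> other edges.\<close>
      fix h assume "h \<in> H"
      then obtain v w where vw: "h = {v, w}" "h \<in> F" "d v = 2" using half by blast
      have "card (line.nb h F) + 2 \<le> d v + d w" unfolding d_def by (rule card_line_nb[OF fin vw(2,1)])
      then have "card (line.nb h F) \<le> k" using vw(3) dk[of w] by linarith
      then show "finite (L h) \<and> card (line.nb h F) \<le> card (L h)" using L[of h] vw(2) FE by auto
    next
      show "line.swappable (F - H) L" using psubset.IH[of "F - H"] \<open>b \<in> H\<close> HF FE by blast
    qed
  qed
qed

end

theorem theorem5:
  fixes G :: "'v graph"
    and pos :: "'v \<Rightarrow> complex"
    and \<gamma> :: "'v set \<Rightarrow> real \<Rightarrow> complex"
    and J :: "'v set graph"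
    and L :: "'v set \<Rightarrow> 'c set"
    and k :: nat
  assumes "simple_plane_graph G pos \<gamma>"
    and "J = line_graph G"
    and "k = max 15 (max_degree G)"
    and "k_assignment k J L"
  shows "L_swappable J L"
proof -
  have simple: "finite (verts G)" "\<And>e. e \<in> edges G \<Longrightarrow> e \<subseteq> verts G \<and> card e = 2"
    and embed: "planar_embedding G pos \<gamma>"
    using assms(1) by (auto simp: simple_plane_graph_def simple_graph_def)
  have "edges G \<subseteq> Pow (verts G)" using simple(2) by blast
  then have finE: "finite (edges G)" using simple(1) finite_subset by blast
  interpret plane_graph "verts G" "edges G" pos \<gamma>
    by unfold_locales (use simple embed in \<open>auto simp: planar_embedding_def\<close>)
  have "card {e \<in> edges G. x \<in> e} \<le> k" for x
  proof (cases "x \<in> verts G")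
    case True
    then have "vdegree G x \<le> max_degree G"
      unfolding max_degree_def using simple(1) by (intro Max_ge) auto
    then show ?thesis using assms(3) by (simp add: vdegree_def)
  next
    case False
    then have "{e \<in> edges G. x \<in> e} = {}" using simple(2) by blast
    then show ?thesis by (metis card.empty le0)
  qed
  moreover have "finite (L e) \<and> card (L e) = k" if "e \<in> edges G" for e
    using assms(2,4) that by (simp add: k_assignment_def line_graph_def)
  ultimately have "line.swappable (edges G) L"
    using swappable_edges[of "edges G" k L] finE assms(3) by simp
  then show ?thesis using L_swappable_line_graph[OF finE] assms(2) by simp
qed

end
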